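(* Let $r=b\,n^\alpha$ with either $b>0$ and $\alpha>1/2$, or $b>\sqrt8$ and $\alpha=1/2$. For each $n\ge2$ let $Z_0\subset\mathbb{R}^n$ be the zero cell of a Poisson hyperplane process with distance exponent $r$ and intensity $$\widehat\gamma(r,n)=\frac r2\,\frac{\omega_n\omega_{r+1}}{\omega_{n+r}}\Big(\Gamma\big(\tfrac nr+1\big)\kappa_n\Big)^{r/n},$$ and let $\overline{Z}_0=V_n(Z_0)^{-1/n}Z_0$. Then there is a constant $C>0$, not depending on $n$, and for any $\varepsilon\in(0,\sqrt e)$ there is an $N_\varepsilon\in\mathbb{N}$, such that for all $n\ge N_\varepsilon$ and all $L\in G(n,n-1)$, $$\mathbb{P}\big(V_{n-1}(\overline{Z}_0\cap L)>\sqrt e-\varepsilon\big)\ \ge\ 1-C\,\varepsilon^{-2}\,H(\alpha,b,n),$$ where $$H(\alpha,b,n)=\begin{cases}\big(2^{2/b-b/4}\big)^{\sqrt n}&:\ \alpha=1/2\text{ and }b>\sqrt8,\\[2pt] \big(2^{-b/4}\big)^{n^\alpha}&:\ 1/2<\alpha<1,\\[2pt] \dfrac1{\sqrt n}\Big(\dfrac{4(b+1)^{b+1}}{(b+2)^{b+2}}\Big)^{n/2}&:\ \alpha=1,\\[6pt] (C\,n^{1-\alpha})^{n/2}&:\ \alpha>1.\end{cases}$$ In particular, the hyperplane conjecture holds asymptotically almost surely for $\overline{Z}_0$ in the sense that $$\lim_{n\to\infty}\mathbb{P}\big(V_{n-1}(\overline{Z}_0\cap L)>\sqrt e-\varepsilon\big)=1$$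 for all $\varepsilon\in(0,\sqrt e)$ and $L\in G(n,n-1)$.
   Context: For real $s>0$ put $\omega_s=2\pi^{s/2}/\Gamma(s/2)$ and $\kappa_s=\pi^{s/2}/\Gamma(s/2+1)$. $G(n,m)$ is the set of $m$-dimensional linear subspaces of $\mathbb{R}^n$. For $n\ge2$, $r>0$ (distance exponent) and $\gamma>0$ (intensity), let $H(u,t)=\{x\in\mathbb{R}^n:\langle x,u\rangle=t\}$ for $u\in\mathbb{S}^{n-1}$, $t\in\mathbb{R}$, and let $\Theta$ be the measure on the space $A(n,n-1)$ of affine hyperplanes of $\mathbb{R}^n$ given by $$\Theta(\,\cdot\,)=\frac{\gamma}{\omega_n}\int_{\mathbb{S}^{n-1}}\int_{\mathbb{R}}\mathbf{1}\{H(u,t)\in\,\cdot\,\}\,|t|^{r-1}\,dt\,\mathcal{H}^{n-1}(du),$$ where $\mathcal{H}^s$ is $s$-dimensional Hausdorff measure. The Poisson hyperplane process $X$ with distance exponent $r$ and intensity $\gamma$ is the Poisson process on $A(n,n-1)$ with intensity measure $\Theta$. Its zero cell is $Z_0=\bigcap_{H\in X}H^-$, where $H^-$ is the closed half-space bounded by $H$ containing the origin; almost surely $Z_0$ is a polytope. $V_n$ is volume in $\mathbb{R}^n$, and $V_{n-1}$ of a subset of a hyperplane is its $(n-1)$-dimensional volume. In the limit statement, $L$ is a hyperplane $L=L_n\in G(n,n-1)$ for each $n$. *)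

theory Defs
  imports "HOL-Probability.Probability"
begin

section \<open>Euclidean space of dimension n, for varying n\<close>

text \<open>
  The dimension is quantified inside the main statement, hence it cannot be a type. A point of
  \<open>n\<close>-dimensional Euclidean space is a function in \<open>{..<n} \<rightarrow>\<^sub>E UNIV\<close>, i.e. a function on the
  indices below \<open>n\<close>, extended by \<open>undefined\<close>; Lebesgue measure is the product measure.
  The product topology of \<open>nat \<Rightarrow> real\<close> induces the Euclidean topology on this carrier.
\<close>

definition Rn :: "nat \<Rightarrow> (nat \<Rightarrow> real) set" where
  "Rn n = ({..<n} \<rightarrow>\<^sub>E UNIV)"

definition volM :: "nat \<Rightarrow> (nat \<Rightarrow> real) measure" where
  "volM n = Pi\<^sub>M {..<n} (\<lambda>_. lborel)"

abbreviation vol :: "nat \<Rightarrow> (nat \<Rightarrow> real) set \<Rightarrow> real" where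
  "vol n A \<equiv> measure (volM n) A"

definition inner_n :: "nat \<Rightarrow> (nat \<Rightarrow> real) \<Rightarrow> (nat \<Rightarrow> real) \<Rightarrow> real" where
  "inner_n n x y = (\<Sum>i<n. x i * y i)"

definition dist_n :: "nat \<Rightarrow> (nat \<Rightarrow> real) \<Rightarrow> (nat \<Rightarrow> real) \<Rightarrow> real" where
  "dist_n n x y = L2_set (\<lambda>i. x i - y i) {..<n}"

definition zero_n :: "nat \<Rightarrow> nat \<Rightarrow> real" where
  "zero_n n = (\<lambda>i\<in>{..<n}. 0)"

definition scale_n :: "nat \<Rightarrow> real \<Rightarrow> (nat \<Rightarrow> real) \<Rightarrow> nat \<Rightarrow> real" where
  "scale_n n c x = (\<lambda>i\<in>{..<n}. c * x i)"

definition lincomb_n :: "nat \<Rightarrow> nat \<Rightarrow> (nat \<Rightarrow> nat \<Rightarrow> real) \<Rightarrow> (nat \<Rightarrow> real) \<Rightarrow> nat \<Rightarrow> real" where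
  "lincomb_n n m v c = (\<lambda>i\<in>{..<n}. \<Sum>j<m. c j * v j i)"

definition sphere_n :: "nat \<Rightarrow> (nat \<Rightarrow> real) set" where
  "sphere_n n = {u \<in> Rn n. L2_set u {..<n} = 1}"

section \<open>Linear subspaces and their volume\<close>

definition is_basis :: "nat \<Rightarrow> nat \<Rightarrow> (nat \<Rightarrow> nat \<Rightarrow> real) \<Rightarrow> (nat \<Rightarrow> real) set \<Rightarrow> bool" where
  "is_basis n m v L \<longleftrightarrow>
     (\<forall>j<m. v j \<in> Rn n) \<and>
     (\<forall>c. lincomb_n n m v c = zero_n n \<longrightarrow> (\<forall>j<m. c j = 0)) \<and>
     L = range (lincomb_n n m v)"

definition is_orthonormal_basis :: "nat \<Rightarrow> nat \<Rightarrow> (nat \<Rightarrow> nat \<Rightarrow> real) \<Rightarrow> (nat \<Rightarrow> real) set \<Rightarrow> bool" where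
  "is_orthonormal_basis n m v L \<longleftrightarrow>
     is_basis n m v L \<and> (\<forall>i<m. \<forall>j<m. inner_n n (v i) (v j) = (if i = j then 1 else 0))"

definition grassmannian :: "nat \<Rightarrow> nat \<Rightarrow> (nat \<Rightarrow> real) set set" where
  "grassmannian n m = {L. \<exists>v. is_basis n m v L}"

text \<open>
  The \<open>m\<close>-dimensional volume of a subset of an \<open>m\<close>-dimensional linear subspace \<open>L\<close> is Lebesgue
  measure in orthonormal coordinates; it does not depend on the chosen orthonormal basis.
\<close>

definition subspace_vol :: "nat \<Rightarrow> nat \<Rightarrow> (nat \<Rightarrow> real) set \<Rightarrow> (nat \<Rightarrow> real) set \<Rightarrow> real" where
  "subspace_vol n m L A =
     (let v = (SOME v. is_orthonormal_basis n m v L)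
      in vol m {c \<in> Rn m. lincomb_n n m v c \<in> A})"

section \<open>Constants and Hausdorff measure\<close>

definition omega :: "real \<Rightarrow> real" where
  "omega s = 2 * pi powr (s / 2) / Gamma (s / 2)"

definition kappa :: "real \<Rightarrow> real" where
  "kappa s = pi powr (s / 2) / Gamma (s / 2 + 1)"

definition diam_n :: "nat \<Rightarrow> (nat \<Rightarrow> real) set \<Rightarrow> ennreal" where
  "diam_n n U = (SUP x\<in>U. SUP y\<in>U. ennreal (dist_n n x y))"

text \<open>
  Hausdorff outer measure of real dimension \<open>s > 0\<close>, normalised so that it agrees with Lebesgue
  measure for \<open>s = n\<close>. The sets used for covering have diameter at most \<open>\<delta> < \<infinity>\<close>, so \<open>enn2real\<close>
  loses nothing. (For \<open>s = 0\<close> the convention \<open>0 powr 0 = 0\<close> would give the wrong value.)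
\<close>

definition hausdorff_pre :: "nat \<Rightarrow> real \<Rightarrow> real \<Rightarrow> (nat \<Rightarrow> real) set \<Rightarrow> ennreal" where
  "hausdorff_pre n s \<delta> A =
     (INF U \<in> {U :: nat \<Rightarrow> (nat \<Rightarrow> real) set.
                 (\<forall>i. U i \<subseteq> Rn n \<and> diam_n n (U i) \<le> ennreal \<delta>) \<and> A \<subseteq> (\<Union>i. U i)}.
        \<Sum>i. ennreal (kappa s * (enn2real (diam_n n (U i)) / 2) powr s))"

definition hausdorff :: "nat \<Rightarrow> real \<Rightarrow> (nat \<Rightarrow> real) set \<Rightarrow> ennreal" where
  "hausdorff n s A = (SUP \<delta>\<in>{0<..}. hausdorff_pre n s \<delta> A)"

text \<open>The \<open>(n - 1)\<close>-dimensional Hausdorff measure on the Borel sets of the unit sphere.\<close>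

definition sphereM :: "nat \<Rightarrow> (nat \<Rightarrow> real) measure" where
  "sphereM n = measure_of (sphere_n n) (sets (restrict_space (volM n) (sphere_n n)))
                 (hausdorff n (real n - 1))"

section \<open>Hyperplanes\<close>

definition hyperplane :: "nat \<Rightarrow> (nat \<Rightarrow> real) \<Rightarrow> real \<Rightarrow> (nat \<Rightarrow> real) set" where
  "hyperplane n u t = {x \<in> Rn n. inner_n n x u = t}"

definition hyperplanes :: "nat \<Rightarrow> (nat \<Rightarrow> real) set set" where
  "hyperplanes n = {hyperplane n u t | u t. u \<in> sphere_n n}"

text \<open>The Borel \<open>\<sigma>\<close>-algebra of the space of affine hyperplanes is generated by the sets of
  hyperplanes hitting a given compact set.\<close>

definition hitting :: "nat \<Rightarrow> (nat \<Rightarrow> real) set \<Rightarrow> (nat \<Rightarrow> real) set set" where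
  "hitting n K = {H \<in> hyperplanes n. H \<inter> K \<noteq> {}}"

definition hyperplane_sets :: "nat \<Rightarrow> (nat \<Rightarrow> real) set set set" where
  "hyperplane_sets n = sigma_sets (hyperplanes n) {hitting n K | K. K \<subseteq> Rn n \<and> compact K}"

definition hyperplane_intensity :: "nat \<Rightarrow> real \<Rightarrow> real \<Rightarrow> (nat \<Rightarrow> real) set measure" where
  "hyperplane_intensity n r \<gamma> =
     measure_of (hyperplanes n) (hyperplane_sets n)
       (\<lambda>A. ennreal (\<gamma> / omega (real n)) *
            (\<integral>\<^sup>+ u. (\<integral>\<^sup>+ t. indicator A (hyperplane n u t) * ennreal (\<bar>t\<bar> powr (r - 1)) \<partial>lborel)
              \<partial>sphereM n))"

section \<open>Poisson processes\<close>

definition num_points :: "'a set \<Rightarrow> 'a set \<Rightarrow> ennreal" where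
  "num_points S A = emeasure (count_space UNIV) (S \<inter> A)"

text \<open>
  A (simple) Poisson process is a random set of points. No generality is lost compared to random
  counting measures, since the intensity measures used here are \<open>\<sigma>\<close>-finite and without atoms.
\<close>

definition poisson_process :: "'w measure \<Rightarrow> 'a measure \<Rightarrow> ('w \<Rightarrow> 'a set) \<Rightarrow> bool" where
  "poisson_process P \<Theta> X \<longleftrightarrow>
     prob_space P \<and>
     (\<forall>\<omega>\<in>space P. X \<omega> \<subseteq> space \<Theta>) \<and>
     (\<forall>A\<in>sets \<Theta>. (\<lambda>\<omega>. num_points (X \<omega>) A) \<in> borel_measurable P) \<and>
     (\<forall>A\<in>sets \<Theta>. emeasure \<Theta> A < \<infinity> \<longrightarrow>
        (\<forall>k::nat. measure P {\<omega>\<in>space P. num_points (X \<omega>) A = of_nat k} =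
                  measure \<Theta> A ^ k / fact k * exp (- measure \<Theta> A))) \<and>
     (\<forall>A\<in>sets \<Theta>. emeasure \<Theta> A = \<infinity> \<longrightarrow> (AE \<omega> in P. num_points (X \<omega>) A = \<infinity>)) \<and>
     (\<forall>(A :: nat \<Rightarrow> 'a set) I. finite I \<and> (\<forall>i\<in>I. A i \<in> sets \<Theta>) \<and> disjoint_family_on A I \<longrightarrow>
        prob_space.indep_vars P (\<lambda>_. borel) (\<lambda>i \<omega>. num_points (X \<omega>) (A i)) I)"

text \<open>As usual for point processes, the realisations are locally finite.\<close>

definition poisson_hyperplane_process ::
    "nat \<Rightarrow> real \<Rightarrow> real \<Rightarrow> 'w measure \<Rightarrow> ('w \<Rightarrow> (nat \<Rightarrow> real) set set) \<Rightarrow> bool" where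
  "poisson_hyperplane_process n r \<gamma> P X \<longleftrightarrow>
     poisson_process P (hyperplane_intensity n r \<gamma>) X \<and>
     (\<forall>\<omega>\<in>space P. \<forall>K. K \<subseteq> Rn n \<and> compact K \<longrightarrow> finite (X \<omega> \<inter> hitting n K))"

section \<open>The zero cell\<close>

text \<open>
  The closed half-space bounded by \<open>H\<close> that contains the origin. It is unique, and the union below
  is just this half-space, unless \<open>H\<close> passes through the origin; almost surely no hyperplane of
  the process does.
\<close>

definition halfspace0 :: "nat \<Rightarrow> (nat \<Rightarrow> real) set \<Rightarrow> (nat \<Rightarrow> real) set" where
  "halfspace0 n H =
     \<Union> {W. zero_n n \<in> W \<and>
           (\<exists>u\<in>sphere_n n. \<exists>t. H = hyperplane n u t \<and> W = {x \<in> Rn n. inner_n n x u \<le> t})}"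

definition zero_cell :: "nat \<Rightarrow> (nat \<Rightarrow> real) set set \<Rightarrow> (nat \<Rightarrow> real) set" where
  "zero_cell n S = {x \<in> Rn n. \<forall>H\<in>S. x \<in> halfspace0 n H}"

definition normalized :: "nat \<Rightarrow> (nat \<Rightarrow> real) set \<Rightarrow> (nat \<Rightarrow> real) set" where
  "normalized n Z = scale_n n (vol n Z powr (- 1 / real n)) ` Z"

definition gamma_hat :: "real \<Rightarrow> nat \<Rightarrow> real" where
  "gamma_hat r n =
     r / 2 * (omega (real n) * omega (r + 1) / omega (real n + r)) *
     (Gamma (real n / r + 1) * kappa (real n)) powr (r / real n)"

text \<open>\<open>C\<close> is the constant in the case \<open>\<alpha> > 1\<close>; the first case is meant for \<open>b > sqrt 8\<close>.\<close>

definition rate_H :: "real \<Rightarrow> real \<Rightarrow> real \<Rightarrow> nat \<Rightarrow> real" where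
  "rate_H C \<alpha> b n =
     (if \<alpha> = 1 / 2 then (2 powr (2 / b - b / 4)) powr sqrt (real n)
      else if \<alpha> < 1 then (2 powr (- b / 4)) powr (real n powr \<alpha>)
      else if \<alpha> = 1 then
        1 / sqrt (real n) *
        (4 * (b + 1) powr (b + 1) / (b + 2) powr (b + 2)) powr (real n / 2)
      else (C * real n powr (1 - \<alpha>)) powr (real n / 2))"

definition section_prob ::
    "nat \<Rightarrow> 'w measure \<Rightarrow> ('w \<Rightarrow> (nat \<Rightarrow> real) set set) \<Rightarrow> (nat \<Rightarrow> real) set \<Rightarrow> real \<Rightarrow> real" where
  "section_prob n P X L a =
     measure P {\<omega>\<in>space P. subspace_vol n (n - 1) L (normalized n (zero_cell n (X \<omega>)) \<inter> L) > a}"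

end

theory Submission
  imports Defs "HOL-Real_Asymp.Real_Asymp"
begin

text \<open>
The normalized cell does not change when the cell is dilated, so the exact intensity is irrelevant and
about the Hausdorff measure on the sphere only finiteness, positivity and rotation invariance matter.
A point \<open>x\<close> lies in the zero cell iff no hyperplane separates it strictly from the origin, an event of
probability \<open>exp (- k |x|\<^sup>r)\<close>, while the two events for \<open>x\<close> and \<open>y\<close> are correlated only through the
hyperplanes separating both points from the origin. By Fubini this yields the mean of the volume of an
\<open>m\<close>-dimensional section (for \<open>m = n - 1\<close> and for \<open>m = n\<close>); writing \<open>exp (- k |x|\<^sup>r)\<close> as a mixture of indicators
of balls bounds its relative variance by a quotient of Gamma values times an integral of squared volumes
of caps of the ball. That bound has the order of the rate \<open>H\<close>. Chebyshev's inequality for the section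
volume and for the cell volume then puts \<open>V\<^sub>n\<^sub>-\<^sub>1(Z \<inter> L) V\<^sub>n(Z) powr (- (n - 1) / n)\<close> close to the same
expression in the means, which tends to \<open>sqrt e\<close> by the log-convexity of Gamma.
\<close>

section \<open>Coordinates and Lebesgue measure on n-space\<close>

text \<open>No volume of the sphere is ever computed: its finiteness is read off from the local
  finiteness of the process, its positivity from a cube, and whatever else it contributes sits in
  the constant \<open>k\<close>, which cancels in the relative variance and in the quotient of the
  means. The covariance is bounded through the larger of the two norms. Under the mixture over balls
  both points then range over the same ball, and for a fixed hyperplane the integral over pairs
  factorises into a squared cap volume. The resulting bound \<open>rel_var\<close> has two
  exponential factors. One is 4^(m/r), from the fluctuation of the radius in the mixture; the other
  is \<open>gamma_T (r / 2) (m / 2)\<close>, from the caps, and it is about 2^(-r/2) as long as r is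
  small against m. At alpha = 1/2 both are exponential in sqrt n, and the rate H gives away half of
  the exponent of the second: b > sqrt 8 says exactly that 2/b < b/4. For r small against m, of the
  order of m, and large against m, \<open>gamma_T\<close> is bounded in three different
  ways.\<close>

lemma Rn_iff: "x \<in> Rn n \<longleftrightarrow> (\<forall>i. i \<ge> n \<longrightarrow> x i = undefined)"
  by (auto simp: Rn_def PiE_def extensional_def Pi_def)

lemma Rn_eqI: "x \<in> Rn n \<Longrightarrow> y \<in> Rn n \<Longrightarrow> (\<And>i. i < n \<Longrightarrow> x i = y i) \<Longrightarrow> x = y"
  by (metis Rn_iff ext not_le)

lemma scale_n_in_Rn [simp]: "scale_n n c x \<in> Rn n"
  by (simp add: Rn_iff scale_n_def)

lemma lincomb_n_in_Rn [simp]: "lincomb_n n m v c \<in> Rn n"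
  by (simp add: Rn_iff lincomb_n_def)

lemma zero_n_in_Rn [simp]: "zero_n n \<in> Rn n"
  by (simp add: Rn_iff zero_n_def)

lemma space_volM [simp]: "space (volM n) = Rn n"
  by (simp add: volM_def space_PiM Rn_def)

abbreviation norm_n :: "nat \<Rightarrow> (nat \<Rightarrow> real) \<Rightarrow> real" where
  "norm_n n x \<equiv> L2_set x {..<n}"

lemma norm_n_sqrt: "norm_n n x = sqrt (inner_n n x x)"
  by (simp add: L2_set_def inner_n_def power2_eq_square)

lemma norm_n_power2: "(norm_n n x)\<^sup>2 = inner_n n x x"
  by (simp add: norm_n_sqrt inner_n_def sum_nonneg)

lemma inner_n_commute: "inner_n n x y = inner_n n y x"
  by (simp add: inner_n_def mult.commute)

lemma inner_n_scale_left [simp]: "inner_n n (scale_n n c x) y = c * inner_n n x y"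
  by (simp add: inner_n_def scale_n_def sum_distrib_left mult.assoc)

lemma inner_n_scale_right [simp]: "inner_n n x (scale_n n c y) = c * inner_n n x y"
  by (metis inner_n_commute inner_n_scale_left)

lemma inner_n_zero_left [simp]: "inner_n n (zero_n n) y = 0"
  by (simp add: inner_n_def zero_n_def)

lemma norm_n_scale [simp]: "norm_n n (scale_n n c x) = \<bar>c\<bar> * norm_n n x"
  by (simp add: norm_n_sqrt real_sqrt_mult flip: mult.assoc)

interpretation lb: product_sigma_finite "\<lambda>_::nat. lborel :: real measure"
  by standard

lemma sets_volM_cong [measurable_cong]: "sets (volM n) = sets (Pi\<^sub>M {..<n} (\<lambda>_. borel))"
  unfolding volM_def by (intro sets_PiM_cong) auto

lemma sigma_finite_volM: "sigma_finite_measure (volM n)"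
  unfolding volM_def by (rule lb.sigma_finite) simp

lemma measurable_volM_component:
  assumes "f \<in> M \<rightarrow>\<^sub>M volM n" "i < n"
  shows "(\<lambda>x. f x i) \<in> borel_measurable M"
proof -
  have "(\<lambda>x. x i) \<in> volM n \<rightarrow>\<^sub>M borel"
    using measurable_component_singleton[of i "{..<n}" "\<lambda>_. lborel :: real measure"] assms(2)
    by (simp add: volM_def)
  from measurable_compose[OF assms(1) this] show ?thesis .
qed

lemma measurable_inner_n [measurable]:
  assumes [measurable]: "f \<in> M \<rightarrow>\<^sub>M volM n" "g \<in> M \<rightarrow>\<^sub>M volM n"
  shows "(\<lambda>x. inner_n n (f x) (g x)) \<in> borel_measurable M"
  unfolding inner_n_def
  by (intro borel_measurable_sum borel_measurable_times measurable_volM_component[where n=n] assms) auto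

lemma measurable_norm_n [measurable]:
  assumes [measurable]: "f \<in> M \<rightarrow>\<^sub>M volM n"
  shows "(\<lambda>x. norm_n n (f x)) \<in> borel_measurable M"
  unfolding norm_n_sqrt by measurable

lemma sphere_n_sets [measurable]: "sphere_n n \<in> sets (volM n)"
proof -
  have "sphere_n n = {x \<in> space (volM n). norm_n n x = 1}"
    by (auto simp: sphere_n_def)
  also have "\<dots> \<in> sets (volM n)" by measurable
  finally show ?thesis .
qed

section \<open>Plane rotations, shears and the invariance of Lebesgue measure\<close>

definition givens :: "nat \<Rightarrow> nat \<Rightarrow> real \<Rightarrow> real \<Rightarrow> (nat \<Rightarrow> real) \<Rightarrow> nat \<Rightarrow> real" where
  "givens i j c s x = x(i := c * x i - s * x j, j := s * x i + c * x j)"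

definition shear :: "nat \<Rightarrow> nat \<Rightarrow> real \<Rightarrow> (nat \<Rightarrow> real) \<Rightarrow> nat \<Rightarrow> real" where
  "shear i j a x = x(i := x i + a * x j)"

definition axis_n :: "nat \<Rightarrow> real \<Rightarrow> nat \<Rightarrow> real" where
  "axis_n n a = (\<lambda>i\<in>{..<n}. if i = 0 then a else 0)"

lemma axis_n_in_Rn [simp]: "axis_n n a \<in> Rn n"
  by (simp add: axis_n_def Rn_iff)

lemma givens_in_Rn: "i < n \<Longrightarrow> j < n \<Longrightarrow> x \<in> Rn n \<Longrightarrow> givens i j c s x \<in> Rn n"
  by (simp add: Rn_iff givens_def)

lemma sum_two_split:
  fixes f :: "nat \<Rightarrow> real"
  assumes "i < n" "j < n" "i \<noteq> j"
  shows "(\<Sum>l<n. f l) = f i + f j + (\<Sum>l\<in>{..<n} - {i, j}. f l)"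
proof -
  have "(\<Sum>l<n. f l) = f i + (\<Sum>l\<in>{..<n} - {i}. f l)"
    using assms by (subst sum.remove[of _ i]) auto
  also have "(\<Sum>l\<in>{..<n} - {i}. f l) = f j + (\<Sum>l\<in>{..<n} - {i} - {j}. f l)"
    using assms by (subst sum.remove[of _ j]) auto
  also have "{..<n} - {i} - {j} = {..<n} - {i, j}" by auto
  finally show ?thesis by simp
qed

text \<open>The adjoint of a rotation is the rotation by the opposite angle. This is how a rotation
  is moved from a point to the normal vector of a hyperplane and back.\<close>

lemma inner_givens_left:
  assumes "i < n" "j < n" "i \<noteq> j"
  shows "inner_n n (givens i j c s x) y = inner_n n x (givens i j c (- s) y)"
  using assms unfolding inner_n_def
  by (subst (1 2) sum_two_split[of i n j]) (auto simp: givens_def algebra_simps intro!: sum.cong)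

lemma givens_inverse:
  assumes "i \<noteq> j" "c\<^sup>2 + s\<^sup>2 = 1"
  shows "givens i j c (- s) (givens i j c s x) = x"
proof -
  have 1: "c * (c * x i - s * x j) + s * (s * x i + c * x j) = x i"
    using arg_cong[OF assms(2), of "\<lambda>t. t * x i"] by (simp add: algebra_simps power2_eq_square)
  have 2: "c * (s * x i + c * x j) - s * (c * x i - s * x j) = x j"
    using arg_cong[OF assms(2), of "\<lambda>t. t * x j"] by (simp add: algebra_simps power2_eq_square)
  show ?thesis
    using 1 2 assms(1) by (auto simp: givens_def fun_eq_iff)
qed

lemma inner_givens:
  assumes "i < n" "j < n" "i \<noteq> j" "c\<^sup>2 + s\<^sup>2 = 1"
  shows "inner_n n (givens i j c s x) (givens i j c s y) = inner_n n x y"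
  using assms by (simp add: inner_givens_left givens_inverse)

lemma norm_givens:
  assumes "i < n" "j < n" "i \<noteq> j" "c\<^sup>2 + s\<^sup>2 = 1"
  shows "norm_n n (givens i j c s x) = norm_n n x"
  using assms by (simp add: norm_n_sqrt inner_givens)

text \<open>A rotation of the plane (0, j) clears coordinate j, so finitely many of them carry any
  vector to the first axis; the induction counts the nonzero coordinates other than coordinate 0.
  Invariance under rotations of coordinate planes thus already means dependence on the norm alone,
  and general orthogonal maps can be avoided.\<close>

lemma rotation_invariant_reduce:
  fixes F :: "(nat \<Rightarrow> real) \<Rightarrow> 'b"
  assumes n: "n \<ge> 2" and x: "x \<in> Rn n"
    and F: "\<And>i j c s x. i < n \<Longrightarrow> j < n \<Longrightarrow> i \<noteq> j \<Longrightarrow> c\<^sup>2 + s\<^sup>2 = 1 \<Longrightarrow> x \<in> Rn n \<Longrightarrow>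
               F (givens i j c s x) = F x"
  shows "F x = F (axis_n n (norm_n n x))"
  using x
proof (induction "card {j. 0 < j \<and> j < n \<and> x j \<noteq> 0}" arbitrary: x rule: less_induct)
  case less
  show ?case
  proof (cases "\<exists>j. 0 < j \<and> j < n \<and> x j \<noteq> 0")
    case True
    then obtain j where j: "0 < j" "j < n" "x j \<noteq> 0" by blast
    define \<rho> where "\<rho> = sqrt ((x 0)\<^sup>2 + (x j)\<^sup>2)"
    have "0 < (x 0)\<^sup>2 + (x j)\<^sup>2" using j by (intro add_nonneg_pos) auto
    then have \<rho>: "\<rho> > 0" "\<rho>\<^sup>2 = (x 0)\<^sup>2 + (x j)\<^sup>2"
      by (auto simp: \<rho>_def)
    \<comment> \<open>Cosine and sine of the angle that turns (x 0, x j) into (rho, 0).\<close>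
    define y where "y = givens 0 j (x 0 / \<rho>) (- x j / \<rho>) x"
    have cs: "(x 0 / \<rho>)\<^sup>2 + (- x j / \<rho>)\<^sup>2 = 1"
    proof -
      have "(x 0 / \<rho>)\<^sup>2 + (- x j / \<rho>)\<^sup>2 = ((x 0)\<^sup>2 + (x j)\<^sup>2) / \<rho>\<^sup>2"
        by (simp add: power_divide add_divide_distrib)
      then show ?thesis using \<rho>(1) unfolding \<rho>(2)[symmetric] by simp
    qed
    have y: "y \<in> Rn n" using less.prems j n by (auto simp: y_def intro: givens_in_Rn)
    have yj: "y j = 0" using j by (simp add: y_def givens_def)
    have yl: "y l = x l" if "l \<noteq> 0" "l \<noteq> j" for l using that by (simp add: y_def givens_def)
    have "{l. 0 < l \<and> l < n \<and> y l \<noteq> 0} \<subset> {l. 0 < l \<and> l < n \<and> x l \<noteq> 0}"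
    proof
      show "{l. 0 < l \<and> l < n \<and> y l \<noteq> 0} \<subseteq> {l. 0 < l \<and> l < n \<and> x l \<noteq> 0}"
      proof (intro Collect_mono impI)
        fix l assume l: "0 < l \<and> l < n \<and> y l \<noteq> 0"
        then have "l \<noteq> j" using yj by auto
        with l yl[of l] show "0 < l \<and> l < n \<and> x l \<noteq> 0" by simp
      qed
      show "{l. 0 < l \<and> l < n \<and> y l \<noteq> 0} \<noteq> {l. 0 < l \<and> l < n \<and> x l \<noteq> 0}"
        using yj j by blast
    qed
    then have "card {l. 0 < l \<and> l < n \<and> y l \<noteq> 0} < card {l. 0 < l \<and> l < n \<and> x l \<noteq> 0}"
      by (intro psubset_card_mono) auto
    from less.hyps[OF this y] have "F y = F (axis_n n (norm_n n y))" .
    moreover have "F y = F x" unfolding y_def using cs j n less.prems by (intro F) auto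
    moreover have "norm_n n y = norm_n n x" unfolding y_def using cs j n by (intro norm_givens) auto
    ultimately show ?thesis by simp
  next
    case False
    then have z: "x l = 0" if "0 < l" "l < n" for l using that by blast
    have "inner_n n x x = x 0 * x 0 + x 1 * x 1 + (\<Sum>l\<in>{..<n} - {0, 1}. x l * x l)"
      unfolding inner_n_def using n by (intro sum_two_split) auto
    also have "\<dots> = (x 0)\<^sup>2" using z n by (simp add: power2_eq_square)
    finally have nx: "norm_n n x = \<bar>x 0\<bar>" by (simp add: norm_n_sqrt)
    show ?thesis
    proof (cases "x 0 \<ge> 0")
      case True
      have "x = axis_n n (norm_n n x)" using True less.prems z nx
        by (intro Rn_eqI[of _ n] axis_n_in_Rn) (auto simp: axis_n_def)
      then show ?thesis by simp
    next
      case False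
      \<comment> \<open>A half turn of the plane (0, 1) repairs the sign of the first coordinate; a
        second coordinate is available since n >= 2.\<close>
      have "axis_n n (norm_n n x) = givens 0 1 (-1) 0 x"
        using less.prems z n False unfolding nx
        by (intro Rn_eqI[of _ n] axis_n_in_Rn givens_in_Rn) (auto simp: axis_n_def givens_def)
      moreover have "F (givens 0 1 (-1) 0 x) = F x" using n less.prems by (intro F) auto
      ultimately show ?thesis by simp
    qed
  qed
qed

lemma measurable_volM_fun_upd:
  assumes [measurable]: "f \<in> M \<rightarrow>\<^sub>M volM n" "g \<in> borel_measurable M" and i: "i < n"
  shows "(\<lambda>x. (f x)(i := g x)) \<in> M \<rightarrow>\<^sub>M volM n"
proof -
  have "(\<lambda>x. (f x)(i := g x)) \<in> M \<rightarrow>\<^sub>M Pi\<^sub>M {..<n} (\<lambda>_. lborel)"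
    using i by (intro measurable_fun_upd[where J="{..<n}"]) (auto simp flip: volM_def)
  then show ?thesis by (simp add: volM_def)
qed

lemma measurable_shear:
  "i < n \<Longrightarrow> j < n \<Longrightarrow> shear i j a \<in> volM n \<rightarrow>\<^sub>M volM n"
  unfolding shear_def by (intro measurable_volM_fun_upd) auto

lemma measurable_givens:
  "i < n \<Longrightarrow> j < n \<Longrightarrow> givens i j c s \<in> volM n \<rightarrow>\<^sub>M volM n"
  unfolding givens_def by (intro measurable_volM_fun_upd) auto

lemma nn_integral_volM_split:
  assumes i: "i < n" and f: "f \<in> borel_measurable (volM n)"
  shows "(\<integral>\<^sup>+x. f x \<partial>volM n) =
           (\<integral>\<^sup>+x. (\<integral>\<^sup>+y. f (x(i := y)) \<partial>lborel) \<partial>Pi\<^sub>M ({..<n} - {i}) (\<lambda>_. lborel))" (is "?a = ?b")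
    and "(\<integral>\<^sup>+x. f x \<partial>volM n) =
           (\<integral>\<^sup>+y. (\<integral>\<^sup>+x. f (x(i := y)) \<partial>Pi\<^sub>M ({..<n} - {i}) (\<lambda>_. lborel)) \<partial>lborel)" (is "_ = ?c")
proof -
  have I: "volM n = Pi\<^sub>M (insert i ({..<n} - {i})) (\<lambda>_. lborel)"
    using i unfolding volM_def by (simp add: insert_absorb)
  note f' = f[unfolded I]
  show "?a = ?b" unfolding I by (rule lb.product_nn_integral_insert[OF _ _ f']) auto
  show "?a = ?c" unfolding I by (rule lb.product_nn_integral_insert_rev[OF _ _ f']) auto
qed

text \<open>With the other coordinates fixed, a shear translates coordinate i. Fubini with that
  coordinate innermost leaves translation invariance on the line.\<close>

lemma distr_shear:
  assumes ij: "i < n" "j < n" "i \<noteq> j"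
  shows "distr (volM n) (volM n) (shear i j a) = volM n"
proof (rule measure_eqI)
  fix A assume "A \<in> sets (distr (volM n) (volM n) (shear i j a))"
  then have A [measurable]: "A \<in> sets (volM n)" by simp
  note [measurable] = measurable_shear[OF ij(1,2), of a]
  let ?I = "{..<n} - {i}"
  let ?M = "Pi\<^sub>M ?I (\<lambda>_. lborel :: real measure)"
  have I: "volM n = Pi\<^sub>M (insert i ?I) (\<lambda>_. lborel)"
    using ij unfolding volM_def by (simp add: insert_absorb)
  have upd: "(\<lambda>y. x(i := y)) \<in> borel \<rightarrow>\<^sub>M volM n" if "x \<in> space ?M" for x
  proof -
    have "(\<lambda>y. x(i := y)) \<in> borel \<rightarrow>\<^sub>M Pi\<^sub>M (insert i ?I) (\<lambda>_. lborel)"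
      using that by (intro measurable_fun_upd[where J="?I"]) auto
    then show ?thesis using I by simp
  qed
  have "emeasure (distr (volM n) (volM n) (shear i j a)) A = (\<integral>\<^sup>+x. indicator A (shear i j a x) \<partial>volM n)"
    using nn_integral_distr[of "shear i j a" "volM n" "volM n" "indicator A"] by simp
  also have "\<dots> = (\<integral>\<^sup>+x. (\<integral>\<^sup>+y. indicator A (shear i j a (x(i := y))) \<partial>lborel) \<partial>?M)"
    using ij by (intro nn_integral_volM_split) auto
  also have "\<dots> = (\<integral>\<^sup>+x. (\<integral>\<^sup>+y. indicator A (x(i := y)) \<partial>lborel) \<partial>?M)"
  proof (rule nn_integral_cong)
    fix x assume x: "x \<in> space ?M"
    note [measurable] = upd[OF x]
    have "(\<integral>\<^sup>+y. indicator A (x(i := y)) \<partial>lborel)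
        = (\<integral>\<^sup>+y. indicator A (x(i := a * x j + y)) \<partial>lborel)"
      by (subst nn_integral_real_affine[where c=1 and t="a * x j"]) auto
    moreover have "shear i j a (x(i := y)) = x(i := a * x j + y)" for y
      using ij by (auto simp: shear_def)
    ultimately show "(\<integral>\<^sup>+y. indicator A (shear i j a (x(i := y))) \<partial>lborel) =
      (\<integral>\<^sup>+y. indicator A (x(i := y)) \<partial>lborel)" by simp
  qed
  also have "\<dots> = (\<integral>\<^sup>+x. indicator A x \<partial>volM n)"
    using ij by (intro nn_integral_volM_split[symmetric]) auto
  also have "\<dots> = emeasure (volM n) A" by simp
  finally show "emeasure (distr (volM n) (volM n) (shear i j a)) A = emeasure (volM n) A" .
qed simp

text \<open>Factoring a rotation into three shears makes its invariance of Lebesgue measure a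
  consequence of \<open>distr_shear\<close>, without determinants.\<close>

lemma givens_eq_shears:
  assumes "i \<noteq> j" "c\<^sup>2 + s\<^sup>2 = 1" "s \<noteq> 0"
  shows "givens i j c s = shear i j ((c - 1) / s) \<circ> (shear j i s \<circ> shear i j ((c - 1) / s))"
proof
  fix x
  have e: "(1 - c) * (1 + c) = s * s" using assms(2) by (simp add: algebra_simps power2_eq_square)
  have 1: "c * x i - s * x j = x i + (c - 1) / s * x j + (c - 1) / s * (x j + s * (x i + (c - 1) / s * x j))"
  proof -
    have "x i + (c - 1) / s * x j + (c - 1) / s * (x j + s * (x i + (c - 1) / s * x j))
        = c * x i + (c - 1) / s * (1 + c) * x j"
      using assms(3) by (simp add: field_simps)
    also have "(c - 1) / s * (1 + c) = - s"
      using e assms(3) by (simp add: field_simps)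
    finally show ?thesis by simp
  qed
  have 2: "s * x i + c * x j = x j + s * (x i + (c - 1) / s * x j)"
    using assms(3) by (simp add: field_simps)
  show "givens i j c s x = (shear i j ((c - 1) / s) \<circ> (shear j i s \<circ> shear i j ((c - 1) / s))) x"
    using 1 2 assms(1) by (auto simp: givens_def shear_def fun_eq_iff)
qed

lemma distr_givens:
  assumes ij: "i < n" "j < n" "i \<noteq> j" and cs: "c\<^sup>2 + s\<^sup>2 = 1"
  shows "distr (volM n) (volM n) (givens i j c s) = volM n"
proof -
  have *: "distr (volM n) (volM n) (givens i j c s) = volM n" if "c\<^sup>2 + s\<^sup>2 = 1" "s \<noteq> 0" for c s
  proof -
    note m = measurable_shear[OF ij(1,2)] measurable_shear[OF ij(2,1)]
    have "distr (volM n) (volM n) (givens i j c s) =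
      distr (distr (distr (volM n) (volM n) (shear i j ((c - 1) / s))) (volM n) (shear j i s)) (volM n) (shear i j ((c - 1) / s))"
      unfolding givens_eq_shears[OF ij(3) that]
      using m by (simp add: distr_distr measurable_comp)
    also have "\<dots> = volM n"
      using ij by (simp add: distr_shear)
    finally show ?thesis .
  qed
  show ?thesis
  proof (cases "s = 0")
    case False then show ?thesis using * cs by blast
  next
    case True
    then have "c = 1 \<or> c = -1" using cs by (simp add: power2_eq_1_iff)
    then show ?thesis
    proof
      assume "c = 1"
      then have "givens i j c s = (\<lambda>x. x)" using True by (auto simp: givens_def)
      then show ?thesis by (simp add: distr_id2)
    next
      assume "c = -1"
      \<comment> \<open>The factorisation into shears divides by the sine, so the half turn is
        written as two quarter turns.\<close>
      then have "givens i j c s = givens i j 0 1 \<circ> givens i j 0 1"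
        using True ij by (auto simp: givens_def fun_eq_iff)
      then have "distr (volM n) (volM n) (givens i j c s) = distr (distr (volM n) (volM n) (givens i j 0 1)) (volM n) (givens i j 0 1)"
        using measurable_givens[OF ij(1,2)] by (simp add: distr_distr)
      then show ?thesis using *[of 0 1] by simp
    qed
  qed
qed

text \<open>A product measure is determined by its values on boxes, where the claim splits into
  scalings of the line.\<close>

lemma distr_scale_n:
  assumes a: "a \<noteq> 0"
  shows "distr (volM n) (volM n) (scale_n n a) = density (volM n) (\<lambda>_. ennreal ((1 / \<bar>a\<bar>) ^ n))"
proof -
  have m [measurable]: "scale_n n b \<in> volM n \<rightarrow>\<^sub>M volM n" for b
    unfolding scale_n_def volM_def by measurable
  have "density (distr (volM n) (volM n) (scale_n n a)) (\<lambda>_. ennreal (\<bar>a\<bar> ^ n)) = Pi\<^sub>M {..<n} (\<lambda>_. lborel)"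
  proof (rule lb.PiM_eqI)
    fix A :: "nat \<Rightarrow> real set" assume A: "\<And>i. i \<in> {..<n} \<Longrightarrow> A i \<in> sets lborel"
    let ?B = "\<lambda>i. (\<lambda>x. a * x) -` A i"
    have B: "?B i \<in> sets lborel" if "i < n" for i
    proof -
      have "(\<lambda>x. a * x) -` A i \<inter> space borel \<in> sets borel"
        using A[of i] that by (intro measurable_sets[of _ borel borel]) auto
      then show ?thesis by simp
    qed
    have AP: "Pi\<^sub>E {..<n} A \<in> sets (volM n)" unfolding volM_def using A by (intro sets_PiM_I_finite) auto
    have "scale_n n a -` Pi\<^sub>E {..<n} A \<inter> Rn n = Pi\<^sub>E {..<n} ?B"
      by (auto simp: PiE_iff scale_n_def Rn_def)
    then have "emeasure (distr (volM n) (volM n) (scale_n n a)) (Pi\<^sub>E {..<n} A) = (\<Prod>i<n. emeasure lborel (?B i))"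
      using AP B by (simp add: emeasure_distr) (subst volM_def, subst lb.emeasure_PiM, auto)
    moreover have "ennreal \<bar>a\<bar> * emeasure lborel (?B i) = emeasure lborel (A i)" if "i < n" for i
    proof -
      have "emeasure lborel (A i) = (\<integral>\<^sup>+x. indicator (A i) x \<partial>lborel)" using A[of i] that by simp
      also have "\<dots> = ennreal \<bar>a\<bar> * (\<integral>\<^sup>+x. indicator (A i) (0 + a * x) \<partial>lborel)"
        using A[of i] that a by (intro nn_integral_real_affine) auto
      also have "(\<integral>\<^sup>+x. indicator (A i) (0 + a * x) \<partial>lborel) = (\<integral>\<^sup>+x. indicator (?B i) x \<partial>lborel)"
        by (intro nn_integral_cong) (auto simp: indicator_def)
      also have "\<dots> = emeasure lborel (?B i)" using B[OF that] by simp
      finally show ?thesis ..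
    qed
    then have "(\<Prod>i<n. ennreal \<bar>a\<bar> * emeasure lborel (?B i)) = (\<Prod>i<n. emeasure lborel (A i))"
      by (intro prod.cong) auto
    then have "ennreal (\<bar>a\<bar> ^ n) * (\<Prod>i<n. emeasure lborel (?B i)) = (\<Prod>i<n. emeasure lborel (A i))"
      by (simp add: prod.distrib ennreal_power)
    ultimately show "emeasure (density (distr (volM n) (volM n) (scale_n n a)) (\<lambda>_. ennreal (\<bar>a\<bar> ^ n))) (Pi\<^sub>E {..<n} A)
      = (\<Prod>i\<in>{..<n}. emeasure lborel (A i))"
      using AP by (simp add: emeasure_density_const)
  qed (simp_all add: volM_def)
  then have "volM n = density (distr (volM n) (volM n) (scale_n n a)) (\<lambda>_. ennreal (\<bar>a\<bar> ^ n))"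
    by (simp add: volM_def)
  then have "density (volM n) (\<lambda>_. ennreal ((1 / \<bar>a\<bar>) ^ n)) =
     density (density (distr (volM n) (volM n) (scale_n n a)) (\<lambda>_. ennreal (\<bar>a\<bar> ^ n))) (\<lambda>_. ennreal ((1 / \<bar>a\<bar>) ^ n))"
    by (rule arg_cong)
  also have "\<dots> = density (distr (volM n) (volM n) (scale_n n a)) (\<lambda>_. 1)"
    using a by (subst density_density_eq) (auto simp: power_divide simp flip: ennreal_mult)
  also have "\<dots> = distr (volM n) (volM n) (scale_n n a)" by (simp add: density_1)
  finally show ?thesis ..
qed

section \<open>Hausdorff measure on the sphere\<close>

abbreviation hausdorff_cost :: "nat \<Rightarrow> real \<Rightarrow> (nat \<Rightarrow> real) set \<Rightarrow> ennreal" where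
  "hausdorff_cost n s V \<equiv> ennreal (kappa s * (enn2real (diam_n n V) / 2) powr s)"

abbreviation hausdorff_covers :: "nat \<Rightarrow> real \<Rightarrow> (nat \<Rightarrow> real) set \<Rightarrow> (nat \<Rightarrow> (nat \<Rightarrow> real) set) set" where
  "hausdorff_covers n \<delta> A \<equiv> {U. (\<forall>i. U i \<subseteq> Rn n \<and> diam_n n (U i) \<le> ennreal \<delta>) \<and> A \<subseteq> (\<Union>i. U i)}"

lemma diam_empty [simp]: "diam_n n {} = 0"
  by (simp add: diam_n_def bot_ennreal)

lemma dist_n_le_diam: "x \<in> U \<Longrightarrow> y \<in> U \<Longrightarrow> ennreal (dist_n n x y) \<le> diam_n n U"
  unfolding diam_n_def by (intro SUP_upper2[of x] SUP_upper) auto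

lemma hausdorff_pre_mono: "A \<subseteq> B \<Longrightarrow> hausdorff_pre n s \<delta> A \<le> hausdorff_pre n s \<delta> B"
  unfolding hausdorff_pre_def by (rule INF_superset_mono) auto

lemma hausdorff_pre_antimono: "\<delta> \<le> \<delta>' \<Longrightarrow> hausdorff_pre n s \<delta>' A \<le> hausdorff_pre n s \<delta> A"
  unfolding hausdorff_pre_def
  by (rule INF_superset_mono) (auto intro: order_trans ennreal_leI)

lemma hausdorff_pre_empty [simp]: "hausdorff_pre n s \<delta> {} = 0"
proof -
  have "hausdorff_pre n s \<delta> {} \<le> (\<Sum>i. hausdorff_cost n s ((\<lambda>_::nat. {}) i))"
    unfolding hausdorff_pre_def by (rule INF_lower) auto
  then show ?thesis by simp
qed

text \<open>Each \<open>A i\<close> receives a cover that is optimal up to e / 2^(i+1), and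
  \<open>prod_decode\<close> lists the double sequence of covering sets as one sequence.\<close>

lemma hausdorff_pre_UN:
  "hausdorff_pre n s \<delta> (\<Union>i::nat. A i) \<le> (\<Sum>i. hausdorff_pre n s \<delta> (A i))"
proof (rule ennreal_le_epsilon)
  fix e :: real assume fin: "(\<Sum>i. hausdorff_pre n s \<delta> (A i)) < top" and e: "0 < e"
  have "\<exists>U\<in>hausdorff_covers n \<delta> (A i).
          (\<Sum>j. hausdorff_cost n s (U j)) < hausdorff_pre n s \<delta> (A i) + ennreal (e * (1/2) ^ Suc i)" for i
  proof -
    have "hausdorff_pre n s \<delta> (A i) < top" using fin by (rule ennreal_suminf_lessD)
    then have "hausdorff_pre n s \<delta> (A i) < hausdorff_pre n s \<delta> (A i) + ennreal (e * (1/2) ^ Suc i)"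
      using e by (cases "hausdorff_pre n s \<delta> (A i)") (auto simp: ennreal_less_iff simp flip: ennreal_plus)
    then obtain X where X: "X = hausdorff_pre n s \<delta> (A i) + ennreal (e * (1/2) ^ Suc i)"
        "hausdorff_pre n s \<delta> (A i) < X" by blast
    from X(2) have "\<exists>U\<in>hausdorff_covers n \<delta> (A i). (\<Sum>j. hausdorff_cost n s (U j)) < X"
      unfolding hausdorff_pre_def by (rule INF_less_iff[THEN iffD1])
    then show ?thesis unfolding X(1) .
  qed
  then have "\<forall>i. \<exists>U. U \<in> hausdorff_covers n \<delta> (A i) \<and>
          (\<Sum>j. hausdorff_cost n s (U j)) < hausdorff_pre n s \<delta> (A i) + ennreal (e * (1/2) ^ Suc i)"
    unfolding Bex_def by (rule allI)
  from choice[OF this] obtain U where U': "\<forall>i. U i \<in> hausdorff_covers n \<delta> (A i) \<and>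
    (\<Sum>j. hausdorff_cost n s (U i j)) < hausdorff_pre n s \<delta> (A i) + ennreal (e * (1/2) ^ Suc i)" ..
  have U: "U i \<in> hausdorff_covers n \<delta> (A i)"
    "(\<Sum>j. hausdorff_cost n s (U i j)) < hausdorff_pre n s \<delta> (A i) + ennreal (e * (1/2) ^ Suc i)" for i
    using spec[OF U', of i] by (rule conjunct1, rule conjunct2)
  let ?V = "\<lambda>k. case prod_decode k of (i, j) \<Rightarrow> U i j"
  have "hausdorff_pre n s \<delta> (\<Union>i. A i) \<le> (\<Sum>k. hausdorff_cost n s (?V k))"
    unfolding hausdorff_pre_def
  proof (rule INF_lower, intro CollectI conjI allI)
    fix k show "?V k \<subseteq> Rn n" using U(1) by (auto split: prod.splits)
    show "diam_n n (?V k) \<le> ennreal \<delta>" using U(1) by (auto split: prod.splits)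
  next
    show "(\<Union>i. A i) \<subseteq> (\<Union>k. ?V k)"
    proof safe
      fix i x assume "x \<in> A i"
      then have "x \<in> (\<Union>j. U i j)" using U(1)[of i] by auto
      then obtain j where "x \<in> U i j" by blast
      then show "x \<in> (\<Union>k. ?V k)"
        by (intro UN_I[of "prod_encode (i, j)"]) auto
    qed
  qed
  also have "\<dots> = (\<Sum>k. case_prod (\<lambda>i j. hausdorff_cost n s (U i j)) (prod_decode k))"
    by (intro suminf_cong) (simp split: prod.splits)
  also have "\<dots> = (\<Sum>i. \<Sum>j. hausdorff_cost n s (U i j))"
    by (rule suminf_ennreal_2dimen) simp
  also have "\<dots> \<le> (\<Sum>i. hausdorff_pre n s \<delta> (A i) + ennreal (e * (1/2) ^ Suc i))"
    using U(2) by (intro suminf_le summableI) (auto intro: less_imp_le)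
  also have "\<dots> = (\<Sum>i. hausdorff_pre n s \<delta> (A i)) + (\<Sum>i. ennreal (e * (1/2) ^ Suc i))"
    by (intro suminf_add[symmetric] summableI)
  also have "(\<Sum>i. ennreal (e * (1/2) ^ Suc i)) = ennreal e"
  proof -
    have "(\<lambda>i. e * (1/2) ^ Suc i) sums (e * 1)"
      by (intro sums_mult power_half_series)
    then have "(\<lambda>i. ennreal (e * (1/2) ^ Suc i)) sums ennreal e"
      using e by (subst sums_ennreal) auto
    then show ?thesis by (rule sums_unique[symmetric])
  qed
  finally show "hausdorff_pre n s \<delta> (\<Union>i. A i) \<le> (\<Sum>i. hausdorff_pre n s \<delta> (A i)) + ennreal e" .
qed

lemma hausdorff_mono: "A \<subseteq> B \<Longrightarrow> hausdorff n s A \<le> hausdorff n s B"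
  unfolding hausdorff_def by (intro SUP_mono) (use hausdorff_pre_mono in blast)

lemma hausdorff_empty [simp]: "hausdorff n s {} = 0"
  by (simp add: hausdorff_def)

lemma hausdorff_pre_le: "0 < \<delta> \<Longrightarrow> hausdorff_pre n s \<delta> A \<le> hausdorff n s A"
  unfolding hausdorff_def by (intro SUP_upper) auto

lemma hausdorff_UN: "hausdorff n s (\<Union>i::nat. A i) \<le> (\<Sum>i. hausdorff n s (A i))"
  unfolding hausdorff_def[of n s "\<Union>i. A i"]
proof (rule SUP_least)
  fix \<delta> :: real assume "\<delta> \<in> {0<..}"
  then show "hausdorff_pre n s \<delta> (\<Union>i. A i) \<le> (\<Sum>i. hausdorff n s (A i))"
    by (intro order_trans[OF hausdorff_pre_UN] suminf_le summableI hausdorff_pre_le) auto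
qed

lemma hausdorff_Un: "hausdorff n s (A \<union> B) \<le> hausdorff n s A + hausdorff n s B"
proof -
  let ?A = "\<lambda>i::nat. if i = 0 then A else if i = 1 then B else {}"
  have "hausdorff n s (\<Union>i. ?A i) \<le> (\<Sum>i. hausdorff n s (?A i))" by (rule hausdorff_UN)
  also have "(\<Union>i. ?A i) = A \<union> B" by (auto split: if_splits)
  also have "(\<Sum>i. hausdorff n s (?A i)) = (\<Sum>i\<in>{0,1}. hausdorff n s (?A i))"
    by (intro suminf_finite) auto
  finally show ?thesis by simp
qed

text \<open>A set of diameter at most delta < eta cannot meet both A and B, so every cover of the
  union splits into a cover of A and one of B.\<close>

lemma hausdorff_pre_separated:
  assumes "\<delta> < \<eta>" "0 < \<eta>" "\<And>a b. a \<in> A \<Longrightarrow> b \<in> B \<Longrightarrow> \<eta> \<le> dist_n n a b"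
  shows "hausdorff_pre n s \<delta> A + hausdorff_pre n s \<delta> B \<le> hausdorff_pre n s \<delta> (A \<union> B)"
  unfolding hausdorff_pre_def[of n s \<delta> "A \<union> B"]
proof (rule INF_greatest)
  fix U assume U: "U \<in> hausdorff_covers n \<delta> (A \<union> B)"
  \<comment> \<open>Covers are sequences, so a set that misses C is not dropped but replaced by the
    empty set; its cost is 0 because \<open>0 powr s = 0\<close>.\<close>
  let ?P = "\<lambda>C i. if U i \<inter> C \<noteq> {} then U i else {}"
  have *: "hausdorff_pre n s \<delta> C \<le> (\<Sum>i. hausdorff_cost n s (?P C i))" if "C \<subseteq> A \<union> B" for C
    unfolding hausdorff_pre_def
  proof (rule INF_lower, safe)
    fix x assume "x \<in> C"
    have "A \<union> B \<subseteq> (\<Union>i. U i)" using U by simp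
    then have "x \<in> (\<Union>i. U i)" using that \<open>x \<in> C\<close> by (meson subsetD)
    then obtain i where "x \<in> U i" by blast
    then show "x \<in> (\<Union>i. ?P C i)" using \<open>x \<in> C\<close> by (intro UN_I[of i]) auto
  qed (use U in \<open>auto split: if_splits\<close>)
  have disj: "U i \<inter> A = {} \<or> U i \<inter> B = {}" for i
  proof (rule ccontr)
    assume "\<not> ?thesis"
    then obtain a b where ab: "a \<in> U i" "a \<in> A" "b \<in> U i" "b \<in> B" by auto
    have "ennreal (dist_n n a b) \<le> ennreal \<delta>"
      using dist_n_le_diam[OF ab(1,3)] U order_trans by blast
    then show False using assms(3)[OF ab(2,4)] assms(1,2)
      by (auto simp: ennreal_le_iff2)
  qed
  have "hausdorff_pre n s \<delta> A + hausdorff_pre n s \<delta> B \<le>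
     (\<Sum>i. hausdorff_cost n s (?P A i)) + (\<Sum>i. hausdorff_cost n s (?P B i))"
    by (intro add_mono *) auto
  also have "\<dots> = (\<Sum>i. hausdorff_cost n s (?P A i) + hausdorff_cost n s (?P B i))"
    by (intro suminf_add summableI)
  also have "\<dots> \<le> (\<Sum>i. hausdorff_cost n s (U i))"
    using disj by (intro suminf_le summableI) auto
  finally show "hausdorff_pre n s \<delta> A + hausdorff_pre n s \<delta> B \<le> (\<Sum>i. hausdorff_cost n s (U i))" .
qed

text \<open>The suprema in the two summands are taken over independent mesh sizes d and d'; both are
  first lowered to a common size below eta.\<close>

lemma hausdorff_separated:
  assumes \<eta>: "\<eta> > 0" "\<And>a b. a \<in> A \<Longrightarrow> b \<in> B \<Longrightarrow> \<eta> \<le> dist_n n a b"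
  shows "hausdorff n s A + hausdorff n s B \<le> hausdorff n s (A \<union> B)"
proof -
  have 1: "hausdorff_pre n s d A + hausdorff_pre n s d' B \<le> hausdorff n s (A \<union> B)"
    if "d > 0" "d' > 0" for d d'
  proof -
    let ?m = "min (min d d') (\<eta> / 2)"
    have "hausdorff_pre n s d A + hausdorff_pre n s d' B \<le> hausdorff_pre n s ?m A + hausdorff_pre n s ?m B"
      by (intro add_mono hausdorff_pre_antimono) auto
    also have "\<dots> \<le> hausdorff_pre n s ?m (A \<union> B)"
      using \<eta> by (intro hausdorff_pre_separated[where \<eta>=\<eta>]) auto
    also have "\<dots> \<le> hausdorff n s (A \<union> B)"
      using that \<eta> by (intro hausdorff_pre_le) auto
    finally show ?thesis .
  qed
  have 2: "hausdorff n s A + hausdorff_pre n s d' B \<le> hausdorff n s (A \<union> B)" if "d' > 0" for d'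
    unfolding hausdorff_def[of n s A] using 1 that
    by (subst ennreal_SUP_add_left[symmetric]) (auto intro!: SUP_least)
  show ?thesis
    unfolding hausdorff_def[of n s B] using 2
    by (subst ennreal_SUP_add_right) (auto intro!: SUP_least)
qed

lemma dist_n_ge_coord: "i < n \<Longrightarrow> \<bar>x i - y i\<bar> \<le> dist_n n x y"
  using member_le_L2_set[of "{..<n}" i "\<lambda>i. \<bar>x i - y i\<bar>"]
  by (simp add: dist_n_def L2_set_def)

text \<open>Caratheodory's argument for metric outer measures: the part of \<open>T\<close> outside the half-space is
  cut into slabs approaching the boundary; slabs of equal parity have positive mutual distance, so
  their outer measures are summable.\<close>

lemma hausdorff_halfspace:
  assumes i: "i < n"
  shows "hausdorff n s (T \<inter> {x. x i \<le> a}) + hausdorff n s (T - {x. x i \<le> a}) = hausdorff n s T"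
proof (rule antisym)
  let ?E = "{x. x i \<le> a}"
  let ?H = "hausdorff n s"
  show "?H T \<le> ?H (T \<inter> ?E) + ?H (T - ?E)"
    using hausdorff_Un[of n s "T \<inter> ?E" "T - ?E"] by (simp add: Int_Diff_Un)
  show "?H (T \<inter> ?E) + ?H (T - ?E) \<le> ?H T"
  proof (cases "?H T = top")
    case False
    define \<tau> where "\<tau> k = a + 1 / real (Suc k)" for k
    have \<tau>_dec: "\<tau> l < \<tau> k" if "k < l" for k l
      using that by (simp add: \<tau>_def frac_less2)
    have \<tau>_le: "\<tau> l \<le> \<tau> k" if "k \<le> l" for k l
      using that by (simp add: \<tau>_def frac_le)
    have \<tau>_a: "a < \<tau> k" for k by (simp add: \<tau>_def)
    define D where "D k = {x\<in>T. \<tau> (Suc k) < x i \<and> x i \<le> \<tau> k}" for k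
    define Tk where "Tk k = {x\<in>T. \<tau> k < x i}" for k
    have sep: "?H A + ?H B \<le> ?H (A \<union> B)"
      if "c < d" "\<And>x. x \<in> A \<Longrightarrow> x i \<le> c" "\<And>x. x \<in> B \<Longrightarrow> d \<le> x i" for A B c d
    proof (rule hausdorff_separated)
      show "d - c > 0" using that by simp
      fix x y assume "x \<in> A" "y \<in> B"
      then show "d - c \<le> dist_n n x y"
        using dist_n_ge_coord[OF i, of x y] that(2)[of x] that(3)[of y] by linarith
    qed
    have parity: "(\<Sum>j<N. ?H (D (2 * j + q))) \<le> ?H T" for N q
    proof -
      have "(\<Sum>j<N. ?H (D (2 * j + q))) \<le> ?H (\<Union>j<N. D (2 * j + q))"
      proof (induction N)
        case (Suc N)
        have "(\<Sum>j<Suc N. ?H (D (2 * j + q))) \<le> ?H (D (2 * N + q)) + ?H (\<Union>j<N. D (2 * j + q))"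
          using Suc.IH by (simp add: add.commute add_left_mono)
        also have "\<dots> \<le> ?H (D (2 * N + q) \<union> (\<Union>j<N. D (2 * j + q)))"
        proof (cases "N = 0")
          case False
          show ?thesis
          proof (rule sep[of "\<tau> (2 * N + q)" "\<tau> (Suc (2 * (N - 1) + q))"])
            show "\<tau> (2 * N + q) < \<tau> (Suc (2 * (N - 1) + q))" using False by (intro \<tau>_dec) auto
            fix x assume "x \<in> (\<Union>j<N. D (2 * j + q))"
            then obtain j where j: "j < N" "x \<in> D (2 * j + q)" by auto
            have "\<tau> (Suc (2 * (N - 1) + q)) \<le> \<tau> (Suc (2 * j + q))" using j by (intro \<tau>_le) auto
            then show "\<tau> (Suc (2 * (N - 1) + q)) \<le> x i" using j(2) by (auto simp: D_def)
          qed (auto simp: D_def)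
        qed simp
        also have "D (2 * N + q) \<union> (\<Union>j<N. D (2 * j + q)) = (\<Union>j<Suc N. D (2 * j + q))"
          by (auto simp: lessThan_Suc)
        finally show ?case .
      qed simp
      also have "\<dots> \<le> ?H T" by (intro hausdorff_mono) (auto simp: D_def)
      finally show ?thesis .
    qed
    have sums: "(\<Sum>j<N. ?H (D j)) \<le> 2 * ?H T" for N
    proof -
      have "(\<Sum>j<N. ?H (D j)) \<le> (\<Sum>j<2 * N. ?H (D j))" by (intro sum_mono2) auto
      also have "\<dots> = (\<Sum>j<N. ?H (D (2 * j + 0))) + (\<Sum>j<N. ?H (D (2 * j + 1)))"
        by (induction N) (simp_all add: ac_simps)
      also have "\<dots> \<le> ?H T + ?H T" by (intro add_mono parity)
      finally show ?thesis by (simp add: mult_2)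
    qed
    have fin: "(\<Sum>j. ?H (D j)) \<noteq> top"
    proof -
      have "(\<Sum>j. ?H (D j)) \<le> 2 * ?H T"
        unfolding suminf_eq_SUP by (intro SUP_least sums)
      then show ?thesis using False by (auto simp: top_unique ennreal_mult_eq_top_iff)
    qed
    have finj: "?H (D j) \<noteq> top" for j
      using ennreal_suminf_lessD[of "\<lambda>j. ?H (D j)" top j] fin by (simp add: top.not_eq_extremum)
    define f where "f j = enn2real (?H (D j))" for j
    have Hf: "?H (D j) = ennreal (f j)" for j using finj[of j] by (simp add: f_def top.not_eq_extremum)
    have f0: "f j \<ge> 0" for j by (simp add: f_def)
    have sumf: "summable f"
      using fin f0 unfolding Hf by (intro summable_suminf_not_top) auto
    \<comment> \<open>Outside the half-space, T consists of \<open>Tk k\<close>, which keeps a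
      positive distance from the half-space, and of the slabs from k on, whose measures are the tail
      of a convergent series.\<close>
    have main: "?H (T \<inter> ?E) + ?H (T - ?E) \<le> ?H T + ennreal (\<Sum>j. f (j + k))" for k
    proof -
      have "T - ?E \<subseteq> Tk k \<union> (\<Union>j. D (j + k))"
      proof
        fix x assume x: "x \<in> T - ?E"
        show "x \<in> Tk k \<union> (\<Union>j. D (j + k))"
        proof (cases "\<tau> k < x i")
          case False
          have "\<exists>l. \<tau> l < x i"
            using reals_Archimedean[of "x i - a"] x by (auto simp: \<tau>_def inverse_eq_divide algebra_simps)
          define l where "l = (LEAST l. \<tau> l < x i)"
          have l1: "\<tau> l < x i" unfolding l_def using \<open>\<exists>l. \<tau> l < x i\<close> by (rule LeastI_ex)
          have "k < l" using False l1 \<tau>_le[of l k] by (cases "k < l") auto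
          have l2: "\<not> \<tau> (l - 1) < x i"
            using \<open>k < l\<close> not_less_Least[of "l - 1" "\<lambda>l. \<tau> l < x i"] by (simp add: l_def[symmetric])
          have "x \<in> D ((l - 1 - k) + k)"
            using l1 l2 \<open>k < l\<close> x by (auto simp: D_def)
          then show ?thesis by blast
        qed (use x in \<open>auto simp: Tk_def\<close>)
      qed
      then have "?H (T - ?E) \<le> ?H (Tk k \<union> (\<Union>j. D (j + k)))" by (rule hausdorff_mono)
      also have "\<dots> \<le> ?H (Tk k) + ?H (\<Union>j. D (j + k))" by (rule hausdorff_Un)
      also have "?H (\<Union>j. D (j + k)) \<le> (\<Sum>j. ?H (D (j + k)))" by (rule hausdorff_UN)
      also have "(\<Sum>j. ?H (D (j + k))) = ennreal (\<Sum>j. f (j + k))"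
        unfolding Hf using f0 sumf by (intro suminf_ennreal2) (auto simp: summable_iff_shift)
      finally have "?H (T \<inter> ?E) + ?H (T - ?E) \<le> (?H (T \<inter> ?E) + ?H (Tk k)) + ennreal (\<Sum>j. f (j + k))"
        by (simp add: add_left_mono add.assoc)
      also have "?H (T \<inter> ?E) + ?H (Tk k) \<le> ?H (T \<inter> ?E \<union> Tk k)"
        by (rule sep[OF \<tau>_a[of k]]) (auto simp: Tk_def)
      also have "\<dots> \<le> ?H T" by (intro hausdorff_mono) (auto simp: Tk_def)
      finally show ?thesis by (simp add: add_right_mono)
    qed
    show ?thesis
    proof (rule ennreal_le_epsilon)
      fix e :: real assume "0 < e"
      then obtain k where "norm (\<Sum>j. f (j + k)) < e"
        using suminf_exist_split[OF _ sumf, of e] by blast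
      then have "ennreal (\<Sum>j. f (j + k)) \<le> ennreal e" by (intro ennreal_leI) auto
      then show "?H (T \<inter> ?E) + ?H (T - ?E) \<le> ?H T + ennreal e"
        using main[of k] by (meson add_left_mono order_trans)
    qed
  qed simp
qed

text \<open>Equipping L with the zero measure turns it into a measurable space, so that
  measurability of the coordinate maps can be tested on half-lines.\<close>

lemma sets_volM_subset_halfspaces:
  assumes L: "sigma_algebra (Rn n) L"
    and halfspace: "\<And>i a. i < n \<Longrightarrow> {x \<in> Rn n. x i \<le> a} \<in> L"
  shows "sets (volM n) \<subseteq> L"
proof -
  interpret L: sigma_algebra "Rn n" L by fact
  let ?N = "measure_of (Rn n) L (\<lambda>_. 0)"
  have N: "space ?N = Rn n" "sets ?N = L" by simp_all
  have m: "(\<lambda>x. x i) \<in> borel_measurable ?N" if "i < n" for i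
    unfolding borel_measurable_iff_le using halfspace[OF that] by simp
  have "{f \<in> \<Pi>\<^sub>E i\<in>{..<n}. UNIV. f i \<in> A} \<in> L" if "i < n" "A \<in> sets borel" for i and A :: "real set"
  proof -
    have "(\<lambda>x. x i) -` A \<inter> space ?N \<in> sets ?N"
      using m[OF that(1)] that(2) by (rule measurable_sets)
    then show ?thesis unfolding N by (simp add: Rn_def Collect_conj_eq Int_commute vimage_def)
  qed
  then have "sigma_sets (Rn n) {{f \<in> \<Pi>\<^sub>E i\<in>{..<n}. space (lborel :: real measure). f i \<in> A} |i A.
       i \<in> {..<n} \<and> A \<in> sets (lborel :: real measure)} \<subseteq> L"
    by (intro L.sigma_sets_subset) auto
  then show ?thesis by (simp add: volM_def sets_PiM_single Rn_def)
qed

text \<open>The outer measure is countably additive on the sets that split every test set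
  additively. Coordinate half-spaces do so, and they generate the product sigma-algebra.\<close>

lemma measure_space_hausdorff:
  "measure_space (Rn n) (sets (volM n)) (hausdorff n s)"
proof -
  interpret P: sigma_algebra "Rn n" "Pow (Rn n)" by (rule sigma_algebra_Pow)
  let ?L = "lambda_system (Rn n) (Pow (Rn n)) (hausdorff n s)"
  have "outer_measure_space (Pow (Rn n)) (hausdorff n s)"
    unfolding outer_measure_space_def positive_def increasing_def countably_subadditive_def
    using hausdorff_mono hausdorff_UN by auto
  then have L: "measure_space (Rn n) ?L (hausdorff n s)"
    by (rule P.caratheodory_lemma)
  then have sa: "sigma_algebra (Rn n) ?L" by (simp add: measure_space_def)
  have sub: "sets (volM n) \<subseteq> ?L"
  proof (rule sets_volM_subset_halfspaces[OF sa])
    fix i a assume i: "i < n"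
    show "{x \<in> Rn n. x i \<le> a} \<in> ?L"
      unfolding P.lambda_system_eq
    proof (safe)
      fix T assume "T \<subseteq> Rn n"
      then have "T \<inter> {x \<in> Rn n. x i \<le> a} = T \<inter> {x. x i \<le> a}" "T - {x \<in> Rn n. x i \<le> a} = T - {x. x i \<le> a}"
        by auto
      then show "hausdorff n s (T \<inter> {x \<in> Rn n. x i \<le> a}) + hausdorff n s (T - {x \<in> Rn n. x i \<le> a}) = hausdorff n s T"
        using hausdorff_halfspace[OF i] by simp
    qed
  qed

  have "sigma_algebra (Rn n) (sets (volM n))" using sets.sigma_algebra_axioms[of "volM n"] by simp
  moreover have "countably_additive (sets (volM n)) (hausdorff n s)"
    using L sub unfolding measure_space_def countably_additive_def by blast
  ultimately show ?thesis
    by (simp add: measure_space_def positive_def)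
qed

text \<open>\<open>measure_of\<close> yields the zero measure unless its set function is a measure.
  That \<open>sphereM\<close> really carries the Hausdorff measure therefore rests on countable
  additivity on the Borel sets.\<close>

lemma space_sphereM [simp]: "space (sphereM n) = sphere_n n"
  and sets_sphereM: "sets (sphereM n) = sets (restrict_space (volM n) (sphere_n n))"
  and emeasure_sphereM: "A \<in> sets (sphereM n) \<Longrightarrow> emeasure (sphereM n) A = hausdorff n (real n - 1) A"
proof -
  let ?R = "restrict_space (volM n) (sphere_n n)"
  have sp: "space ?R = sphere_n n"
    by (auto simp: space_restrict_space sphere_n_def)
  have sub: "sets ?R \<subseteq> Pow (sphere_n n)" using sets.space_closed[of ?R] sp by simp
  have sa: "sigma_algebra (sphere_n n) (sets ?R)" using sets.sigma_algebra_axioms[of ?R] sp by simp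
  show "space (sphereM n) = sphere_n n" unfolding sphereM_def using sub by (rule space_measure_of)
  show sets: "sets (sphereM n) = sets ?R" unfolding sphereM_def using sub
    by (simp add: sigma_algebra.sigma_sets_eq[OF sa])
  have *: "sets ?R \<subseteq> sets (volM n)"
    by (auto simp: sets_restrict_space)
  have "countably_additive (sets ?R) (hausdorff n (real n - 1))"
    using measure_space_hausdorff[of n "real n - 1"] * unfolding measure_space_def countably_additive_def
    by blast
  then show "emeasure (sphereM n) A = hausdorff n (real n - 1) A" if "A \<in> sets (sphereM n)"
    unfolding sphereM_def using sub that[unfolded sets] sa
    by (subst emeasure_measure_of_sigma) (auto simp: positive_def)
qed

text \<open>An isometry carries a cover to a cover with the same diameters. Applied to a rotation
  and to its inverse, the inequality becomes the equality behind
  \<open>distr_givens_sphere\<close>.\<close>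

lemma hausdorff_image_le:
  assumes g: "\<And>x. x \<in> Rn n \<Longrightarrow> g x \<in> Rn n" "\<And>x y. x \<in> Rn n \<Longrightarrow> y \<in> Rn n \<Longrightarrow> dist_n n (g x) (g y) = dist_n n x y"
  shows "hausdorff n s (g ` A) \<le> hausdorff n s A"
proof -
  have diam: "diam_n n (g ` V) = diam_n n V" if "V \<subseteq> Rn n" for V
    unfolding diam_n_def image_image using that g(2)
    by (intro SUP_cong refl) (auto simp: subset_iff)
  have "hausdorff_pre n s \<delta> (g ` A) \<le> hausdorff_pre n s \<delta> A" for \<delta>
    unfolding hausdorff_pre_def[of n s \<delta> A]
  proof (rule INF_greatest)

    fix U assume U: "U \<in> hausdorff_covers n \<delta> A"
    have "hausdorff_pre n s \<delta> (g ` A) \<le> (\<Sum>i. hausdorff_cost n s (g ` U i))"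
      unfolding hausdorff_pre_def
    proof (rule INF_lower, safe)
      fix i x assume "x \<in> U i" then show "g x \<in> Rn n" using U g(1) by blast
    next
      fix i show "diam_n n (g ` U i) \<le> ennreal \<delta>" using U diam[of "U i"] by simp
    next
      fix x assume "x \<in> A" then show "g x \<in> (\<Union>i. g ` U i)" using U by blast
    qed
    also have "\<dots> = (\<Sum>i. hausdorff_cost n s (U i))" using U diam by simp
    finally show "hausdorff_pre n s \<delta> (g ` A) \<le> (\<Sum>i. hausdorff_cost n s (U i))" .
  qed
  then show ?thesis unfolding hausdorff_def by (intro SUP_mono) blast
qed

lemma dist_givens:
  assumes "i < n" "j < n" "i \<noteq> j" "c\<^sup>2 + s\<^sup>2 = 1"
  shows "dist_n n (givens i j c s x) (givens i j c s y) = dist_n n x y"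
proof -
  have "(\<lambda>l. givens i j c s x l - givens i j c s y l) = givens i j c s (\<lambda>l. x l - y l)"
    using assms(3) by (auto simp: givens_def fun_eq_iff algebra_simps)
  then show ?thesis using norm_givens[OF assms] by (simp add: dist_n_def)
qed

lemma measurable_givens_sphere:
  assumes "i < n" "j < n" "i \<noteq> j" "c\<^sup>2 + s\<^sup>2 = 1"
  shows "givens i j c s \<in> sphereM n \<rightarrow>\<^sub>M sphereM n"
proof -
  have "givens i j c s \<in> restrict_space (volM n) (sphere_n n) \<rightarrow>\<^sub>M restrict_space (volM n) (sphere_n n)"
    using assms by (intro measurable_restrict_space3 measurable_givens) (auto simp: sphere_n_def givens_in_Rn norm_givens)
  then show ?thesis by (simp cong: measurable_cong_sets add: sets_sphereM)
qed

lemma distr_givens_sphere: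
  assumes "i < n" "j < n" "i \<noteq> j" "c\<^sup>2 + s\<^sup>2 = 1"
  shows "distr (sphereM n) (sphereM n) (givens i j c s) = sphereM n"
proof (rule measure_eqI)
  let ?g = "givens i j c s" and ?g' = "givens i j c (- s)"
  fix A assume "A \<in> sets (distr (sphereM n) (sphereM n) ?g)"
  then have A: "A \<in> sets (sphereM n)" by simp
  then have AS: "A \<subseteq> sphere_n n" using sets.sets_into_space by fastforce
  have cs': "c\<^sup>2 + (- s)\<^sup>2 = 1" using assms by simp
  have inv: "?g' (?g x) = x" "?g (?g' x) = x" for x
    using givens_inverse[OF assms(3,4)] givens_inverse[OF assms(3) cs'] by auto
  have sph: "?g x \<in> sphere_n n" if "x \<in> sphere_n n" for x
    using assms that by (auto simp: sphere_n_def givens_in_Rn norm_givens)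
  have sph': "?g' x \<in> sphere_n n" if "x \<in> sphere_n n" for x
    using assms cs' that by (auto simp: sphere_n_def givens_in_Rn norm_givens)
  let ?B = "?g -` A \<inter> sphere_n n"
  have B: "?B \<in> sets (sphereM n)"
    using measurable_sets[OF measurable_givens_sphere[OF assms] A] by simp
  have A_eq: "A = ?g ` ?B"
  proof
    show "A \<subseteq> ?g ` ?B"
    proof
      fix x assume "x \<in> A"
      then have "?g' x \<in> ?B" using inv AS sph' by auto
      then show "x \<in> ?g ` ?B" using inv(2)[of x] by (metis image_eqI)
    qed
  qed auto
  have "?B = ?g' ` A"
  proof
    show "?B \<subseteq> ?g' ` A"
    proof
      fix x assume "x \<in> ?B"
      then show "x \<in> ?g' ` A" using inv(1)[of x] by (metis image_eqI IntD1 vimageD)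
    qed
    show "?g' ` A \<subseteq> ?B" using inv(2) AS sph' by auto
  qed
  then have "hausdorff n (real n - 1) ?B \<le> hausdorff n (real n - 1) A"
    using assms cs' by (auto intro!: hausdorff_image_le givens_in_Rn dist_givens)
  moreover have "hausdorff n (real n - 1) (?g ` ?B) \<le> hausdorff n (real n - 1) ?B"
    using assms by (auto intro!: hausdorff_image_le givens_in_Rn dist_givens)
  ultimately have "hausdorff n (real n - 1) ?B = hausdorff n (real n - 1) A"
    using A_eq by auto
  then show "emeasure (distr (sphereM n) (sphereM n) ?g) A = emeasure (sphereM n) A"
    using A B by (simp add: emeasure_distr measurable_givens_sphere[OF assms] emeasure_sphereM)
qed simp

section \<open>The intensity measure of hyperplanes\<close>

lemma kappa_pos: "0 \<le> s \<Longrightarrow> 0 < kappa s"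
  by (simp add: kappa_def Gamma_real_pos)

lemma omega_pos: "0 < s \<Longrightarrow> 0 < omega s"
  by (simp add: omega_def Gamma_real_pos)

text \<open>The orthogonal projection of the sphere onto a coordinate hyperplane covers a cube.\<close>

lemma sphere_n_hausdorff_pos:
  assumes n: "n \<ge> 2"
  shows "hausdorff n (real n - 1) (sphere_n n) > 0"
proof -
  define m where "m = n - 1"
  have m: "m \<ge> 1" "n = Suc m" "real n - 1 = real m" using n by (auto simp: m_def)
  \<comment> \<open>With this side length, m coordinates in [0, a] have squares summing to at most m
    a <= 1, so a last coordinate can be found that puts the point on the sphere.\<close>
  define a where "a = 1 / real n"
  have a: "a > 0" using n by (simp add: a_def)
  define Q where "Q = ({..<m} \<rightarrow>\<^sub>E {0..a})"
  \<comment> \<open>A cube of half-width d has volume (2 d)^m = 4^m (d / 2)^m, while a covering set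
    of diameter d costs \<open>kappa m\<close> times (d / 2)^m.\<close>
  define K where "K = 4 ^ m / kappa (real m)"
  have K: "K > 0" unfolding K_def using kappa_pos[of "real m"] by simp
  have main: "ennreal (a ^ m) \<le> ennreal K * (\<Sum>i. hausdorff_cost n (real m) (U i))"
    if U: "U \<in> hausdorff_covers n 1 (sphere_n n)" for U
  proof -
    define d where "d i = enn2real (diam_n n (U i))" for i
    have d0: "d i \<ge> 0" for i by (simp add: d_def)
    have diam: "diam_n n (U i) = ennreal (d i)" for i
    proof -
      have "diam_n n (U i) \<le> 1" using U by simp
      then have "diam_n n (U i) < top" using order_le_less_trans by fastforce
      then show ?thesis by (simp add: d_def)
    qed
    define p where "p i = (SOME x. x \<in> U i)" for i

    define B where "B i = (\<Pi>\<^sub>E j\<in>{..<m}. {p i j - d i .. p i j + d i})" for i :: nat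
    have B_sets: "B i \<in> sets (volM m)" for i
      unfolding B_def volM_def by (intro sets_PiM_I_finite) auto
    have Q_sets: "Q \<in> sets (volM m)"
      unfolding Q_def volM_def by (intro sets_PiM_I_finite) auto
    have B_em: "emeasure (volM m) (B i) = ennreal ((2 * d i) ^ m)" for i
    proof -
      have "emeasure (volM m) (B i) = (\<Prod>j<m. emeasure lborel {p i j - d i .. p i j + d i})"
        unfolding volM_def B_def by (subst lb.emeasure_PiM) auto
      also have "\<dots> = (\<Prod>j<m. ennreal (2 * d i))"
        using d0[of i] by (intro prod.cong) auto
      finally show ?thesis using d0[of i] by (simp add: ennreal_power)
    qed
    have cover: "Q \<subseteq> (\<Union>i. B i)"
    proof
      fix c assume c: "c \<in> Q"
      have c01: "0 \<le> c j" "c j \<le> a" if "j < m" for j using c that by (auto simp: Q_def PiE_iff)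
      have "(\<Sum>j<m. (c j)\<^sup>2) \<le> (\<Sum>j<m. a)"
      proof (intro sum_mono)
        fix j assume "j \<in> {..<m}"
        then have "(c j)\<^sup>2 \<le> a\<^sup>2" using c01 by (intro power_mono) auto
        also have "a\<^sup>2 \<le> a" using n by (simp add: a_def power2_eq_square field_simps)
        finally show "(c j)\<^sup>2 \<le> a" .
      qed
      also have "\<dots> \<le> 1" using m by (simp add: a_def)
      finally have s1: "(\<Sum>j<m. (c j)\<^sup>2) \<le> 1" .
      define x where "x = (\<lambda>j\<in>{..<n}. if j < m then c j else sqrt (1 - (\<Sum>j<m. (c j)\<^sup>2)))"
      have "(norm_n n x)\<^sup>2 = (\<Sum>j<Suc m. (x j)\<^sup>2)"
        by (simp add: L2_set_def sum_nonneg m)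
      also have "\<dots> = (\<Sum>j<m. (x j)\<^sup>2) + (1 - (\<Sum>j<m. (c j)\<^sup>2))"
        using s1 by (simp add: x_def m)
      also have "(\<Sum>j<m. (x j)\<^sup>2) = (\<Sum>j<m. (c j)\<^sup>2)"
        by (intro sum.cong) (auto simp: x_def m)
      finally have "norm_n n x = 1" by (simp add: power2_eq_1_iff L2_set_nonneg)
        (smt (verit) L2_set_nonneg)
      then have "x \<in> sphere_n n" by (simp add: sphere_n_def Rn_iff x_def)
      then have "x \<in> (\<Union>i. U i)" using U by blast
      then obtain i where i: "x \<in> U i" by blast
      then have p: "p i \<in> U i" unfolding p_def by (rule someI[of "\<lambda>x. x \<in> U i"])
      have "ennreal (dist_n n x (p i)) \<le> ennreal (d i)"
        using dist_n_le_diam[OF i p, of n] unfolding diam .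
      then have dist: "dist_n n x (p i) \<le> d i" using d0[of i] by (simp add: ennreal_le_iff)
      have "c \<in> B i"
      proof -
        have "\<bar>c j - p i j\<bar> \<le> d i" if "j < m" for j
          using dist_n_ge_coord[of j n x "p i"] dist that by (auto simp: x_def m)
        then have "p i j - d i \<le> c j \<and> c j \<le> p i j + d i" if "j < m" for j
          using that by (smt (verit))
        then show ?thesis using c by (auto simp: B_def Q_def PiE_iff)
      qed
      then show "c \<in> (\<Union>i. B i)" by blast
    qed
    have "ennreal (a ^ m) = emeasure (volM m) Q"
      using a unfolding volM_def Q_def by (subst lb.emeasure_PiM) (auto simp: ennreal_power)
    also have "\<dots> \<le> emeasure (volM m) (\<Union>i. B i)"
      using cover B_sets by (intro emeasure_mono) auto
    also have "\<dots> \<le> (\<Sum>i. emeasure (volM m) (B i))"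
      using B_sets by (intro emeasure_subadditive_countably) auto
    also have "\<dots> = (\<Sum>i. ennreal K * hausdorff_cost n (real m) (U i))"
    proof (intro suminf_cong)
      fix i
      have "(2 * d i) ^ m = K * (kappa (real m) * (d i / 2) powr real m)"
      proof (cases "d i = 0")
        case False
        then have "(2 * d i) ^ m = 4 ^ m * (d i / 2) powr real m"
          using d0[of i] power_mult_distrib[of 4 "d i / 2" m] by (simp add: powr_realpow)
        then show ?thesis using kappa_pos[of "real m"] by (simp add: K_def)
      qed (use m(1) in simp)
      then show "emeasure (volM m) (B i) = ennreal K * hausdorff_cost n (real m) (U i)"
        using K kappa_pos[of "real m"] unfolding B_em by (simp add: d_def flip: ennreal_mult)
    qed
    finally show ?thesis by simp
  qed
  have "ennreal (a ^ m / K) \<le> hausdorff_pre n (real m) 1 (sphere_n n)"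
    unfolding hausdorff_pre_def
  proof (rule INF_greatest)
    fix U assume "U \<in> hausdorff_covers n 1 (sphere_n n)"
    from main[OF this] have "ennreal (1 / K) * ennreal (a ^ m) \<le>
        ennreal (1 / K) * (ennreal K * (\<Sum>i. hausdorff_cost n (real m) (U i)))"
      by (rule mult_left_mono) simp
    also have "\<dots> = (\<Sum>i. hausdorff_cost n (real m) (U i))"
      using K by (simp add: mult.assoc[symmetric] flip: ennreal_mult)
    finally show "ennreal (a ^ m / K) \<le> (\<Sum>i. hausdorff_cost n (real m) (U i))"
      using K a by (simp add: ennreal_mult[symmetric])
  qed
  also have "\<dots> \<le> hausdorff n (real n - 1) (sphere_n n)"
    unfolding m(3) by (intro hausdorff_pre_le) auto
  finally have "ennreal (a ^ m / K) \<le> hausdorff n (real n - 1) (sphere_n n)" .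
  moreover have "0 < ennreal (a ^ m / K)" using a K by simp
  ultimately show ?thesis by (rule less_le_trans[rotated])
qed

text \<open>Replaces a condition on uncountably many points by one on countably many; it serves the
  measurability of hitting events and of the zero cell.\<close>

lemma countable_dense_subset:
  fixes S :: "'a :: second_countable_topology set"
  obtains T where "countable T" "T \<subseteq> S" "\<And>W. open W \<Longrightarrow> W \<inter> S \<noteq> {} \<Longrightarrow> W \<inter> T \<noteq> {}"
proof -
  obtain B :: "'a set set" where B: "countable B" "topological_basis B"
    using ex_countable_basis by blast
  let ?B = "{W\<in>B. W \<inter> S \<noteq> {}}"
  let ?T = "(\<lambda>W. SOME x. x \<in> W \<inter> S) ` ?B"
  have p: "(SOME x. x \<in> W \<inter> S) \<in> W \<inter> S" if "W \<in> ?B" for W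
    using that by (intro someI_ex[of "\<lambda>x. x \<in> W \<inter> S"]) auto
  show ?thesis
  proof (rule that[of ?T])
    show "countable ?T" using B(1) by auto
    show "?T \<subseteq> S" using p by auto
    fix W :: "'a set" assume W: "open W" "W \<inter> S \<noteq> {}"
    then obtain x where x: "x \<in> W" "x \<in> S" by auto
    then obtain V where V: "V \<in> B" "x \<in> V" "V \<subseteq> W"
      using B(2) W(1) by (meson topological_basisE)
    then have "V \<in> ?B" using x by auto
    then show "W \<inter> ?T \<noteq> {}" using p[of V] V by blast
  qed
qed

lemma continuous_on_inner_n [continuous_intros]:
  assumes "continuous_on S f"
  shows "continuous_on S (\<lambda>x. inner_n n (f x) u)"
proof -
  have "continuous_on S (\<lambda>x. f x i)" for i
    using continuous_on_compose2[OF continuous_on_product_coordinates assms] by auto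
  then show ?thesis unfolding inner_n_def by (intro continuous_intros)
qed

lemma compact_segment: "compact ((\<lambda>s. scale_n n s x) ` {0..1})"
proof (intro compact_continuous_image)
  show "continuous_on {0..1} (\<lambda>s. scale_n n s x)"
  proof (intro continuous_on_coordinatewise_then_product)
    fix i
    show "continuous_on {0..1} (\<lambda>s. scale_n n s x i)"
      by (cases "i < n") (auto simp: scale_n_def intro!: continuous_intros)
  qed
qed simp

definition cube_n :: "nat \<Rightarrow> (nat \<Rightarrow> real) \<Rightarrow> real \<Rightarrow> (nat \<Rightarrow> real) set" where
  "cube_n n q d = {y \<in> Rn n. \<forall>i<n. \<bar>y i - q i\<bar> \<le> d}"

text \<open>Compactness refers to functions on all of \<open>nat\<close>, so each coordinate from n
  on contributes the one-point factor \<open>{undefined}\<close> to Tychonoff's theorem.\<close>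

lemma compact_cube: "compact (cube_n n q d)"
proof -
  let ?S = "\<lambda>i. if i < n then {q i - d .. q i + d} else {undefined}"
  have "cube_n n q d = PiE UNIV ?S"
    by (auto simp: cube_n_def Rn_iff PiE_iff abs_le_iff split: if_splits)
       (smt (verit) not_less)+
  moreover have "compactin (product_topology (\<lambda>i. euclidean) UNIV) (PiE UNIV ?S)"
    by (subst compactin_PiE) auto
  ultimately show ?thesis by (simp add: euclidean_product_topology)
qed

section \<open>Hyperplanes that separate a point from the origin\<close>

definition separates :: "nat \<Rightarrow> (nat \<Rightarrow> real) \<Rightarrow> (nat \<Rightarrow> real) \<Rightarrow> real \<Rightarrow> bool" where
  "separates n x u t \<longleftrightarrow> 0 < t \<and> t < inner_n n x u \<or> t < 0 \<and> inner_n n x u < t"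

definition sepset :: "nat \<Rightarrow> (nat \<Rightarrow> real) \<Rightarrow> (nat \<Rightarrow> real) set set" where
  "sepset n x = {H \<in> hyperplanes n. x \<notin> halfspace0 n H}"

lemma hyperplane_in: "u \<in> sphere_n n \<Longrightarrow> hyperplane n u t \<in> hyperplanes n"
  by (auto simp: hyperplanes_def)

lemma hyperplane_uminus: "hyperplane n (scale_n n (-1) u) (- t) = hyperplane n u t"
  by (simp add: hyperplane_def)

lemma uminus_sphere: "u \<in> sphere_n n \<Longrightarrow> scale_n n (-1) u \<in> sphere_n n"
  by (simp add: sphere_n_def)

text \<open>\<open>halfspace0\<close> is a union over all representations (u', t') of the
  hyperplane, so a point outside must violate every one with t' >= 0. A strictly separating
  hyperplane contains l x for some 0 < l < 1 but not the origin; then l times the inner product of x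
  and u' equals t' > 0, and the inner product itself exceeds t' for every such
  representation.\<close>

lemma sepset_iff:
  assumes u: "u \<in> sphere_n n" and x: "x \<in> Rn n"
  shows "hyperplane n u t \<in> sepset n x \<longleftrightarrow> separates n x u t"
proof -
  let ?H = "hyperplane n u t"
  have notin: "x \<notin> halfspace0 n ?H \<longleftrightarrow>
    (\<forall>u'\<in>sphere_n n. \<forall>t'\<ge>0. ?H = hyperplane n u' t' \<longrightarrow> t' < inner_n n x u')"
  proof -
    have "x \<in> halfspace0 n ?H \<longleftrightarrow> (\<exists>u'\<in>sphere_n n. \<exists>t'\<ge>0. ?H = hyperplane n u' t' \<and> inner_n n x u' \<le> t')"
    proof
      assume "\<exists>u'\<in>sphere_n n. \<exists>t'\<ge>0. ?H = hyperplane n u' t' \<and> inner_n n x u' \<le> t'"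
      then obtain u' t' where "u' \<in> sphere_n n" "t' \<ge> 0" "?H = hyperplane n u' t'" "inner_n n x u' \<le> t'" by blast
      then show "x \<in> halfspace0 n ?H" unfolding halfspace0_def
        by (intro UnionI[of "{x \<in> Rn n. inner_n n x u' \<le> t'}"]) (use x in auto)
    next
      assume "x \<in> halfspace0 n ?H"
      then obtain W where W1: "x \<in> W" and W2: "W \<in> {W. zero_n n \<in> W \<and>
           (\<exists>u'\<in>sphere_n n. \<exists>t'. ?H = hyperplane n u' t' \<and> W = {x \<in> Rn n. inner_n n x u' \<le> t'})}"
        unfolding halfspace0_def by (rule UnionE)
      from W2 obtain u' t' where W: "x \<in> W" "zero_n n \<in> W" "u' \<in> sphere_n n" "?H = hyperplane n u' t'"
          "W = {x \<in> Rn n. inner_n n x u' \<le> t'}"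
        using W1 by auto
      then have "0 \<le> t'" "inner_n n x u' \<le> t'" by auto
      with W(3,4) show "\<exists>u'\<in>sphere_n n. \<exists>t'\<ge>0. ?H = hyperplane n u' t' \<and> inner_n n x u' \<le> t'"
        by blast
    qed
    then show ?thesis by (meson not_le)
  qed
  have "x \<notin> halfspace0 n ?H \<longleftrightarrow> separates n x u t"
  proof
    assume l: "x \<notin> halfspace0 n ?H"
    have 1: "t < inner_n n x u" if "t \<ge> 0" using l u that unfolding notin by blast
    have 2: "inner_n n x u < t" if "t \<le> 0"
    proof -
      have "- t < inner_n n x (scale_n n (-1) u)"
        using spec[OF bspec[OF l[unfolded notin] uminus_sphere[OF u]], of "- t"] hyperplane_uminus[of n u t] that by simp
      then show ?thesis by simp
    qed
    show "separates n x u t" using 1 2 unfolding separates_def by linarith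
  next
    assume r: "separates n x u t"
    show "x \<notin> halfspace0 n ?H" unfolding notin
    proof safe
      fix u' t' assume u': "u' \<in> sphere_n n" "0 \<le> t'" "?H = hyperplane n u' t'"
      define l where "l = t / inner_n n x u"
      have ne: "inner_n n x u \<noteq> 0" using r by (auto simp: separates_def)
      have l: "0 < l" "l < 1" using r by (auto simp: separates_def l_def divide_neg_neg field_simps)
      have "scale_n n l x \<in> ?H" using ne by (simp add: hyperplane_def l_def)
      then have e: "l * inner_n n x u' = t'" unfolding u'(3) by (simp add: hyperplane_def)
      have "t' \<noteq> 0"
      proof
        assume "t' = 0"
        then have "zero_n n \<in> ?H" unfolding u'(3) by (simp add: hyperplane_def)
        then show False using r by (auto simp: hyperplane_def separates_def)
      qed
      then have "t' > 0" using u' by simp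
      then have "inner_n n x u' > 0" using e l zero_less_mult_pos by blast
      then show "t' < inner_n n x u'" using e l by (simp flip: e)
    qed
  qed
  then show ?thesis using u by (simp add: sepset_def hyperplane_in)
qed

lemma hitting_iff: "H \<in> hitting n K \<longleftrightarrow> H \<in> hyperplanes n \<and> (\<exists>y\<in>K. y \<in> H)"
  by (auto simp: hitting_def)

text \<open>Segments are compact, so their hitting sets are generators of the sigma-algebra.
  Discarding the hyperplanes through an end point also discards those that contain the whole
  segment.\<close>

lemma sepset_eq_hitting:
  assumes x: "x \<in> Rn n"
  shows "sepset n x = hitting n ((\<lambda>s. scale_n n s x) ` {0..1}) - hitting n {zero_n n} - hitting n {x}"
proof (intro set_eqI)
  fix H
  show "H \<in> sepset n x \<longleftrightarrow> H \<in> hitting n ((\<lambda>s. scale_n n s x) ` {0..1}) - hitting n {zero_n n} - hitting n {x}"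
  proof (cases "H \<in> hyperplanes n")
    case True
    then obtain u t where H: "H = hyperplane n u t" and u: "u \<in> sphere_n n" by (auto simp: hyperplanes_def)
    let ?a = "inner_n n x u"
    have "H \<in> hitting n ((\<lambda>s. scale_n n s x) ` {0..1}) \<longleftrightarrow> (\<exists>s\<in>{0..1}. s * ?a = t)"
      using True by (simp add: hitting_iff H hyperplane_def)
    moreover have "H \<in> hitting n {zero_n n} \<longleftrightarrow> t = 0" "H \<in> hitting n {x} \<longleftrightarrow> ?a = t"
      using True x by (auto simp: hitting_iff H hyperplane_def)
    moreover have "separates n x u t \<longleftrightarrow> (\<exists>s\<in>{0..1}. s * ?a = t) \<and> t \<noteq> 0 \<and> ?a \<noteq> t"
    proof
      assume s: "separates n x u t"
      then have "t / ?a \<in> {0..1}" "t / ?a * ?a = t"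
        by (auto simp: separates_def divide_nonpos_neg field_simps)
      then have "\<exists>s\<in>{0..1}. s * ?a = t" by blast
      then show "(\<exists>s\<in>{0..1}. s * ?a = t) \<and> t \<noteq> 0 \<and> ?a \<noteq> t"
        using s by (auto simp: separates_def)
    next
      assume "(\<exists>s\<in>{0..1}. s * ?a = t) \<and> t \<noteq> 0 \<and> ?a \<noteq> t"
      then obtain s where s: "0 \<le> s" "s \<le> 1" "s * ?a = t" "t \<noteq> 0" "?a \<noteq> t" by auto
      have "?a > 0 \<Longrightarrow> 0 \<le> t \<and> t \<le> ?a" using s by (auto simp: mult_left_le_one_le)
      moreover have "?a < 0 \<Longrightarrow> t \<le> 0 \<and> ?a \<le> t"
        using s mult_right_mono_neg[of s 1 ?a] mult_nonneg_nonpos[of s ?a] by auto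
      moreover have "?a \<noteq> 0" using s by auto
      ultimately show "separates n x u t" using s(4,5) unfolding separates_def
        by (cases "?a > 0") (smt (verit))+
    qed
    ultimately show ?thesis using sepset_iff[OF u x, of t] by (auto simp: H)
  next
    case False
    then show ?thesis by (auto simp: sepset_def hitting_def)
  qed
qed

section \<open>The measurable space of hyperplanes and the intensity measure\<close>

lemma hitting_in_sets: "K \<subseteq> Rn n \<Longrightarrow> compact K \<Longrightarrow> hitting n K \<in> hyperplane_sets n"
  unfolding hyperplane_sets_def by (intro sigma_sets.Basic) auto

lemma hyperplane_sets_gen_subset: "{hitting n K | K. K \<subseteq> Rn n \<and> compact K} \<subseteq> Pow (hyperplanes n)"
  by (auto simp: hitting_def)

definition hyperplaneM :: "nat \<Rightarrow> (nat \<Rightarrow> real) set measure" where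
  "hyperplaneM n = measure_of (hyperplanes n) (hyperplane_sets n) (\<lambda>_. 0)"

lemma sigma_algebra_hyperplane_sets: "sigma_algebra (hyperplanes n) (hyperplane_sets n)"
  unfolding hyperplane_sets_def by (rule sigma_algebra_sigma_sets[OF hyperplane_sets_gen_subset])

lemma hyperplane_sets_subset: "hyperplane_sets n \<subseteq> Pow (hyperplanes n)"
  unfolding hyperplane_sets_def using sigma_sets_into_sp[OF hyperplane_sets_gen_subset] by blast

lemma space_hyperplaneM [simp]: "space (hyperplaneM n) = hyperplanes n"
  unfolding hyperplaneM_def by (rule space_measure_of[OF hyperplane_sets_subset])

lemma sets_hyperplaneM [simp]: "sets (hyperplaneM n) = hyperplane_sets n"
  unfolding hyperplaneM_def using hyperplane_sets_subset
  by (simp add: sigma_algebra.sigma_sets_eq[OF sigma_algebra_hyperplane_sets])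

lemma sepset_sets: "x \<in> Rn n \<Longrightarrow> sepset n x \<in> hyperplane_sets n"
  unfolding sepset_eq_hitting sets_hyperplaneM[symmetric]
  by (intro sets.Diff) (auto intro!: hitting_in_sets compact_segment)

lemma measurable_sphereM_volM: "(\<lambda>u. u) \<in> sphereM n \<rightarrow>\<^sub>M volM n"
proof -
  have "(\<lambda>u. u) \<in> restrict_space (volM n) (sphere_n n) \<rightarrow>\<^sub>M volM n"
    by (intro measurable_restrict_space1) auto
  then show ?thesis by (simp cong: measurable_cong_sets add: sets_sphereM)
qed

text \<open>On a compact K the distance of the inner product from t attains its minimum, so the
  hyperplane hits K iff the values on a countable dense subset come arbitrarily close to t. This is
  a countable condition on (u, t).\<close>

lemma measurable_hyperplane:
  "(\<lambda>(u, t). hyperplane n u t) \<in> sphereM n \<Otimes>\<^sub>M lborel \<rightarrow>\<^sub>M hyperplaneM n"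
proof (rule measurable_sigma_sets[OF _ hyperplane_sets_gen_subset])
  show "sets (hyperplaneM n) = sigma_sets (hyperplanes n) {hitting n K | K. K \<subseteq> Rn n \<and> compact K}"
    by (simp add: hyperplane_sets_def)
  show "(\<lambda>(u, t). hyperplane n u t) \<in> space (sphereM n \<Otimes>\<^sub>M lborel) \<rightarrow> hyperplanes n"
    by (auto simp: space_pair_measure hyperplane_in)
  fix A assume "A \<in> {hitting n K | K. K \<subseteq> Rn n \<and> compact K}"
  then obtain K where K: "K \<subseteq> Rn n" "compact K" "A = hitting n K" by auto
  obtain T where T: "countable T" "T \<subseteq> K" "\<And>W. open W \<Longrightarrow> W \<inter> K \<noteq> {} \<Longrightarrow> W \<inter> T \<noteq> {}"
    using countable_dense_subset by blast
  have hit: "hyperplane n u t \<in> hitting n K \<longleftrightarrow> (\<forall>k::nat. \<exists>x\<in>T. \<bar>inner_n n x u - t\<bar> < 1 / Suc k)"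
    if u: "u \<in> sphere_n n" for u t
  proof
    assume "hyperplane n u t \<in> hitting n K"
    then obtain x where x: "x \<in> K" "inner_n n x u = t" by (auto simp: hitting_def hyperplane_def)
    show "\<forall>k::nat. \<exists>x\<in>T. \<bar>inner_n n x u - t\<bar> < 1 / Suc k"
    proof
      fix k :: nat
      let ?W = "{x. \<bar>inner_n n x u - t\<bar> < 1 / Suc k}"
      have "open ?W" by (intro open_Collect_less continuous_intros)
      moreover have "x \<in> ?W \<inter> K" using x by simp
      then have "?W \<inter> K \<noteq> {}" by blast
      ultimately show "\<exists>x\<in>T. \<bar>inner_n n x u - t\<bar> < 1 / Suc k" using T(3)[of ?W] by blast
    qed
  next
    assume a: "\<forall>k::nat. \<exists>x\<in>T. \<bar>inner_n n x u - t\<bar> < 1 / Suc k"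
    then have "K \<noteq> {}" using T(2) by blast
    have "continuous_on K (\<lambda>x. \<bar>inner_n n x u - t\<bar>)" by (intro continuous_intros)
    from continuous_attains_inf[OF K(2) \<open>K \<noteq> {}\<close> this] obtain x where
      x: "x \<in> K" "\<And>y. y \<in> K \<Longrightarrow> \<bar>inner_n n x u - t\<bar> \<le> \<bar>inner_n n y u - t\<bar>" by blast
    have "\<bar>inner_n n x u - t\<bar> = 0"
    proof (rule ccontr)
      assume "\<bar>inner_n n x u - t\<bar> \<noteq> 0"
      then obtain k where "1 / Suc k < \<bar>inner_n n x u - t\<bar>"
        using reals_Archimedean[of "\<bar>inner_n n x u - t\<bar>"] by (auto simp: inverse_eq_divide)
      moreover obtain y where "y \<in> T" "\<bar>inner_n n y u - t\<bar> < 1 / Suc k" using a by blast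
      ultimately show False using x(2)[of y] T(2) by (meson less_le_trans less_asym subsetD)
    qed
    then show "hyperplane n u t \<in> hitting n K"
      using x(1) K(1) u by (auto simp: hitting_def hyperplane_def hyperplane_in[unfolded hyperplane_def])
  qed
  have Tm: "(\<lambda>_. x) \<in> sphereM n \<Otimes>\<^sub>M lborel \<rightarrow>\<^sub>M volM n" if "x \<in> T" for x
    using that T(2) K(1) by auto
  have "(\<lambda>(u, t). hyperplane n u t) -` A \<inter> space (sphereM n \<Otimes>\<^sub>M lborel) =
     {p \<in> space (sphereM n \<Otimes>\<^sub>M lborel). \<forall>k::nat. \<exists>x\<in>T. \<bar>inner_n n x (fst p) - snd p\<bar> < 1 / Suc k}"
    using hit by (auto simp: K space_pair_measure)
  also have "\<dots> \<in> sets (sphereM n \<Otimes>\<^sub>M lborel)"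
  proof -
    have "{p \<in> space (sphereM n \<Otimes>\<^sub>M lborel). \<exists>x\<in>T. \<bar>inner_n n x (fst p) - snd p\<bar> < 1 / Suc k}
        \<in> sets (sphereM n \<Otimes>\<^sub>M lborel)" for k
    proof (rule sets.sets_Collect_countable_Ex'[OF _ T(1)])
      fix x assume x: "x \<in> T"
      note [measurable] = Tm[OF x] measurable_compose[OF measurable_fst measurable_sphereM_volM]
      show "{p \<in> space (sphereM n \<Otimes>\<^sub>M lborel). \<bar>inner_n n x (fst p) - snd p\<bar> < 1 / Suc k}
        \<in> sets (sphereM n \<Otimes>\<^sub>M lborel)" by measurable
    qed
    then show ?thesis by (intro sets.sets_Collect_countable_All)
  qed
  finally show "(\<lambda>(u, t). hyperplane n u t) -` A \<inter> space (sphereM n \<Otimes>\<^sub>M lborel) \<in> sets (sphereM n \<Otimes>\<^sub>M lborel)" .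
qed

text \<open>The set function handed to \<open>measure_of\<close> must be shown to be a measure: it
  is the image of a density on sphere times line. Integrating over the line inside relies on
  sigma-finiteness of the line alone; finiteness of the sphere measure is derived later, from the
  process.\<close>

lemma hyperplane_intensity:
  shows space_hyperplane_intensity: "space (hyperplane_intensity n r \<gamma>) = hyperplanes n"
    and sets_hyperplane_intensity: "sets (hyperplane_intensity n r \<gamma>) = hyperplane_sets n"
    and emeasure_hyperplane_intensity: "A \<in> hyperplane_sets n \<Longrightarrow> emeasure (hyperplane_intensity n r \<gamma>) A =
            ennreal (\<gamma> / omega (real n)) *
            (\<integral>\<^sup>+ u. (\<integral>\<^sup>+ t. indicator A (hyperplane n u t) * ennreal (\<bar>t\<bar> powr (r - 1)) \<partial>lborel)
              \<partial>sphereM n)"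
proof -
  let ?F = "\<lambda>A. ennreal (\<gamma> / omega (real n)) *
            (\<integral>\<^sup>+ u. (\<integral>\<^sup>+ t. indicator A (hyperplane n u t) * ennreal (\<bar>t\<bar> powr (r - 1)) \<partial>lborel)
              \<partial>sphereM n)"
  let ?P = "sphereM n \<Otimes>\<^sub>M lborel :: ((nat \<Rightarrow> real) \<times> real) measure"
  let ?D = "density ?P (\<lambda>p. ennreal (\<gamma> / omega (real n)) * ennreal (\<bar>snd p\<bar> powr (r - 1)))"
  let ?H = "\<lambda>(u, t). hyperplane n u t"
  define N where "N = distr ?D (hyperplaneM n) ?H"
  note mH = measurable_hyperplane[of n]
  have em: "emeasure N A = ?F A" if A: "A \<in> hyperplane_sets n" for A
  proof -
    have mA [measurable]: "?H -` A \<inter> space ?P \<in> sets ?P"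
      using mH A by (intro measurable_sets) auto
    have mI [measurable]: "(\<lambda>p. indicator A (?H p) :: ennreal) \<in> borel_measurable ?P"
      using A by (intro measurable_compose[OF mH] borel_measurable_indicator) auto
    have "emeasure N A = (\<integral>\<^sup>+p. (ennreal (\<gamma> / omega (real n)) * ennreal (\<bar>snd p\<bar> powr (r - 1))) * indicator (?H -` A \<inter> space ?P) p \<partial>?P)"
    proof -
      have "emeasure N A = emeasure ?D (?H -` A \<inter> space ?P)"
        unfolding N_def using mH A by (subst emeasure_distr) auto
      then show ?thesis by (subst (asm) emeasure_density) measurable
    qed
    also have "\<dots> = (\<integral>\<^sup>+p. ennreal (\<gamma> / omega (real n)) * (indicator A (?H p) * ennreal (\<bar>snd p\<bar> powr (r - 1))) \<partial>?P)"
      by (intro nn_integral_cong) (auto simp: indicator_def)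
    also have "\<dots> = ennreal (\<gamma> / omega (real n)) * (\<integral>\<^sup>+p. indicator A (?H p) * ennreal (\<bar>snd p\<bar> powr (r - 1)) \<partial>?P)"
      by (rule nn_integral_cmult) measurable
    also have "(\<integral>\<^sup>+p. indicator A (?H p) * ennreal (\<bar>snd p\<bar> powr (r - 1)) \<partial>?P) =
       (\<integral>\<^sup>+u. \<integral>\<^sup>+t. indicator A (?H (u, t)) * ennreal (\<bar>snd (u, t)\<bar> powr (r - 1)) \<partial>lborel \<partial>sphereM n)"
      by (rule lborel.nn_integral_fst[symmetric]) measurable
    finally show ?thesis by simp
  qed
  have "hyperplane_intensity n r \<gamma> = measure_of (hyperplanes n) (hyperplane_sets n) (emeasure N)"
    unfolding hyperplane_intensity_def
    by (intro measure_of_eq hyperplane_sets_subset em[symmetric])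
       (simp add: sigma_algebra.sigma_sets_eq[OF sigma_algebra_hyperplane_sets])
  also have "\<dots> = N" using measure_of_of_measure[of N] by (simp add: N_def)
  finally have eq: "hyperplane_intensity n r \<gamma> = N" .
  show "space (hyperplane_intensity n r \<gamma>) = hyperplanes n"
    "sets (hyperplane_intensity n r \<gamma>) = hyperplane_sets n"
    unfolding eq by (simp_all add: N_def)
  show "emeasure (hyperplane_intensity n r \<gamma>) A = ?F A" if "A \<in> hyperplane_sets n"
    unfolding eq using em[OF that] .
qed

lemma nn_integral_powr_from_0:
  assumes "r > 0" "a \<ge> 0"
  shows "(\<integral>\<^sup>+t. ennreal (t powr (r - 1)) * indicator {0..a} t \<partial>lborel) = ennreal (a powr r / r)"
  using nn_integral_has_integral_lebesgue[OF _ has_integral_powr_from_0[of "r - 1" a]] assms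
  by (simp add: ennreal_mult' ennreal_indicator mult.commute)

lemma nn_integral_separates:
  assumes r: "r > 0"
  shows "(\<integral>\<^sup>+t. indicator {t. separates n x u t} t * ennreal (\<bar>t\<bar> powr (r - 1)) \<partial>lborel)
           = ennreal (\<bar>inner_n n x u\<bar> powr r / r)"
proof -
  let ?a = "inner_n n x u"
  have pos: "(\<integral>\<^sup>+t. indicator {t. 0 < t \<and> t < b} t * ennreal (\<bar>t\<bar> powr (r - 1)) \<partial>lborel) = ennreal (b powr r / r)"
    if b: "b \<ge> 0" for b
  proof -
    have "(\<integral>\<^sup>+t. indicator {t. 0 < t \<and> t < b} t * ennreal (\<bar>t\<bar> powr (r - 1)) \<partial>lborel) =
      (\<integral>\<^sup>+t. ennreal (t powr (r - 1)) * indicator {0..b} t \<partial>lborel)"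
      by (intro nn_integral_cong_AE AE_I[of _ _ "{0, b}"]) (auto simp: indicator_def emeasure_lborel_countable)
    then show ?thesis using nn_integral_powr_from_0[OF r b] by simp
  qed
  show ?thesis
  proof (cases "?a \<ge> 0")
    case True
    then have "{t. separates n x u t} = {t. 0 < t \<and> t < ?a}" by (auto simp: separates_def)
    then show ?thesis using pos[OF True] True by simp
  next
    case False
    then have e: "{t. separates n x u t} = {t. 0 < - t \<and> - t < - ?a}" by (auto simp: separates_def)
    have "(\<integral>\<^sup>+t. indicator {t. separates n x u t} t * ennreal (\<bar>t\<bar> powr (r - 1)) \<partial>lborel) =
       (\<integral>\<^sup>+t. indicator {t. 0 < t \<and> t < - ?a} t * ennreal (\<bar>t\<bar> powr (r - 1)) \<partial>lborel)"
      unfolding e by (subst nn_integral_real_affine[where c="-1" and t=0]) (auto simp: indicator_def)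
    then show ?thesis using pos[of "- ?a"] False by simp
  qed
qed

section \<open>Poisson hyperplane processes\<close>

text \<open>The intensity is an arbitrary positive number here; \<open>gamma_hat\<close> enters only
  at the very end, through its positivity.\<close>

locale hyperplane_process =
  fixes n :: nat and r \<gamma> :: real and P :: "'w measure" and X :: "'w \<Rightarrow> (nat \<Rightarrow> real) set set"
  assumes n: "2 \<le> n" and r: "0 < r" and \<gamma>: "0 < \<gamma>"
    and process: "poisson_hyperplane_process n r \<gamma> P X"
begin

definition \<Theta> :: "(nat \<Rightarrow> real) set measure" where
  "\<Theta> = hyperplane_intensity n r \<gamma>"

definition c0 :: real where "c0 = \<gamma> / omega (real n)"

lemma c0_pos: "0 < c0"
  using \<gamma> n by (simp add: c0_def omega_pos)

lemma poisson: "poisson_process P \<Theta> X"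
  using process by (simp add: poisson_hyperplane_process_def \<Theta>_def)

sublocale prob_space P
  using poisson by (simp add: poisson_process_def)

lemma sets_Theta [simp]: "sets \<Theta> = hyperplane_sets n"
  and space_Theta [simp]: "space \<Theta> = hyperplanes n"
  by (simp_all add: \<Theta>_def sets_hyperplane_intensity space_hyperplane_intensity)

lemma emeasure_Theta:
  "A \<in> hyperplane_sets n \<Longrightarrow> emeasure \<Theta> A = ennreal c0 *
     (\<integral>\<^sup>+ u. (\<integral>\<^sup>+ t. indicator A (hyperplane n u t) * ennreal (\<bar>t\<bar> powr (r - 1)) \<partial>lborel) \<partial>sphereM n)"
  unfolding \<Theta>_def c0_def by (rule emeasure_hyperplane_intensity)

lemma X_subset: "\<omega> \<in> space P \<Longrightarrow> X \<omega> \<subseteq> hyperplanes n"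
  using poisson by (auto simp: poisson_process_def)

lemma num_points_measurable [measurable]:
  "A \<in> hyperplane_sets n \<Longrightarrow> (\<lambda>\<omega>. num_points (X \<omega>) A) \<in> borel_measurable P"
  using poisson by (auto simp: poisson_process_def)

lemma num_points_eq_0_iff: "num_points S A = 0 \<longleftrightarrow> S \<inter> A = {}"
  by (simp add: num_points_def emeasure_count_space_eq_0)

text \<open>If the intensity of a compact set were infinite, then local finiteness would fail.\<close>

lemma emeasure_hitting_finite:
  assumes K: "K \<subseteq> Rn n" "compact K"
  shows "emeasure \<Theta> (hitting n K) < \<infinity>"
proof (rule ccontr)
  assume "\<not> ?thesis"
  then have "emeasure \<Theta> (hitting n K) = \<infinity>" by (auto simp: less_top[symmetric])
  then have "AE \<omega> in P. num_points (X \<omega>) (hitting n K) = \<infinity>"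
    using poisson hitting_in_sets[OF K] unfolding poisson_process_def by auto
  moreover have "finite (X \<omega> \<inter> hitting n K)" if "\<omega> \<in> space P" for \<omega>
    using process K that unfolding poisson_hyperplane_process_def by blast
  then have "num_points (X \<omega>) (hitting n K) \<noteq> \<infinity>" if "\<omega> \<in> space P" for \<omega>
    using that by (simp add: num_points_def emeasure_count_space_finite)
  ultimately have "AE \<omega> in P. False" by (auto elim!: AE_mp intro!: AE_I2)
  then show False by (simp add: AE_False)
qed

lemma emeasure_sepset_finite: "x \<in> Rn n \<Longrightarrow> emeasure \<Theta> (sepset n x) < \<infinity>"
proof -
  assume x: "x \<in> Rn n"
  let ?K = "(\<lambda>s. scale_n n s x) ` {0..1}"
  have "emeasure \<Theta> (sepset n x) \<le> emeasure \<Theta> (hitting n ?K)"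
    using x by (intro emeasure_mono) (auto simp: sepset_eq_hitting intro!: hitting_in_sets compact_segment)
  also have "\<dots> < \<infinity>" by (intro emeasure_hitting_finite compact_segment) auto
  finally show ?thesis .
qed

lemma emeasure_sepset:
  assumes x: "x \<in> Rn n"
  shows "emeasure \<Theta> (sepset n x) = ennreal c0 * (\<integral>\<^sup>+u. ennreal (\<bar>inner_n n x u\<bar> powr r / r) \<partial>sphereM n)"
  unfolding emeasure_Theta[OF sepset_sets[OF x]]
proof (intro arg_cong[where f="\<lambda>z. ennreal c0 * z"] nn_integral_cong)
  fix u assume "u \<in> space (sphereM n)"
  then have u: "u \<in> sphere_n n" by simp
  have "(\<integral>\<^sup>+t. indicator (sepset n x) (hyperplane n u t) * ennreal (\<bar>t\<bar> powr (r - 1)) \<partial>lborel) =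
     (\<integral>\<^sup>+t. indicator {t. separates n x u t} t * ennreal (\<bar>t\<bar> powr (r - 1)) \<partial>lborel)"
    using sepset_iff[OF u x] by (intro nn_integral_cong) (auto simp: indicator_def)
  then show "(\<integral>\<^sup>+t. indicator (sepset n x) (hyperplane n u t) * ennreal (\<bar>t\<bar> powr (r - 1)) \<partial>lborel)
     = ennreal (\<bar>inner_n n x u\<bar> powr r / r)"
    using nn_integral_separates[OF r] by simp
qed

lemma measurable_inner_sphere [measurable]:
  "x \<in> Rn n \<Longrightarrow> (\<lambda>u. inner_n n x u) \<in> borel_measurable (sphereM n)"
proof -
  assume "x \<in> Rn n"
  then have [measurable]: "(\<lambda>_. x) \<in> sphereM n \<rightarrow>\<^sub>M volM n" by simp
  note [measurable] = measurable_sphereM_volM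
  show ?thesis by measurable
qed

text \<open>The sphere measure is invariant under the inverse rotation, which the adjoint then moves
  from the normal u to the point x; \<open>rotation_invariant_reduce\<close> does the rest.\<close>

lemma sepset_rotation:
  assumes x: "x \<in> Rn n" and y: "y \<in> Rn n" "norm_n n y = norm_n n x"
  shows "emeasure \<Theta> (sepset n x) = emeasure \<Theta> (sepset n y)"
proof -
  have *: "emeasure \<Theta> (sepset n x) = emeasure \<Theta> (sepset n (axis_n n (norm_n n x)))" if "x \<in> Rn n" for x
    using n that
  proof (rule rotation_invariant_reduce)
    fix i j :: nat and c s :: real and x :: "nat \<Rightarrow> real"
    assume g: "i < n" "j < n" "i \<noteq> j" "c\<^sup>2 + s\<^sup>2 = 1" and x: "x \<in> Rn n"
    have g': "c\<^sup>2 + (- s)\<^sup>2 = 1" using g by simp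
    note [measurable] = measurable_inner_sphere[OF x]
    have "(\<integral>\<^sup>+u. ennreal (\<bar>inner_n n x u\<bar> powr r / r) \<partial>sphereM n)
      = (\<integral>\<^sup>+u. ennreal (\<bar>inner_n n x u\<bar> powr r / r) \<partial>distr (sphereM n) (sphereM n) (givens i j c (- s)))"
      by (simp add: distr_givens_sphere[OF g(1-3) g'])
    also have "\<dots> = (\<integral>\<^sup>+u. ennreal (\<bar>inner_n n x (givens i j c (- s) u)\<bar> powr r / r) \<partial>sphereM n)"
      by (intro nn_integral_distr measurable_givens_sphere[OF g(1-3) g']) measurable
    also have "\<dots> = (\<integral>\<^sup>+u. ennreal (\<bar>inner_n n (givens i j c s x) u\<bar> powr r / r) \<partial>sphereM n)"
      using g by (simp add: inner_givens_left)
    finally show "emeasure \<Theta> (sepset n (givens i j c s x)) = emeasure \<Theta> (sepset n x)"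
      using x g by (simp add: emeasure_sepset givens_in_Rn)
  qed
  from *[OF x] *[OF y(1)] y(2) show ?thesis by simp
qed

text \<open>The rate in the survival probability exp (- k |x|^r) of a point. Its value in terms of
  the intensity is left open; only \<open>k_pos\<close> is drawn on.\<close>

definition k :: real where
  "k = enn2real (emeasure \<Theta> (sepset n (axis_n n 1)))"

lemma norm_axis_n [simp]: "norm_n n (axis_n n a) = \<bar>a\<bar>"
proof -
  have "inner_n n (axis_n n a) (axis_n n a) = (\<Sum>i<n. if i = 0 then a * a else 0)"
    unfolding inner_n_def by (intro sum.cong) (auto simp: axis_n_def)
  also have "\<dots> = a * a" using n by simp
  finally show ?thesis by (simp add: norm_n_sqrt)
qed

lemma emeasure_sepset_eq:
  assumes x: "x \<in> Rn n"
  shows "emeasure \<Theta> (sepset n x) = ennreal (k * norm_n n x powr r)"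
proof -
  have k: "emeasure \<Theta> (sepset n (axis_n n 1)) = ennreal k"
    unfolding k_def using emeasure_sepset_finite[of "axis_n n 1"] by simp
  have e: "axis_n n a = scale_n n a (axis_n n 1)" for a
    by (auto simp: axis_n_def scale_n_def)
  let ?a = "norm_n n x"
  have a: "0 \<le> ?a" by (simp add: L2_set_nonneg)
  have "emeasure \<Theta> (sepset n x) = emeasure \<Theta> (sepset n (scale_n n ?a (axis_n n 1)))"
    using x a by (intro sepset_rotation) auto
  also have "\<dots> = ennreal c0 * (\<integral>\<^sup>+u. ennreal (?a powr r) * ennreal (\<bar>inner_n n (axis_n n 1) u\<bar> powr r / r) \<partial>sphereM n)"
    using a r by (simp add: emeasure_sepset abs_mult powr_mult flip: ennreal_mult)
  also have "\<dots> = ennreal c0 * (ennreal (?a powr r) * (\<integral>\<^sup>+u. ennreal (\<bar>inner_n n (axis_n n 1) u\<bar> powr r / r) \<partial>sphereM n))"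
    using measurable_inner_sphere[OF axis_n_in_Rn]
    by (intro arg_cong[where f="\<lambda>z. ennreal c0 * z"] nn_integral_cmult) measurable
  also have "\<dots> = ennreal (?a powr r) * emeasure \<Theta> (sepset n (axis_n n 1))"
    by (simp add: emeasure_sepset ac_simps)
  finally have "emeasure \<Theta> (sepset n x) = ennreal (?a powr r) * emeasure \<Theta> (sepset n (axis_n n 1))" .
  moreover have "0 \<le> k" by (simp add: k_def)
  ultimately show ?thesis by (simp add: k mult.commute ennreal_mult)
qed

text \<open>For k = 0 the integral of |u i|^r over the sphere would vanish for every coordinate i.
  Almost every point of the sphere would then be the origin, against the positivity of its
  measure.\<close>

lemma k_pos: "0 < k"
proof (rule ccontr)
  assume "\<not> 0 < k"
  moreover have "0 \<le> k" by (simp add: k_def)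
  ultimately have k0: "k = 0" by simp
  have "AE u in sphereM n. u i = 0" if i: "i < n" for i
  proof -
    let ?e = "\<lambda>j\<in>{..<n}. if j = i then 1 else 0 :: real"
    have e: "?e \<in> Rn n" by (simp add: Rn_iff)
    have ip: "inner_n n ?e u = u i" for u
    proof -
      have "inner_n n ?e u = (\<Sum>j<n. if j = i then u j else 0)"
        unfolding inner_n_def by (intro sum.cong) auto
      then show ?thesis using i by simp
    qed
    note [measurable] = measurable_inner_sphere[OF e, unfolded ip]
    have "ennreal c0 * (\<integral>\<^sup>+u. ennreal (\<bar>u i\<bar> powr r / r) \<partial>sphereM n) = 0"
      using emeasure_sepset_eq[OF e] emeasure_sepset[OF e] k0 by (simp add: ip)
    then have "(\<integral>\<^sup>+u. ennreal (\<bar>u i\<bar> powr r / r) \<partial>sphereM n) = 0" using c0_pos by simp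
    then have "AE u in sphereM n. ennreal (\<bar>u i\<bar> powr r / r) = 0"
      by (subst (asm) nn_integral_0_iff_AE) measurable
    then show ?thesis
    proof eventually_elim
      case (elim u)
      then have "\<bar>u i\<bar> powr r / r \<le> 0" by (simp add: ennreal_eq_0_iff)
      then show ?case using r by (simp add: divide_le_0_iff)
    qed
  qed
  then have "AE u in sphereM n. \<forall>i<n. u i = 0" by (simp add: AE_all_countable)
  then have "AE u in sphereM n. False"
  proof (rule AE_mp[OF _ AE_I2], intro impI)
    fix u assume "u \<in> space (sphereM n)" "\<forall>i<n. u i = 0"
    then show False by (auto simp: sphere_n_def L2_set_def)
  qed
  then have "emeasure (sphereM n) (space (sphereM n)) = 0"
    by (simp add: AE_iff_measurable[OF sets.top])
  then have "hausdorff n (real n - 1) (sphere_n n) = 0"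
    by (metis emeasure_sphereM sets.top space_sphereM)
  then show False using sphere_n_hausdorff_pos[OF n] by simp
qed

section \<open>The zero cell and its void probabilities\<close>

definition Z :: "'w \<Rightarrow> (nat \<Rightarrow> real) set" where
  "Z \<omega> = zero_cell n (X \<omega>)"

lemma Z_iff: "\<omega> \<in> space P \<Longrightarrow> x \<in> Rn n \<Longrightarrow> x \<in> Z \<omega> \<longleftrightarrow> num_points (X \<omega>) (sepset n x) = 0"
  using X_subset[of \<omega>] unfolding num_points_eq_0_iff by (auto simp: Z_def zero_cell_def sepset_def)

lemma void_probability:
  assumes A: "A \<in> hyperplane_sets n" "emeasure \<Theta> A < \<infinity>"
  shows "measure P {\<omega>\<in>space P. num_points (X \<omega>) A = 0} = exp (- measure \<Theta> A)"
proof -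
  have "\<forall>k::nat. measure P {\<omega>\<in>space P. num_points (X \<omega>) A = of_nat k} =
                  measure \<Theta> A ^ k / fact k * exp (- measure \<Theta> A)"
    using poisson A unfolding poisson_process_def by auto
  from spec[OF this, of 0] show ?thesis by simp
qed

definition overlap :: "(nat \<Rightarrow> real) \<Rightarrow> (nat \<Rightarrow> real) \<Rightarrow> real" where
  "overlap x y = measure \<Theta> (sepset n x \<inter> sepset n y)"

lemma sepset_Int_sets: "x \<in> Rn n \<Longrightarrow> y \<in> Rn n \<Longrightarrow> sepset n x \<inter> sepset n y \<in> hyperplane_sets n"
  unfolding sets_hyperplaneM[symmetric] by (intro sets.Int) (auto intro: sepset_sets)

lemma emeasure_overlap:
  assumes "x \<in> Rn n" "y \<in> Rn n"
  shows "emeasure \<Theta> (sepset n x \<inter> sepset n y) = ennreal (overlap x y)"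
proof -
  have "emeasure \<Theta> (sepset n x \<inter> sepset n y) \<le> emeasure \<Theta> (sepset n x)"
    using assms by (intro emeasure_mono) (auto intro: sepset_sets)
  also have "\<dots> < \<infinity>" using assms by (intro emeasure_sepset_finite)
  finally show ?thesis unfolding overlap_def by (intro emeasure_eq_ennreal_measure) auto
qed

lemma prob_in_Z:
  assumes x: "x \<in> Rn n"
  shows "measure P {\<omega>\<in>space P. x \<in> Z \<omega>} = exp (- k * norm_n n x powr r)"
proof -
  have "{\<omega>\<in>space P. x \<in> Z \<omega>} = {\<omega>\<in>space P. num_points (X \<omega>) (sepset n x) = 0}"
    using Z_iff[OF _ x] by auto
  moreover have "measure \<Theta> (sepset n x) = k * norm_n n x powr r"
    using emeasure_sepset_eq[OF x] k_pos by (simp add: measure_def)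
  ultimately show ?thesis
    using void_probability[OF sepset_sets[OF x] emeasure_sepset_finite[OF x]] by simp
qed

text \<open>Let a, b and o be the intensities of the two separating sets and of their intersection.
  The probability is exp (- a - b + o), and its excess over the independent value is exp (- a - b +
  o) (1 - exp (- o)). This is at most o exp (- max a b), because 1 - exp (- o) <= o and o <= min a
  b.\<close>

lemma prob_both_in_Z:
  assumes x: "x \<in> Rn n" and y: "y \<in> Rn n"
  shows "measure P {\<omega>\<in>space P. x \<in> Z \<omega> \<and> y \<in> Z \<omega>} \<le>
     exp (- k * norm_n n x powr r) * exp (- k * norm_n n y powr r)
     + overlap x y * exp (- k * (max (norm_n n x) (norm_n n y)) powr r)"
proof -
  let ?A = "sepset n x" and ?B = "sepset n y"
  let ?a = "k * norm_n n x powr r" and ?b = "k * norm_n n y powr r"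
  have AB: "?A \<in> sets \<Theta>" "?B \<in> sets \<Theta>" using x y by (auto intro: sepset_sets)
  have mA: "measure \<Theta> ?A = ?a" and mB: "measure \<Theta> ?B = ?b"
    using emeasure_sepset_eq[OF x] emeasure_sepset_eq[OF y] k_pos by (simp_all add: measure_def)
  have fA: "?A \<in> fmeasurable \<Theta>" and fB: "?B \<in> fmeasurable \<Theta>"
    using AB x y emeasure_sepset_finite by (auto simp: fmeasurable_def)
  have fin: "emeasure \<Theta> (?A \<union> ?B) < \<infinity>"
    using fA fB fmeasurable.Un[OF fA fB] by (auto simp: fmeasurable_def)
  have "{\<omega>\<in>space P. x \<in> Z \<omega> \<and> y \<in> Z \<omega>} = {\<omega>\<in>space P. num_points (X \<omega>) (?A \<union> ?B) = 0}"
    using Z_iff x y unfolding num_points_eq_0_iff by blast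
  then have "measure P {\<omega>\<in>space P. x \<in> Z \<omega> \<and> y \<in> Z \<omega>} = exp (- measure \<Theta> (?A \<union> ?B))"
    using void_probability[OF sets.Un[OF AB, simplified] fin] by simp
  also have "measure \<Theta> (?A \<union> ?B) = ?a + ?b - overlap x y"
    using measure_Un3[OF fA fB] by (simp add: mA mB overlap_def)
  finally have eq: "measure P {\<omega>\<in>space P. x \<in> Z \<omega> \<and> y \<in> Z \<omega>} = exp (- ?a - ?b + overlap x y)"
    by (simp add: algebra_simps)
  have le: "overlap x y \<le> ?a" "overlap x y \<le> ?b"
    unfolding overlap_def mA[symmetric] mB[symmetric]
    using fA fB by (auto intro!: measure_mono_fmeasurable simp: fmeasurable_def AB)
  have o0: "0 \<le> overlap x y" by (simp add: overlap_def)
  have maxeq: "k * (max (norm_n n x) (norm_n n y)) powr r = max ?a ?b"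
  proof (cases "norm_n n x \<le> norm_n n y")
    case True
    then have "?a \<le> ?b" using k_pos r by (intro mult_left_mono powr_mono2) (auto simp: L2_set_nonneg)
    then show ?thesis using True by simp
  next
    case False
    then have "?b \<le> ?a" using k_pos r by (intro mult_left_mono powr_mono2) (auto simp: L2_set_nonneg)
    then show ?thesis using False by simp
  qed
  have "exp (- ?a - ?b) * exp (overlap x y) - exp (- ?a - ?b) = exp (- ?a - ?b + overlap x y) * (1 - exp (- overlap x y))"
    by (simp add: algebra_simps flip: exp_add)
  also have "\<dots> \<le> exp (- ?a - ?b + overlap x y) * overlap x y"
    using exp_ge_add_one_self[of "- overlap x y"] by (intro mult_left_mono) auto
  also have "\<dots> \<le> exp (- max ?a ?b) * overlap x y"
    using le o0 by (intro mult_right_mono) (auto simp: max_def)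
  finally show ?thesis unfolding eq using maxeq
    by (simp add: exp_add exp_diff exp_minus field_simps)
qed

end

section \<open>Spherical caps\<close>

lemma kappa_eq_unit_ball_vol: "kappa s = unit_ball_vol s"
  by (simp add: kappa_def unit_ball_vol_def)

text \<open>The Beta integral after t = s^2, the form in which it meets slices of a ball at height
  s.\<close>

lemma nn_integral_Beta_squares:
  assumes "p > 0" "q > 0"
  shows "(\<integral>\<^sup>+s. ennreal (s powr (2 * p - 1) * (1 - s\<^sup>2) powr (q - 1)) * indicator {0..1} s \<partial>lborel)
           = ennreal (Beta p q / 2)"
proof -
  have "((\<lambda>t. t powr (p - 1) * (1 - t) powr (q - 1)) has_integral Beta p q) {0..1}"
    using assms by (rule has_integral_Beta_real)
  from nn_integral_has_integral_lebesgue[OF _ this] have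
     "ennreal (Beta p q) = nn_integral lborel (\<lambda>t. ennreal (t powr (p - 1) * (1 - t) powr (q - 1) *
                                indicator {0^2..1^2} t))"
    by (simp add: mult_ac ennreal_mult' ennreal_indicator)
  also have "\<dots> = (\<integral>\<^sup>+ x. ennreal (x\<^sup>2 powr (p - 1) * (1 - x\<^sup>2) powr (q - 1) * (2 * x) *
                          indicator {0..1} x) \<partial>lborel)"
    by (subst nn_integral_substitution[where g = "\<lambda>x. x ^ 2" and g' = "\<lambda>x. 2 * x"])
       (auto intro!: derivative_eq_intros continuous_intros simp: set_borel_measurable_def)
  also have "\<dots> = (\<integral>\<^sup>+ x. ennreal 2 * (ennreal (x powr (2 * p - 1) * (1 - x\<^sup>2) powr (q - 1)) * indicator {0..1} x) \<partial>lborel)"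
  proof (intro nn_integral_cong_AE AE_I[of _ _ "{0}"])
    have e: "x\<^sup>2 powr (p - 1) * x = x powr (2 * p - 1)" if "x > 0" for x :: real
    proof -
      have "x\<^sup>2 powr (p - 1) * x powr 1 = x powr (2 * (p - 1)) * x powr 1"
        using that by (simp add: powr_powr flip: powr_numeral)
      also have "\<dots> = x powr (2 * (p - 1) + 1)" by (rule powr_add[symmetric])
      also have "2 * (p - 1) + 1 = 2 * p - 1" by simp
      finally show ?thesis using that by simp
    qed
    have e2: "x\<^sup>2 powr (p - 1) * (1 - x\<^sup>2) powr (q - 1) * (2 * x) = 2 * (x powr (2 * p - 1) * (1 - x\<^sup>2) powr (q - 1))" if "x > 0" for x :: real
    proof -
      have "x\<^sup>2 powr (p - 1) * (1 - x\<^sup>2) powr (q - 1) * (2 * x) = 2 * ((x\<^sup>2 powr (p - 1) * x) * (1 - x\<^sup>2) powr (q - 1))"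
        by (simp only: mult_ac)
      then show ?thesis by (simp only: e[OF that])
    qed
    show "{x \<in> space lborel. ennreal (x\<^sup>2 powr (p - 1) * (1 - x\<^sup>2) powr (q - 1) * (2 * x) * indicator {0..1} x) \<noteq>
      ennreal 2 * (ennreal (x powr (2 * p - 1) * (1 - x\<^sup>2) powr (q - 1)) * indicator {0..1} x)} \<subseteq> {0}"
    proof (intro subsetI)
      fix x assume x: "x \<in> {x \<in> space lborel. ennreal (x\<^sup>2 powr (p - 1) * (1 - x\<^sup>2) powr (q - 1) * (2 * x) * indicator {0..1} x) \<noteq>
        ennreal 2 * (ennreal (x powr (2 * p - 1) * (1 - x\<^sup>2) powr (q - 1)) * indicator {0..1} x)}"
      show "x \<in> {0}"
      proof (rule ccontr)
        assume "x \<notin> {0}"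
        then consider "x < 0" | "x > 0" by force
        then have "ennreal (x\<^sup>2 powr (p - 1) * (1 - x\<^sup>2) powr (q - 1) * (2 * x) * indicator {0..1} x) =
          ennreal 2 * (ennreal (x powr (2 * p - 1) * (1 - x\<^sup>2) powr (q - 1)) * indicator {0..1} x)"
        proof cases
          case 2
          show ?thesis unfolding e2[OF 2] by (simp add: ennreal_mult' indicator_def)
        qed auto
        then show False using x by simp
      qed
    qed
  qed auto
  also have "\<dots> = ennreal 2 * (\<integral>\<^sup>+ x. ennreal (x powr (2 * p - 1) * (1 - x\<^sup>2) powr (q - 1)) * indicator {0..1} x \<partial>lborel)"
    by (rule nn_integral_cmult) measurable
  finally have "ennreal (1 / 2) * ennreal (Beta p q) =
      ennreal (1 / 2) * (ennreal 2 * (\<integral>\<^sup>+ x. ennreal (x powr (2 * p - 1) * (1 - x\<^sup>2) powr (q - 1)) * indicator {0..1} x \<partial>lborel))"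
    by (rule arg_cong)
  also have "\<dots> = (ennreal (1 / 2) * ennreal 2) * (\<integral>\<^sup>+ x. ennreal (x powr (2 * p - 1) * (1 - x\<^sup>2) powr (q - 1)) * indicator {0..1} x \<partial>lborel)"
    by (rule mult.assoc[symmetric])
  also have "ennreal (1 / 2) * ennreal 2 = 1"
    by (subst ennreal_mult[symmetric]) auto
  finally show ?thesis
    by (subst (asm) ennreal_mult'[symmetric]) auto
qed

text \<open>For 0 <= s and up to the factor \<open>kappa (m - 1)\<close>, the volume of the part of
  the unit ball of dimension m above height s. Values in \<open>ennreal\<close> let the moments be
  computed by Tonelli.\<close>

definition cap_profile :: "nat \<Rightarrow> real \<Rightarrow> ennreal" where
  "cap_profile m s = (\<integral>\<^sup>+y. ennreal ((1 - y\<^sup>2) powr ((real m - 1) / 2)) * indicator {s<..1} y \<partial>lborel)"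

lemma measurable_cap_profile [measurable]: "cap_profile m \<in> borel_measurable borel"
proof -
  have "(\<lambda>s. \<integral>\<^sup>+y. (\<lambda>(s, y). ennreal ((1 - y\<^sup>2) powr ((real m - 1) / 2)) * (if s < y \<and> y \<le> 1 then 1 else 0)) (s, y) \<partial>lborel) \<in> borel_measurable borel"
    by (rule lborel.borel_measurable_nn_integral_fst) measurable
  also have "(\<lambda>s. \<integral>\<^sup>+y. (\<lambda>(s, y). ennreal ((1 - y\<^sup>2) powr ((real m - 1) / 2)) * (if s < y \<and> y \<le> 1 then 1 else 0)) (s, y) \<partial>lborel) = cap_profile m"
    unfolding cap_profile_def by (intro ext nn_integral_cong) (auto simp: indicator_def)
  finally show ?thesis .
qed

text \<open>For y > s the factor y / s is at least 1, and inserting it gives the integrand an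
  elementary primitive. The price 1 / s becomes s^(-2) after squaring and stays integrable against
  s^(r - 1) because r > 2.\<close>

lemma cap_profile_le:
  assumes m: "m \<ge> 1" and s: "0 < s" "s \<le> 1"
  shows "cap_profile m s \<le> ennreal ((1 - s\<^sup>2) powr ((real m + 1) / 2) / ((real m + 1) * s))"
proof -
  define F where "F y = (1 - y\<^sup>2) powr ((real m + 1) / 2) / (- ((real m + 1) * s))" for y
  have deriv: "(F has_real_derivative (y / s * (1 - y\<^sup>2) powr ((real m - 1) / 2))) (at y)" if "s < y" "y < 1" for y
  proof -
    have p: "1 - y\<^sup>2 > 0" using that s by (simp add: abs_square_less_1)
    have "((\<lambda>y. (1 - y\<^sup>2) powr ((real m + 1) / 2)) has_real_derivative
         ((real m + 1) / 2) * (1 - y\<^sup>2) powr ((real m + 1) / 2 - 1) * (- (2 * y))) (at y)"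
      using p by (auto intro!: derivative_eq_intros simp: field_simps)
    from DERIV_cdivide[OF this, of "- ((real m + 1) * s)"]
    have "(F has_real_derivative (((real m + 1) / 2) * (1 - y\<^sup>2) powr ((real m + 1) / 2 - 1) * (- (2 * y))) / (- ((real m + 1) * s))) (at y)"
      unfolding F_def .
    also have "((real m + 1) / 2) * (1 - y\<^sup>2) powr ((real m + 1) / 2 - 1) * (- (2 * y)) / (- ((real m + 1) * s)) = y / s * (1 - y\<^sup>2) powr ((real m + 1) / 2 - 1)"
      using s by (simp add: divide_simps)
    also have "(real m + 1) / 2 - 1 = (real m - 1) / 2" by (simp add: field_simps)
    finally show ?thesis .
  qed
  have cont: "continuous_on {s..1} F"
    unfolding F_def using s
    by (intro continuous_on_divide continuous_on_powr' continuous_intros) (auto simp: abs_square_le_1)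
  have "((\<lambda>y. y / s * (1 - y\<^sup>2) powr ((real m - 1) / 2)) has_integral (F 1 - F s)) {s..1}"
    using s deriv cont
    by (intro fundamental_theorem_of_calculus_interior) (auto simp flip: has_real_derivative_iff_has_vector_derivative)
  from nn_integral_has_integral_lebesgue[OF _ this]
  have "(\<integral>\<^sup>+y. ennreal (indicator {s..1} y * (y / s * (1 - y\<^sup>2) powr ((real m - 1) / 2))) \<partial>lborel) = ennreal (F 1 - F s)"
    using s by auto
  also have "F 1 - F s = (1 - s\<^sup>2) powr ((real m + 1) / 2) / ((real m + 1) * s)"
    by (simp add: F_def)
  finally have eq: "(\<integral>\<^sup>+y. ennreal (indicator {s..1} y * (y / s * (1 - y\<^sup>2) powr ((real m - 1) / 2))) \<partial>lborel)
    = ennreal ((1 - s\<^sup>2) powr ((real m + 1) / 2) / ((real m + 1) * s))" .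
  show ?thesis unfolding cap_profile_def eq[symmetric]
  proof (intro nn_integral_mono)
    fix y :: real
    show "ennreal ((1 - y\<^sup>2) powr ((real m - 1) / 2)) * indicator {s<..1} y \<le> ennreal (indicator {s..1} y * (y / s * (1 - y\<^sup>2) powr ((real m - 1) / 2)))"
    proof (cases "y \<in> {s<..1}")
      case True
      then have "1 * (1 - y\<^sup>2) powr ((real m - 1) / 2) \<le> y / s * (1 - y\<^sup>2) powr ((real m - 1) / 2)"
        using s by (intro mult_right_mono) auto
      then show ?thesis using True by (simp add: ennreal_leI)
    qed simp
  qed
qed

text \<open>Bound for the second moment of the cap volume divided by its first moment and by the
  volume of the ball, with heights weighted by |t|^(r - 1).\<close>

definition cap_ratio :: "nat \<Rightarrow> real \<Rightarrow> real" where
  "cap_ratio m r = kappa (real m - 1) / kappa (real m) *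
     (r * Beta (r / 2 - 1) (real m + 2) / ((real m + 1)\<^sup>2 * Beta ((r + 1) / 2) ((real m + 1) / 2)))"

lemma Beta_real_pos: "0 < p \<Longrightarrow> 0 < q \<Longrightarrow> 0 < Beta p (q :: real)"
  by (simp add: Beta_def Gamma_real_pos)

lemma cap_ratio_pos: "r > 2 \<Longrightarrow> m \<ge> 1 \<Longrightarrow> 0 < cap_ratio m r"
  unfolding cap_ratio_def by (intro mult_pos_pos divide_pos_pos kappa_pos Beta_real_pos) (auto intro!: kappa_pos)

text \<open>Integrating over the cutting height s first leaves y^r / r, and what remains is a Beta
  integral.\<close>

lemma nn_integral_cap_profile:
  assumes r: "r > 0" and m: "m \<ge> 1"
  shows "(\<integral>\<^sup>+s. ennreal (s powr (r - 1)) * cap_profile m s * indicator {0..} s \<partial>lborel)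
    = ennreal (Beta ((r + 1) / 2) ((real m + 1) / 2) / (2 * r))"
proof -
  let ?f = "\<lambda>s y. ennreal (s powr (r - 1)) * indicator {0..} s * (ennreal ((1 - y\<^sup>2) powr ((real m - 1) / 2)) * (if s < y \<and> y \<le> 1 then 1 else 0))"
  have "(\<integral>\<^sup>+s. ennreal (s powr (r - 1)) * cap_profile m s * indicator {0..} s \<partial>lborel) = (\<integral>\<^sup>+s. \<integral>\<^sup>+y. ?f s y \<partial>lborel \<partial>lborel)"
    unfolding cap_profile_def
    by (subst nn_integral_cmult) (auto intro!: nn_integral_cong simp: indicator_def of_bool_def mult_ac)
  also have "\<dots> = (\<integral>\<^sup>+y. \<integral>\<^sup>+s. ?f s y \<partial>lborel \<partial>lborel)"
    by (rule lborel_pair.Fubini') measurable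
  also have "\<dots> = (\<integral>\<^sup>+y. ennreal (1 / r) * (ennreal (y powr (2 * ((r + 1) / 2) - 1) * (1 - y\<^sup>2) powr ((real m + 1) / 2 - 1)) * indicator {0..1} y) \<partial>lborel)"
  proof (rule nn_integral_cong)
    fix y :: real
    show "(\<integral>\<^sup>+s. ?f s y \<partial>lborel) = ennreal (1 / r) * (ennreal (y powr (2 * ((r + 1) / 2) - 1) * (1 - y\<^sup>2) powr ((real m + 1) / 2 - 1)) * indicator {0..1} y)"
    proof (cases "0 \<le> y \<and> y \<le> 1")
      case True
      have e: "(real m + 1) / 2 - 1 = (real m - 1) / 2" "2 * ((r + 1) / 2) - 1 = r" by (simp_all add: field_simps)
      have "(\<integral>\<^sup>+s. ?f s y \<partial>lborel) = (\<integral>\<^sup>+s. ennreal ((1 - y\<^sup>2) powr ((real m - 1) / 2)) * (ennreal (s powr (r - 1)) * indicator {0..y} s) \<partial>lborel)"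
        using True by (intro nn_integral_cong_AE AE_I[of _ _ "{y}"]) (auto simp: indicator_def mult_ac)
      also have "\<dots> = ennreal ((1 - y\<^sup>2) powr ((real m - 1) / 2)) * ennreal (y powr r / r)"
        using True r by (subst nn_integral_cmult) (auto simp: nn_integral_powr_from_0)
      finally show ?thesis unfolding e using True r by (simp add: ac_simps flip: ennreal_mult)
    next
      case False
      then have "(\<integral>\<^sup>+s. ?f s y \<partial>lborel) = (\<integral>\<^sup>+(s::real). 0 \<partial>lborel)"
        by (intro nn_integral_cong) (auto simp: indicator_def)
      then show ?thesis using False by auto
    qed
  qed
  also have "\<dots> = ennreal (1 / r) * ennreal (Beta ((r + 1) / 2) ((real m + 1) / 2) / 2)"
  proof -
    have B: "(\<integral>\<^sup>+y. ennreal (y powr (2 * ((r + 1) / 2) - 1) * (1 - y\<^sup>2) powr ((real m + 1) / 2 - 1)) * indicator {0..1} y \<partial>lborel)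
      = ennreal (Beta ((r + 1) / 2) ((real m + 1) / 2) / 2)"
      using r by (intro nn_integral_Beta_squares) auto
    show ?thesis unfolding B[symmetric] by (rule nn_integral_cmult) measurable
  qed
  finally show ?thesis using r by (simp add: mult.commute flip: ennreal_mult')
qed

lemma nn_integral_cap_profile_square_le:
  assumes r: "r > 2" and m: "m \<ge> 1"
  shows "(\<integral>\<^sup>+s. ennreal (s powr (r - 1)) * (cap_profile m s)\<^sup>2 * indicator {0..} s \<partial>lborel)
    \<le> ennreal (Beta (r / 2 - 1) (real m + 2) / (2 * (real m + 1)\<^sup>2))"
proof -
  have "(\<integral>\<^sup>+s. ennreal (s powr (r - 1)) * (cap_profile m s)\<^sup>2 * indicator {0..} s \<partial>lborel) \<le>
     (\<integral>\<^sup>+s. ennreal (1 / (real m + 1)\<^sup>2) * (ennreal (s powr (2 * (r / 2 - 1) - 1) * (1 - s\<^sup>2) powr (real m + 2 - 1)) * indicator {0..1} s) \<partial>lborel)"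
  proof (intro nn_integral_mono)
    fix s :: real
    show "ennreal (s powr (r - 1)) * (cap_profile m s)\<^sup>2 * indicator {0..} s \<le> ennreal (1 / (real m + 1)\<^sup>2) * (ennreal (s powr (2 * (r / 2 - 1) - 1) * (1 - s\<^sup>2) powr (real m + 2 - 1)) * indicator {0..1} s)"
    proof -
      consider "s \<le> 0" | "0 < s" "s \<le> 1" | "1 < s" by linarith
      then show ?thesis
      proof cases
        case 1 then show ?thesis by (auto simp: indicator_def)
      next
        case 2
        let ?h = "(1 - s\<^sup>2) powr ((real m + 1) / 2) / ((real m + 1) * s)"
        have "ennreal (s powr (r - 1)) * (cap_profile m s)\<^sup>2 \<le> ennreal (s powr (r - 1)) * (ennreal ?h)\<^sup>2"
          using cap_profile_le[OF m 2] by (intro mult_left_mono power_mono) auto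
        also have "\<dots> = ennreal (s powr (r - 1) * ?h\<^sup>2)"
          using 2 by (simp add: ennreal_power ennreal_mult')
        also have "s powr (r - 1) * ?h\<^sup>2 = 1 / (real m + 1)\<^sup>2 * (s powr (2 * (r / 2 - 1) - 1) * (1 - s\<^sup>2) powr (real m + 2 - 1))"
        proof -
          have "((1 - s\<^sup>2) powr ((real m + 1) / 2))\<^sup>2 = (1 - s\<^sup>2) powr (real m + 2 - 1)"
            by (simp add: power2_eq_square add.commute flip: powr_add)
          moreover have "s powr (r - 1) / s\<^sup>2 = s powr (2 * (r / 2 - 1) - 1)"
            using 2 by (simp add: powr_diff[symmetric] flip: powr_numeral)
          moreover have "s powr (r - 1) * ?h\<^sup>2 = 1 / (real m + 1)\<^sup>2 * ((s powr (r - 1) / s\<^sup>2) * ((1 - s\<^sup>2) powr ((real m + 1) / 2))\<^sup>2)"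
            by (simp add: power_divide power_mult_distrib)
          ultimately show ?thesis by (simp only:)
        qed
        also have "ennreal (1 / (real m + 1)\<^sup>2 * (s powr (2 * (r / 2 - 1) - 1) * (1 - s\<^sup>2) powr (real m + 2 - 1)))
          = ennreal (1 / (real m + 1)\<^sup>2) * ennreal (s powr (2 * (r / 2 - 1) - 1) * (1 - s\<^sup>2) powr (real m + 2 - 1))"
          by (rule ennreal_mult') simp
        finally show ?thesis using 2 by (simp only: indicator_simps atLeast_iff atLeastAtMost_iff less_imp_le mult_1_right simp_thms)
      next
        case 3
        then have "cap_profile m s = 0" by (simp add: cap_profile_def)
        then show ?thesis by simp
      qed
    qed
  qed
  also have "\<dots> = ennreal (1 / (real m + 1)\<^sup>2) * ennreal (Beta (r / 2 - 1) (real m + 2) / 2)"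
    using r nn_integral_Beta_squares[of "r / 2 - 1" "real m + 2"] by (subst nn_integral_cmult) auto
  finally show ?thesis by (simp add: mult.commute flip: ennreal_mult')
qed

lemma nn_integral_even:
  fixes f :: "real \<Rightarrow> ennreal"
  assumes [measurable]: "f \<in> borel_measurable borel"
  shows "(\<integral>\<^sup>+t. f \<bar>t\<bar> \<partial>lborel) = 2 * (\<integral>\<^sup>+t. f t * indicator {0..} t \<partial>lborel)"
proof -
  have "(\<integral>\<^sup>+t. f \<bar>t\<bar> \<partial>lborel) = (\<integral>\<^sup>+t. f t * indicator {0..} t + f (- t) * indicator {0..} (- t) \<partial>lborel)"
  proof (intro nn_integral_cong_AE AE_I[of _ _ "{0}"] subsetI)
    fix t assume "t \<in> {t \<in> space lborel. f \<bar>t\<bar> \<noteq> f t * indicator {0..} t + f (- t) * indicator {0..} (- t)}"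
    then show "t \<in> {0}" by (cases rule: linorder_cases[of t 0]) auto
  qed auto
  also have "\<dots> = (\<integral>\<^sup>+t. f t * indicator {0..} t \<partial>lborel) + (\<integral>\<^sup>+t. f (- t) * indicator {0..} (- t) \<partial>lborel)"
    by (rule nn_integral_add) measurable
  also have "(\<integral>\<^sup>+t. f (- t) * indicator {0..} (- t) \<partial>lborel) = (\<integral>\<^sup>+t. f t * indicator {0..} t \<partial>lborel)"
    by (subst nn_integral_real_affine[of "\<lambda>t. f t * indicator {0..} t" "-1" 0]) auto
  finally show ?thesis by (simp add: mult_2)
qed

lemma cap_profile_moments:
  assumes r: "r > 2" and m: "m \<ge> 1"
  shows "ennreal (kappa (real m - 1)) * (\<integral>\<^sup>+t. ennreal (\<bar>t\<bar> powr (r - 1)) * (cap_profile m \<bar>t\<bar>)\<^sup>2 \<partial>lborel)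
    \<le> ennreal (kappa (real m) * cap_ratio m r) * (\<integral>\<^sup>+t. ennreal (\<bar>t\<bar> powr (r - 1)) * cap_profile m \<bar>t\<bar> \<partial>lborel)"
proof -
  have k: "0 < kappa (real m)" "0 < kappa (real m - 1)" using m by (auto intro!: kappa_pos)
  have b: "0 < Beta (r / 2 - 1) (real m + 2)" "0 < Beta ((r + 1) / 2) ((real m + 1) / 2)"
    using r by (auto intro!: Beta_real_pos)
  have two: "2 * ennreal z = ennreal (2 * z)" for z by (simp add: ennreal_mult')
  have 1: "(\<integral>\<^sup>+t. ennreal (\<bar>t\<bar> powr (r - 1)) * (cap_profile m \<bar>t\<bar>)\<^sup>2 \<partial>lborel) \<le> 2 * ennreal (Beta (r / 2 - 1) (real m + 2) / (2 * (real m + 1)\<^sup>2))"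
    using nn_integral_cap_profile_square_le[OF r m]
    by (subst nn_integral_even[of "\<lambda>t. ennreal (t powr (r - 1)) * (cap_profile m t)\<^sup>2"]) (auto intro: mult_left_mono)
  have 2: "(\<integral>\<^sup>+t. ennreal (\<bar>t\<bar> powr (r - 1)) * cap_profile m \<bar>t\<bar> \<partial>lborel) = 2 * ennreal (Beta ((r + 1) / 2) ((real m + 1) / 2) / (2 * r))"
    using nn_integral_cap_profile[OF _ m, of r] r
    by (subst nn_integral_even[of "\<lambda>t. ennreal (t powr (r - 1)) * cap_profile m t"]) auto
  have "ennreal (kappa (real m - 1)) * (\<integral>\<^sup>+t. ennreal (\<bar>t\<bar> powr (r - 1)) * (cap_profile m \<bar>t\<bar>)\<^sup>2 \<partial>lborel) \<le>
     ennreal (kappa (real m - 1)) * (2 * ennreal (Beta (r / 2 - 1) (real m + 2) / (2 * (real m + 1)\<^sup>2)))"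
    using 1 by (rule mult_left_mono) simp
  also have "\<dots> = ennreal (kappa (real m - 1) * (2 * (Beta (r / 2 - 1) (real m + 2) / (2 * (real m + 1)\<^sup>2))))"
    unfolding two using k by (subst ennreal_mult') auto
  also have "kappa (real m - 1) * (2 * (Beta (r / 2 - 1) (real m + 2) / (2 * (real m + 1)\<^sup>2))) =
     kappa (real m) * cap_ratio m r * (2 * (Beta ((r + 1) / 2) ((real m + 1) / 2) / (2 * r)))"
    using k b r by (simp add: cap_ratio_def field_simps)
  also have "ennreal \<dots> = ennreal (kappa (real m) * cap_ratio m r) * (2 * ennreal (Beta ((r + 1) / 2) ((real m + 1) / 2) / (2 * r)))"
    unfolding two using k cap_ratio_pos[OF r m] by (subst ennreal_mult') auto
  finally show ?thesis unfolding 2 .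
qed

section \<open>Caps cut from a ball of radius R by a hyperplane with arbitrary normal\<close>

definition cap_vol :: "nat \<Rightarrow> real \<Rightarrow> (nat \<Rightarrow> real) \<Rightarrow> real \<Rightarrow> ennreal" where
  "cap_vol m R w t = emeasure (volM m) {c \<in> Rn m. norm_n m c \<le> R \<and> separates m c w t}"

lemma cap_set_measurable:
  assumes w: "w \<in> Rn m"
  shows "{c \<in> Rn m. norm_n m c \<le> R \<and> separates m c w t} \<in> sets (volM m)"
proof -
  have [measurable]: "(\<lambda>_. w) \<in> volM m \<rightarrow>\<^sub>M volM m" using w by simp
  have "{c \<in> space (volM m). norm_n m c \<le> R \<and> separates m c w t} \<in> sets (volM m)"
    unfolding separates_def by measurable
  then show ?thesis by simp
qed

lemma cap_vol_rotation:
  assumes m: "m \<ge> 2" and w: "w \<in> Rn m"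
  shows "cap_vol m R w t = cap_vol m R (axis_n m (norm_n m w)) t"
  using m w
proof (rule rotation_invariant_reduce)
  fix i j :: nat and c s :: real and w :: "nat \<Rightarrow> real"
  assume g: "i < m" "j < m" "i \<noteq> j" "c\<^sup>2 + s\<^sup>2 = 1" and w: "w \<in> Rn m"
  have g': "c\<^sup>2 + (- s)\<^sup>2 = 1" using g by simp
  let ?g = "givens i j c (- s)" and ?S = "{c \<in> Rn m. norm_n m c \<le> R \<and> separates m c w t}"
  have "inner_n m d (givens i j c s w) = inner_n m (?g d) w" for d
    using inner_givens_left[OF g(1-3), of c "- s" d w] by simp
  then have "{d \<in> Rn m. norm_n m d \<le> R \<and> separates m d (givens i j c s w) t} = ?g -` ?S \<inter> space (volM m)"
    using g by (auto simp: separates_def norm_givens[OF g(1-3) g'] givens_in_Rn)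
  then have "cap_vol m R (givens i j c s w) t = emeasure (distr (volM m) (volM m) ?g) ?S"
    unfolding cap_vol_def using g cap_set_measurable[OF w] by (subst emeasure_distr) (auto intro: measurable_givens)
  also have "\<dots> = cap_vol m R w t"
    unfolding cap_vol_def distr_givens[OF g(1-3) g'] ..
  finally show "cap_vol m R (givens i j c s w) t = cap_vol m R w t" .
qed

text \<open>The slice at height y of the first coordinate is a ball of dimension m - 1 and radius
  sqrt (R^2 - y^2). The two heights with |y| = R form a null set and are left out, since the ball
  formula is applied to a positive radius.\<close>

lemma cap_vol_axis:
  assumes m: "m \<ge> 2" and R: "R > 0" and a: "a > 0" and t: "t \<noteq> 0"
  shows "cap_vol m R (axis_n m a) t = ennreal (kappa (real m - 1) * R ^ m) * cap_profile m \<bar>t / (a * R)\<bar>"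
proof -
  let ?S = "{c \<in> Rn m. norm_n m c \<le> R \<and> separates m c (axis_n m a) t}"
  let ?I = "{..<m} - {0::nat}"
  let ?M = "Pi\<^sub>M ?I (\<lambda>_. lborel :: real measure)"
  have S: "?S \<in> sets (volM m)" by (rule cap_set_measurable) simp
  have inner: "inner_n m c (axis_n m a) = a * c 0" for c
  proof -
    have "inner_n m c (axis_n m a) = (\<Sum>i<m. if i = 0 then a * c i else 0)"
      unfolding inner_n_def by (intro sum.cong) (auto simp: axis_n_def)
    then show ?thesis using m by simp
  qed
  have cardI: "card ?I = m - 1" using m by simp
  define h where "h y = ennreal ((1 - y\<^sup>2) powr ((real m - 1) / 2))" for y :: real
  have slice: "(\<integral>\<^sup>+x. indicator ?S (x(0 := y)) \<partial>?M) =
     (if \<bar>y\<bar> < R \<and> (0 < t \<and> t < a * y \<or> t < 0 \<and> a * y < t)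
       then ennreal (kappa (real m - 1) * R ^ (m - 1)) * h (y / R) else 0)" if "\<bar>y\<bar> \<noteq> R" for y
  proof -
    have upd: "x(0 := y) \<in> Rn m" if "x \<in> space ?M" for x
      using that m by (auto simp: Rn_iff space_PiM PiE_iff extensional_def)
    have nrm: "norm_n m (x(0 := y)) = sqrt (y\<^sup>2 + (\<Sum>i\<in>?I. (x i)\<^sup>2))" for x
    proof -
      have "(\<Sum>i<m. ((x(0 := y)) i)\<^sup>2) = y\<^sup>2 + (\<Sum>i\<in>?I. ((x(0 := y)) i)\<^sup>2)"
        using m by (subst sum.remove[of _ 0]) auto
      also have "(\<Sum>i\<in>?I. ((x(0 := y)) i)\<^sup>2) = (\<Sum>i\<in>?I. (x i)\<^sup>2)" by (intro sum.cong) auto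
      finally show ?thesis by (simp add: L2_set_def)
    qed
    show ?thesis
    proof (cases "\<bar>y\<bar> < R \<and> (0 < t \<and> t < a * y \<or> t < 0 \<and> a * y < t)")
      case True
      define \<rho> where "\<rho> = sqrt (R\<^sup>2 - y\<^sup>2)"
      have yR: "y\<^sup>2 < R\<^sup>2" using True power_strict_mono[of "\<bar>y\<bar>" R 2] by simp
      have \<rho>: "\<rho> > 0" using yR by (simp add: \<rho>_def)
      have "(\<integral>\<^sup>+x. indicator ?S (x(0 := y)) \<partial>?M) = (\<integral>\<^sup>+x. indicator ({f. sqrt (\<Sum>i\<in>?I. (f i)\<^sup>2) \<le> \<rho>} \<inter> space ?M) x \<partial>?M)"
      proof (rule nn_integral_cong)
        fix x assume x: "x \<in> space ?M"
        have "norm_n m (x(0 := y)) \<le> R \<longleftrightarrow> sqrt (\<Sum>i\<in>?I. (x i)\<^sup>2) \<le> \<rho>"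
          using R by (simp add: nrm \<rho>_def real_sqrt_le_iff' sum_nonneg algebra_simps)
        then show "indicator ?S (x(0 := y)) = (indicator ({f. sqrt (\<Sum>i\<in>?I. (f i)\<^sup>2) \<le> \<rho>} \<inter> space ?M) x :: ennreal)"
          using x upd[OF x] True by (simp add: indicator_def separates_def inner)
      qed
      also have "\<dots> = emeasure ?M ({f. sqrt (\<Sum>i\<in>?I. (f i)\<^sup>2) \<le> \<rho>} \<inter> space ?M)"
        by (rule nn_integral_indicator) measurable
      also have "\<dots> = ennreal (unit_ball_vol (real (m - 1)) * \<rho> ^ (m - 1))"
        using emeasure_cball_aux[of ?I \<rho>] \<rho> cardI by simp
      also have "real (m - 1) = real m - 1" using m by simp
      also have "\<rho> ^ (m - 1) = R ^ (m - 1) * (1 - (y / R)\<^sup>2) powr ((real m - 1) / 2)"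
      proof -
        have "\<rho> = R * sqrt (1 - (y / R)\<^sup>2)"
        proof -
          have "R\<^sup>2 - y\<^sup>2 = R\<^sup>2 * (1 - (y / R)\<^sup>2)" using R by (simp add: field_simps)
          then show ?thesis using R by (simp add: \<rho>_def real_sqrt_mult)
        qed
        moreover have "0 < 1 - (y / R)\<^sup>2" using yR R by (simp add: power_divide)
        then have "sqrt (1 - (y / R)\<^sup>2) ^ (m - 1) = (1 - (y / R)\<^sup>2) powr ((real m - 1) / 2)"
          using m by (simp add: powr_half_sqrt[symmetric] powr_powr powr_realpow[symmetric] of_nat_diff)
        ultimately show ?thesis by (simp add: power_mult_distrib)
      qed
      finally have fin: "(\<integral>\<^sup>+x. indicator ?S (x(0 := y)) \<partial>?M) = ennreal (unit_ball_vol (real m - 1) *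
         (R ^ (m - 1) * (1 - (y / R)\<^sup>2) powr ((real m - 1) / 2)))" .
      show ?thesis unfolding fin using True R m
        by (simp add: h_def kappa_eq_unit_ball_vol ennreal_mult' mult.assoc)
    next
      case False
      have "indicator ?S (x(0 := y)) = (0::ennreal)" if "x \<in> space ?M" for x
      proof (cases "\<bar>y\<bar> < R")
        case True
        then show ?thesis using False by (auto simp: indicator_def separates_def inner)
      next
        case ge: False
        then have "R < \<bar>y\<bar>" using \<open>\<bar>y\<bar> \<noteq> R\<close> by simp
        also have "\<bar>y\<bar> \<le> norm_n m (x(0 := y))"
          unfolding nrm by (rule real_le_rsqrt) (simp add: sum_nonneg)
        finally show ?thesis by (auto simp: indicator_def)
      qed
      then have "(\<integral>\<^sup>+x. indicator ?S (x(0 := y)) \<partial>?M) = (\<integral>\<^sup>+x. 0 \<partial>?M)" by (rule nn_integral_cong)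
      then show ?thesis using False by auto
    qed
  qed
  have [measurable]: "h \<in> borel_measurable borel" unfolding h_def by measurable
  let ?T = "\<lambda>y. indicator {\<bar>t / (a * R)\<bar><..1} (sgn t * y) :: ennreal"
  have "cap_vol m R (axis_n m a) t = (\<integral>\<^sup>+x. indicator ?S x \<partial>volM m)"
    unfolding cap_vol_def using S by simp
  also have "\<dots> = (\<integral>\<^sup>+y. (\<integral>\<^sup>+x. indicator ?S (x(0 := y)) \<partial>?M) \<partial>lborel)"
    using m S by (intro nn_integral_volM_split) auto
  also have "\<dots> = (\<integral>\<^sup>+y. ennreal (kappa (real m - 1) * R ^ (m - 1)) * (h (y / R) * ?T (y / R)) \<partial>lborel)"
  proof (intro nn_integral_cong_AE)
    have "AE y in lborel. y \<notin> {- R, R}"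
      by (intro AE_not_in countable_imp_null_set_lborel) auto
    then show "AE y in lborel. (\<integral>\<^sup>+x. indicator ?S (x(0 := y)) \<partial>?M) =
        ennreal (kappa (real m - 1) * R ^ (m - 1)) * (h (y / R) * ?T (y / R))"
    proof eventually_elim
      case (elim y)
      then have ne: "\<bar>y\<bar> \<noteq> R" using R by auto
      have "(\<bar>y\<bar> < R \<and> (0 < t \<and> t < a * y \<or> t < 0 \<and> a * y < t)) \<longleftrightarrow> sgn t * (y / R) \<in> {\<bar>t / (a * R)\<bar><..1}"
      proof (cases "t > 0")
        case True
        then have "t < a * y \<Longrightarrow> 0 < y" using a by (metis less_trans zero_less_mult_pos)
        then show ?thesis using True R a ne by (auto simp: field_simps abs_if split: if_splits)
      next
        case False
        then have t0: "t < 0" using t by simp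
        then have "a * y < t \<Longrightarrow> y < 0" using a by (smt (verit) mult_nonneg_nonneg)
        then show ?thesis using t0 R a ne by (auto simp: field_simps abs_if split: if_splits)
      qed
      then show ?case unfolding slice[OF ne] by (simp add: indicator_def)
    qed
  qed
  also have "\<dots> = ennreal (kappa (real m - 1) * R ^ (m - 1)) * (\<integral>\<^sup>+y. h (y / R) * ?T (y / R) \<partial>lborel)"
    by (rule nn_integral_cmult) measurable
  also have "(\<integral>\<^sup>+y. h (y / R) * ?T (y / R) \<partial>lborel) = ennreal R * (\<integral>\<^sup>+y. h y * ?T y \<partial>lborel)"
    using R by (subst nn_integral_real_affine[where c=R and t=0]) auto
  also have "(\<integral>\<^sup>+y. h y * ?T y \<partial>lborel) = (\<integral>\<^sup>+y. h y * indicator {\<bar>t / (a * R)\<bar><..1} y \<partial>lborel)"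
  proof (cases "t > 0")
    case False
    then have s: "sgn t = -1" using t by simp
    have hm: "h (- y) = h y" for y by (simp add: h_def)
    show ?thesis unfolding s
      by (subst nn_integral_real_affine[where c="-1" and t=0]) (auto simp: hm)
  qed simp
  also have "\<dots> = cap_profile m \<bar>t / (a * R)\<bar>" by (simp add: cap_profile_def h_def)
  also have "ennreal (kappa (real m - 1) * R ^ (m - 1)) * (ennreal R * cap_profile m \<bar>t / (a * R)\<bar>)
     = ennreal (kappa (real m - 1) * R ^ m) * cap_profile m \<bar>t / (a * R)\<bar>"
  proof -
    have "R ^ (m - 1) * R = R ^ m" using m by (metis One_nat_def Suc_pred le_simps(2) numeral_2_eq_2 power_Suc2 Suc_leD less_eq_Suc_le)
    then have "ennreal (kappa (real m - 1) * R ^ (m - 1)) * ennreal R = ennreal (kappa (real m - 1) * R ^ m)"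
      using R m kappa_pos[of "real m - 1"] by (subst ennreal_mult[symmetric]) (auto simp: mult.assoc)
    then show ?thesis by (metis mult.assoc)
  qed
  finally show ?thesis .
qed

text \<open>Only the norm a of w matters, and t = a R t' multiplies both moments by the same (a
  R)^r. The quotient is therefore uniform in w, so that w may be the projection of a unit normal
  onto the space of the section.\<close>

lemma cap_vol_moments:
  assumes r: "r > 2" and m: "m \<ge> 2" and R: "R > 0" and w: "w \<in> Rn m"
  shows "(\<integral>\<^sup>+t. ennreal (\<bar>t\<bar> powr (r - 1)) * (cap_vol m R w t)\<^sup>2 \<partial>lborel)
    \<le> ennreal (kappa (real m) * R ^ m * cap_ratio m r) * (\<integral>\<^sup>+t. ennreal (\<bar>t\<bar> powr (r - 1)) * cap_vol m R w t \<partial>lborel)"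
proof (cases "norm_n m w = 0")
  case True
  have "separates m c (axis_n m 0) t = False" for c t
    by (auto simp: separates_def inner_n_def axis_n_def)
  then have "cap_vol m R w t = 0" for t
    using cap_vol_rotation[OF m w, of R t] True by (simp add: cap_vol_def)
  then show ?thesis by simp
next
  case False
  define a where "a = norm_n m w"
  have a: "a > 0" using False by (simp add: a_def L2_set_nonneg less_le)
  define K where "K = kappa (real m - 1) * R ^ m"
  have K: "K > 0" using m R by (simp add: K_def kappa_pos)
  have int: "(\<integral>\<^sup>+t. ennreal (\<bar>t\<bar> powr (r - 1)) * (cap_vol m R w t) ^ i \<partial>lborel) =
     ennreal (K ^ i * (a * R) powr r) * (\<integral>\<^sup>+t. ennreal (\<bar>t\<bar> powr (r - 1)) * (cap_profile m \<bar>t\<bar>) ^ i \<partial>lborel)" for i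
  proof -
    have "(\<integral>\<^sup>+t. ennreal (\<bar>t\<bar> powr (r - 1)) * (cap_vol m R w t) ^ i \<partial>lborel) =
       (\<integral>\<^sup>+t. ennreal (K ^ i) * (ennreal (\<bar>t\<bar> powr (r - 1)) * (cap_profile m \<bar>t / (a * R)\<bar>) ^ i) \<partial>lborel)"
    proof (intro nn_integral_cong_AE AE_I[of _ _ "{0}"] subsetI)
      fix t
      assume "t \<in> {t \<in> space lborel. ennreal (\<bar>t\<bar> powr (r - 1)) * (cap_vol m R w t) ^ i \<noteq>
        ennreal (K ^ i) * (ennreal (\<bar>t\<bar> powr (r - 1)) * (cap_profile m \<bar>t / (a * R)\<bar>) ^ i)}"
      moreover have e: "(cap_vol m R w t) ^ i = ennreal (K ^ i) * (cap_profile m \<bar>t / (a * R)\<bar>) ^ i" if "t \<noteq> 0"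
        unfolding cap_vol_rotation[OF m w] a_def[symmetric] cap_vol_axis[OF m R a that] K_def[symmetric]
        using K by (simp only: power_mult_distrib ennreal_power less_imp_le)
      have "ennreal (\<bar>t\<bar> powr (r - 1)) * (cap_vol m R w t) ^ i =
        ennreal (K ^ i) * (ennreal (\<bar>t\<bar> powr (r - 1)) * (cap_profile m \<bar>t / (a * R)\<bar>) ^ i)" if "t \<noteq> 0"
        unfolding e[OF that] by (rule mult.left_commute)
      ultimately show "t \<in> {0}" by blast
    qed auto
    also have "\<dots> = ennreal (K ^ i) * (\<integral>\<^sup>+t. ennreal (\<bar>t\<bar> powr (r - 1)) * (cap_profile m \<bar>t / (a * R)\<bar>) ^ i \<partial>lborel)"
      by (rule nn_integral_cmult) measurable
    also have "(\<integral>\<^sup>+t. ennreal (\<bar>t\<bar> powr (r - 1)) * (cap_profile m \<bar>t / (a * R)\<bar>) ^ i \<partial>lborel) =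
       ennreal (a * R) * (\<integral>\<^sup>+t. ennreal (\<bar>a * R * t\<bar> powr (r - 1)) * (cap_profile m \<bar>t\<bar>) ^ i \<partial>lborel)"
      using a R by (subst nn_integral_real_affine[where c="a * R" and t=0]) (auto simp: abs_mult)
    also have "\<dots> = ennreal (a * R) * (\<integral>\<^sup>+t. ennreal ((a * R) powr (r - 1)) * (ennreal (\<bar>t\<bar> powr (r - 1)) * (cap_profile m \<bar>t\<bar>) ^ i) \<partial>lborel)"
      using a R by (simp add: abs_mult powr_mult ennreal_mult' mult.assoc)
    also have "\<dots> = ennreal (a * R) * (ennreal ((a * R) powr (r - 1)) * (\<integral>\<^sup>+t. ennreal (\<bar>t\<bar> powr (r - 1)) * (cap_profile m \<bar>t\<bar>) ^ i \<partial>lborel))"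
      by (intro arg_cong[where f="\<lambda>z. ennreal (a * R) * z"] nn_integral_cmult) measurable
    also have "\<dots> = ennreal ((a * R) powr r) * (\<integral>\<^sup>+t. ennreal (\<bar>t\<bar> powr (r - 1)) * (cap_profile m \<bar>t\<bar>) ^ i \<partial>lborel)"
    proof -
      have "a * R * (a * R) powr (r - 1) = (a * R) powr r" using a R by (simp add: powr_diff)
      then show ?thesis using a R by (simp add: mult.assoc[symmetric] flip: ennreal_mult)
    qed
    finally show ?thesis using K by (simp add: ennreal_mult' mult.assoc)
  qed
  have kc: "0 < kappa (real m)" "0 < cap_ratio m r" using m r by (auto intro!: kappa_pos cap_ratio_pos)
  let ?J = "\<integral>\<^sup>+t. ennreal (\<bar>t\<bar> powr (r - 1)) * (cap_profile m \<bar>t\<bar>) ^ 2 \<partial>lborel"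
  let ?I = "\<integral>\<^sup>+t. ennreal (\<bar>t\<bar> powr (r - 1)) * (cap_profile m \<bar>t\<bar>) \<partial>lborel"
  have "(\<integral>\<^sup>+t. ennreal (\<bar>t\<bar> powr (r - 1)) * (cap_vol m R w t)\<^sup>2 \<partial>lborel) = ennreal (K * (a * R) powr r * R ^ m) * (ennreal (kappa (real m - 1)) * ?J)"
    unfolding int using K R m kappa_pos[of "real m - 1"]
    by (simp add: mult.assoc[symmetric] flip: ennreal_mult) (simp add: K_def power2_eq_square mult_ac)
  also have "\<dots> \<le> ennreal (K * (a * R) powr r * R ^ m) * (ennreal (kappa (real m) * cap_ratio m r) * ?I)"
    using r m by (intro mult_left_mono cap_profile_moments) auto
  also have "\<dots> = ennreal (kappa (real m) * R ^ m * cap_ratio m r) * (ennreal (K ^ 1 * (a * R) powr r) * ?I)"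
    using K R kc by (simp add: mult.assoc[symmetric] flip: ennreal_mult) (simp add: mult_ac)
  also have "ennreal (K ^ 1 * (a * R) powr r) * ?I = (\<integral>\<^sup>+t. ennreal (\<bar>t\<bar> powr (r - 1)) * cap_vol m R w t \<partial>lborel)"
    using int[of 1] by simp
  finally show ?thesis .
qed

section \<open>Estimates for Gamma and Beta values\<close>

lemma ln_Gamma_slope:
  fixes a b c :: real
  assumes "0 < a" "a < b" "b < c"
  shows "(ln (Gamma b) - ln (Gamma a)) / (b - a) \<le> (ln (Gamma c) - ln (Gamma b)) / (c - b)"
proof -
  note * = convex_on_slope_le[OF log_convex_Gamma_real, of a c b]
  have "(ln (Gamma a) - ln (Gamma b)) / (a - b) \<le> (ln (Gamma b) - ln (Gamma c)) / (b - c)"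
    using *[THEN order_trans] * assms by force
  moreover have "(u - v) / (z - w) = (v - u) / (w - z)" for u v w z :: real
    by (metis minus_diff_eq minus_divide_divide)
  ultimately show ?thesis by metis
qed

lemma Gamma_real_plus1: "z > 0 \<Longrightarrow> Gamma (z + 1) = z * Gamma (z :: real)"
  by (rule Gamma_plus1) (auto elim!: nonpos_Ints_cases)

text \<open>The slope of ln Gamma on [a, a + d] is at most its slope on the following unit interval,
  which is ln (a + d).\<close>

lemma Gamma_add_le:
  fixes a d :: real
  assumes a: "a > 0" and d: "d \<ge> 0"
  shows "Gamma (a + d) \<le> Gamma a * (a + d) powr d"
proof (cases "d = 0")
  case False
  then have d: "d > 0" using d by simp
  have G: "Gamma (a + d + 1) = (a + d) * Gamma (a + d)" using a d by (intro Gamma_real_plus1) auto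
  have pos: "Gamma a > 0" "Gamma (a + d) > 0" using a d by (auto intro!: Gamma_real_pos)
  have "(ln (Gamma (a + d)) - ln (Gamma a)) / d \<le> ln (a + d)"
    using ln_Gamma_slope[of a "a + d" "a + d + 1"] a d pos by (simp add: G ln_mult)
  then have "ln (Gamma (a + d)) \<le> ln (Gamma a) + d * ln (a + d)" using d by (simp add: field_simps)
  then have "exp (ln (Gamma (a + d))) \<le> exp (ln (Gamma a) + d * ln (a + d))" by simp
  then show ?thesis using pos a d by (simp add: exp_add powr_def)
qed (use a in simp)

text \<open>Dually, the slope of ln Gamma on [a, a + d] is at least that on the preceding unit
  interval, which is ln (a - 1).\<close>

lemma Gamma_add_ge:
  fixes a d :: real
  assumes a: "a > 1" and d: "d \<ge> 0"
  shows "Gamma a * (a - 1) powr d \<le> Gamma (a + d)"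
proof (cases "d = 0")
  case False
  then have d: "d > 0" using d by simp
  have G: "Gamma a = (a - 1) * Gamma (a - 1)"
    using Gamma_real_plus1[of "a - 1"] a by simp
  have pos: "Gamma (a - 1) > 0" "Gamma a > 0" "Gamma (a + d) > 0" using a d by (auto intro!: Gamma_real_pos)
  have "ln (Gamma a) - ln (Gamma (a - 1)) = ln (a - 1)"
  proof -
    have "ln ((a - 1) * Gamma (a - 1)) = ln (a - 1) + ln (Gamma (a - 1))"
      by (rule ln_mult_pos) (use a pos(1) in linarith)+
    then show ?thesis unfolding G by simp
  qed
  then have "ln (a - 1) \<le> (ln (Gamma (a + d)) - ln (Gamma a)) / d"
    using ln_Gamma_slope[of "a - 1" a "a + d"] a d by simp
  then have "ln (Gamma a) + d * ln (a - 1) \<le> ln (Gamma (a + d))" using d by (simp add: field_simps)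
  then have "exp (ln (Gamma a) + d * ln (a - 1)) \<le> exp (ln (Gamma (a + d)))" by simp
  then show ?thesis using pos a d by (simp add: exp_add powr_def)
qed (use a in simp)

lemma Gamma_legendre_duplication_real:
  fixes z :: real
  assumes z: "z > 0"
  shows "Gamma z * Gamma (z + 1 / 2) = 2 powr (1 - 2 * z) * sqrt pi * Gamma (2 * z)"
proof -
  have nz: "complex_of_real z \<notin> \<int>\<^sub>\<le>\<^sub>0" "complex_of_real z + 1 / 2 \<notin> \<int>\<^sub>\<le>\<^sub>0"
    using z by (auto elim!: nonpos_Ints_cases simp: complex_eq_iff)
  have e: "exp ((1 - 2 * complex_of_real z) * complex_of_real (ln 2)) = complex_of_real (2 powr (1 - 2 * z))"
    by (simp add: powr_def exp_of_real[symmetric] mult.commute)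
  have "complex_of_real (Gamma z * Gamma (z + 1 / 2)) = Gamma (complex_of_real z) * Gamma (complex_of_real z + 1 / 2)"
    by (simp add: Gamma_complex_of_real[symmetric])
  also have "\<dots> = complex_of_real (2 powr (1 - 2 * z) * sqrt pi * Gamma (2 * z))"
    unfolding Gamma_legendre_duplication[OF nz] e by (simp add: Gamma_complex_of_real[symmetric])
  finally show ?thesis by (simp only: of_real_eq_iff)
qed

text \<open>This is (x + 2 y + 1) 4^y Beta (y + 1) (x + y + 1). At x = r / 2 and y = m / 2 it
  collects the part of the cap moments that varies exponentially; the factor 4^y reduces it to the
  order of sqrt y at x = 0.\<close>

definition gamma_T :: "real \<Rightarrow> real \<Rightarrow> real" where
  "gamma_T x y = 4 powr y * Gamma (y + 1) * Gamma (x + y + 1) / Gamma (x + 2 * y + 1)"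

lemma gamma_T_pos: "x \<ge> 0 \<Longrightarrow> y \<ge> 0 \<Longrightarrow> gamma_T x y > 0"
  unfolding gamma_T_def by (intro divide_pos_pos mult_pos_pos Gamma_real_pos) auto

text \<open>For x small against y. The duplication formula settles x = 0; shifting the arguments by
  x then costs (x + y + 1)^x in the numerator and gains (2 y)^x in the denominator, together roughly
  2^(-x).\<close>

lemma gamma_T_le_power:
  assumes x: "x \<ge> 0" and y: "y > 0"
  shows "gamma_T x y \<le> sqrt pi * sqrt (y + 1) * ((x + y + 1) / (2 * y)) powr x"
proof -
  have pos: "Gamma (y + 1) > 0" "Gamma (y + 1 / 2) > 0" "Gamma (2 * y + 1) > 0" "Gamma (x + 2 * y + 1) > 0" "Gamma (x + y + 1) > 0"
    using x y by (auto intro!: Gamma_real_pos)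
  have "Gamma (y + 1 / 2) * Gamma (y + 1) = 2 powr (- (2 * y)) * sqrt pi * Gamma (2 * y + 1)"
    using Gamma_legendre_duplication_real[of "y + 1 / 2"] y by (simp add: algebra_simps)
  moreover have "(4::real) powr y * 2 powr (- (2 * y)) = 1"
  proof -
    have "(4::real) powr y = 2 powr (2 * y)" using powr_powr[of 2 2 y] by simp
    then show ?thesis by (simp flip: powr_add)
  qed
  ultimately have d: "4 powr y * (Gamma (y + 1 / 2) * Gamma (y + 1)) = sqrt pi * Gamma (2 * y + 1)"
    by (metis (no_types, lifting) mult.assoc mult_1)
  have g1: "Gamma (y + 1) \<le> Gamma (y + 1 / 2) * sqrt (y + 1)"
    using Gamma_add_le[of "y + 1 / 2" "1 / 2"] y by (simp add: powr_half_sqrt add.assoc)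
  have g2: "Gamma (x + y + 1) \<le> Gamma (y + 1) * (x + y + 1) powr x"
    using Gamma_add_le[of "y + 1" x] x y by (simp add: algebra_simps)
  have g3: "Gamma (2 * y + 1) * (2 * y) powr x \<le> Gamma (x + 2 * y + 1)"
    using Gamma_add_ge[of "2 * y + 1" x] x y by (simp add: algebra_simps)
  have p2: "0 < (2 * y) powr x" using y by simp
  have "4 powr y * Gamma (y + 1) * Gamma (x + y + 1) \<le> 4 powr y * (Gamma (y + 1 / 2) * sqrt (y + 1)) * (Gamma (y + 1) * (x + y + 1) powr x)"
    using g1 g2 pos by (intro mult_mono) (auto intro!: mult_nonneg_nonneg less_imp_le)
  also have "\<dots> = (4 powr y * (Gamma (y + 1 / 2) * Gamma (y + 1))) * (sqrt (y + 1) * (x + y + 1) powr x)"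
    by (simp only: mult_ac)
  also have "\<dots> = (sqrt pi * sqrt (y + 1) * ((x + y + 1) powr x / (2 * y) powr x)) * (Gamma (2 * y + 1) * (2 * y) powr x)"
    unfolding d using p2 by (simp add: field_simps)
  also have "\<dots> \<le> (sqrt pi * sqrt (y + 1) * ((x + y + 1) powr x / (2 * y) powr x)) * Gamma (x + 2 * y + 1)"
    using g3 y by (intro mult_left_mono) auto
  also have "(x + y + 1) powr x / (2 * y) powr x = ((x + y + 1) / (2 * y)) powr x"
    using x y by (simp add: powr_divide)
  finally show ?thesis unfolding gamma_T_def using pos by (simp add: divide_le_eq)
qed

text \<open>For x large against y: the denominator exceeds Gamma (x + y + 1) by at least a factor
  x^y, and Gamma (y + 1) is estimated crudely by (y + 1)^y.\<close>

lemma gamma_T_le_large: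
  assumes x: "x > 0" and y: "y \<ge> 0"
  shows "gamma_T x y \<le> (4 * (y + 1) / x) powr y"
proof -
  have pos: "Gamma (y + 1) > 0" "Gamma (x + 2 * y + 1) > 0" "Gamma (x + y + 1) > 0"
    using x y by (auto intro!: Gamma_real_pos)
  have g1: "Gamma (y + 1) \<le> (y + 1) powr y"
    using Gamma_add_le[of 1 y] y by (simp add: add.commute)
  have "Gamma (x + y + 1) * (x + y) powr y \<le> Gamma (x + 2 * y + 1)"
    using Gamma_add_ge[of "x + y + 1" y] x y by (simp add: algebra_simps)
  moreover have "Gamma (x + y + 1) * x powr y \<le> Gamma (x + y + 1) * (x + y) powr y"
    using pos x y by (intro mult_left_mono powr_mono2) auto
  ultimately have g2: "Gamma (x + y + 1) * x powr y \<le> Gamma (x + 2 * y + 1)" by linarith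
  have "4 powr y * Gamma (y + 1) * Gamma (x + y + 1) \<le> 4 powr y * (y + 1) powr y * Gamma (x + y + 1)"
    using g1 pos by (intro mult_right_mono mult_left_mono) auto
  also have "\<dots> = (4 * (y + 1) / x) powr y * (Gamma (x + y + 1) * x powr y)"
  proof -
    have "(4 * (y + 1) / x) powr y = 4 powr y * (y + 1) powr y / x powr y"
      using x y by (simp only: powr_divide powr_mult)
    then show ?thesis using x by simp
  qed
  also have "\<dots> \<le> (4 * (y + 1) / x) powr y * Gamma (x + 2 * y + 1)"
    using g2 by (intro mult_left_mono) auto
  finally show ?thesis unfolding gamma_T_def using pos by (simp add: divide_le_eq)
qed

text \<open>Passes from n / 2 to (n - 1) / 2 at the cost of a factor that stays bounded as long as x
  / y does. For alpha = 1 the rate is written in n, while the section has dimension n - 1.\<close>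

lemma gamma_T_half_step:
  assumes x: "x \<ge> 0" and y: "y \<ge> 1"
  shows "gamma_T x (y - 1 / 2) \<le> (x + 2 * y) / (2 * y - 1) * gamma_T x y"
proof -
  have pos: "Gamma (y + 1 / 2) > 0" "Gamma (y + 1) > 0" "Gamma (x + y + 1 / 2) > 0" "Gamma (x + y + 1) > 0" "Gamma (x + 2 * y) > 0" "Gamma (x + 2 * y + 1) > 0"
    using x y by (auto intro!: Gamma_real_pos)
  have g1: "Gamma (y + 1 / 2) * (y - 1 / 2) powr (1 / 2) \<le> Gamma (y + 1)"
    using Gamma_add_ge[of "y + 1 / 2" "1 / 2"] y by (simp add: add.assoc)
  have "Gamma (x + y + 1 / 2) * (x + y - 1 / 2) powr (1 / 2) \<le> Gamma (x + y + 1)"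
    using Gamma_add_ge[of "x + y + 1 / 2" "1 / 2"] x y by (simp add: add.assoc)
  moreover have "Gamma (x + y + 1 / 2) * (y - 1 / 2) powr (1 / 2) \<le> Gamma (x + y + 1 / 2) * (x + y - 1 / 2) powr (1 / 2)"
    using pos x y by (intro mult_left_mono powr_mono2) auto
  ultimately have g2: "Gamma (x + y + 1 / 2) * (y - 1 / 2) powr (1 / 2) \<le> Gamma (x + y + 1)" by linarith
  have "(Gamma (y + 1 / 2) * (y - 1 / 2) powr (1 / 2)) * (Gamma (x + y + 1 / 2) * (y - 1 / 2) powr (1 / 2)) \<le> Gamma (y + 1) * Gamma (x + y + 1)"
    using g1 g2 pos by (intro mult_mono) auto
  moreover have "(y - 1 / 2) powr (1 / 2) * (y - 1 / 2) powr (1 / 2) = y - 1 / 2"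
    using y by (simp flip: powr_add)
  ultimately have main: "Gamma (y + 1 / 2) * Gamma (x + y + 1 / 2) * (y - 1 / 2) \<le> Gamma (y + 1) * Gamma (x + y + 1)"
    by (metis (no_types, lifting) mult.assoc mult.left_commute)
  have G: "Gamma (x + 2 * y + 1) = (x + 2 * y) * Gamma (x + 2 * y)" using x y
    by (intro Gamma_real_plus1) auto
  have h: "4 powr (y - 1 / 2) = 4 powr y / (2::real)"
    by (simp add: powr_diff powr_half_sqrt)
  have "gamma_T x (y - 1 / 2) = 4 powr y / 2 * (Gamma (y + 1 / 2) * Gamma (x + y + 1 / 2)) / Gamma (x + 2 * y)"
    by (simp add: gamma_T_def h algebra_simps)
  also have "\<dots> \<le> 4 powr y / 2 * (Gamma (y + 1) * Gamma (x + y + 1) / (y - 1 / 2)) / Gamma (x + 2 * y)"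
    using main y pos by (intro divide_right_mono mult_left_mono) (auto simp: pos_le_divide_eq)
  also have "\<dots> = (x + 2 * y) / (2 * y - 1) * gamma_T x y"
  proof -
    have "A / 2 * (B * C / (w / 2)) / D = s / w * (A * B * C / (s * D))" if "s \<noteq> 0" for A B C D s w :: real
      using that by simp
    moreover have "y - 1 / 2 = (2 * y - 1) / 2" by (simp add: field_simps)
    ultimately show ?thesis unfolding gamma_T_def G using x y by simp
  qed
  finally show ?thesis .
qed

text \<open>The integrand \<open>t\<^sup>y (1 - t)\<^sup>x\<^sup>+\<^sup>y\<close> of the Beta function is dominated by a Gaussian centred at its
  maximum, which loses only a constant factor; this replaces Stirling's formula.\<close>

lemma beta_integrand_le:
  fixes p q t :: real
  assumes p: "p > 0" and q: "q > 0" and t: "0 < t" "t < 1"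
  shows "p * ln t + q * ln (1 - t) + (p + q) / 2 * (t - p / (p + q))\<^sup>2
    \<le> p * ln (p / (p + q)) + q * ln (q / (p + q))"
proof -
  define s where "s = p + q"
  define t0 where "t0 = p / s"
  have s: "s > 0" using p q by (simp add: s_def add_pos_pos)
  have t0: "0 < t0" "t0 < 1" "1 - t0 = q / s" using p q by (auto simp: t0_def s_def field_simps)
  define \<phi> where "\<phi> t = p * ln t + q * ln (1 - t) + s / 2 * (t - t0)\<^sup>2" for t
  define \<phi>' where "\<phi>' t = s * (t0 - t) * (1 / (t * (1 - t)) - 1)" for t
  have deriv: "(\<phi> has_real_derivative \<phi>' t) (at t)" if "0 < t" "t < 1" for t
  proof -
    have "(\<phi> has_real_derivative (p / t - q / (1 - t) + s * (t - t0))) (at t)"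
      unfolding \<phi>_def using that by (auto intro!: derivative_eq_intros simp: field_simps)
    also have "p / t - q / (1 - t) + s * (t - t0) = \<phi>' t"
    proof -
      have "p = s * t0" "q = s * (1 - t0)" using s t0 by (simp_all add: t0_def)
      then have "p / t - q / (1 - t) = s * (t0 / t - (1 - t0) / (1 - t))"
        by (simp add: right_diff_distrib)
      also have "t0 / t - (1 - t0) / (1 - t) = (t0 - t) / (t * (1 - t))"
        using that by (simp add: field_simps)
      finally show ?thesis by (simp add: \<phi>'_def algebra_simps)
    qed
    finally show ?thesis .
  qed
  have ge: "1 / (t * (1 - t)) - 1 \<ge> 0" if "0 < t" "t < 1" for t :: real
  proof -
    have "t * (1 - t) \<le> 1 * 1" using that by (intro mult_mono) auto
    then show ?thesis using that by (simp add: field_simps)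
  qed
  have "\<phi> t \<le> \<phi> t0"
  proof (cases "t \<le> t0")
    case True
    then show ?thesis
    proof (rule DERIV_nonneg_imp_nondecreasing)
      fix z assume z: "t \<le> z" "z \<le> t0"
      then have "0 < z" "z < 1" using t t0 by auto
      then show "\<exists>y. (\<phi> has_real_derivative y) (at z) \<and> 0 \<le> y"
        using deriv[of z] ge[of z] z s by (intro exI[of _ "\<phi>' z"]) (auto simp: \<phi>'_def)
    qed
  next
    case False
    then have "t0 \<le> t" by simp
    then show ?thesis
    proof (rule DERIV_nonpos_imp_nonincreasing)
      fix z assume z: "t0 \<le> z" "z \<le> t"
      then have "0 < z" "z < 1" using t t0 by auto
      then show "\<exists>y. (\<phi> has_real_derivative y) (at z) \<and> y \<le> 0"
      proof (intro exI conjI)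
        have "s * (t0 - z) \<le> 0" using s z by (intro mult_nonneg_nonpos) auto
        then show "\<phi>' z \<le> 0" unfolding \<phi>'_def by (rule mult_nonpos_nonneg) (rule ge[OF \<open>0 < z\<close> \<open>z < 1\<close>])
      qed (rule deriv[OF \<open>0 < z\<close> \<open>z < 1\<close>])
    qed
  qed
  then show ?thesis using t0 by (simp add: \<phi>_def t0_def[symmetric] s_def[symmetric])
qed

text \<open>The dominating Gaussian has mean p / (p + q) and variance 1 / (p + q), so its integral
  over the line is the first factor on the right.\<close>

lemma Beta_le:
  fixes p q :: real
  assumes p: "p > 0" and q: "q > 0"
  shows "Beta (p + 1) (q + 1) \<le> sqrt (2 * pi / (p + q)) * (p powr p * q powr q / (p + q) powr (p + q))"
proof -
  define s where "s = p + q"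
  have s: "s > 0" using p q by (simp add: s_def add_pos_pos)
  define M where "M = p powr p * q powr q / s powr s"
  have M: "M > 0" using p q s by (simp add: M_def)
  have bound: "t powr p * (1 - t) powr q \<le> M * (sqrt (2 * pi / s) * normal_density (p / s) (1 / sqrt s) t)" if "0 < t" "t < 1" for t
  proof -
    have "t powr p * (1 - t) powr q = exp (p * ln t + q * ln (1 - t))"
      using that by (simp add: powr_def exp_add)
    also have "\<dots> \<le> exp (p * ln (p / s) + q * ln (q / s) - s / 2 * (t - p / s)\<^sup>2)"
      using beta_integrand_le[OF p q that] by (simp add: s_def)
    also have "\<dots> = exp (p * ln (p / s) + q * ln (q / s)) * exp (- (s / 2 * (t - p / s)\<^sup>2))"
      by (simp flip: exp_add)
    also have "exp (p * ln (p / s) + q * ln (q / s)) = M"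
    proof -
      have "exp (p * ln (p / s) + q * ln (q / s)) = (p / s) powr p * (q / s) powr q"
        using p q s by (simp add: powr_def exp_add)
      then show ?thesis using p q s by (simp add: M_def powr_divide s_def powr_add)
    qed
    also have "exp (- (s / 2 * (t - p / s)\<^sup>2)) = sqrt (2 * pi / s) * normal_density (p / s) (1 / sqrt s) t"
      using s by (simp add: normal_density_def power_divide real_sqrt_divide real_sqrt_mult)
    finally show ?thesis .
  qed
  have "ennreal (Beta (p + 1) (q + 1)) = (\<integral>\<^sup>+t. ennreal (indicator {0..1} t * (t powr p * (1 - t) powr q)) \<partial>lborel)"
    using nn_integral_has_integral_lebesgue[OF _ has_integral_Beta_real[of "p + 1" "q + 1"]] p q by simp
  also have "\<dots> \<le> (\<integral>\<^sup>+t. ennreal (M * sqrt (2 * pi / s)) * ennreal (normal_density (p / s) (1 / sqrt s) t) \<partial>lborel)"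
  proof (rule nn_integral_mono_AE)
    have "AE t in lborel. t \<notin> {0, 1 :: real}"
      by (intro AE_not_in countable_imp_null_set_lborel) auto
    then show "AE t in lborel. ennreal (indicator {0..1} t * (t powr p * (1 - t) powr q)) \<le>
       ennreal (M * sqrt (2 * pi / s)) * ennreal (normal_density (p / s) (1 / sqrt s) t)"
    proof eventually_elim
      case (elim t)
      show ?case
      proof (cases "t \<in> {0..1}")
        case True
        then have "0 < t" "t < 1" using elim by auto
        from bound[OF this] show ?thesis using M s True
          by (simp add: ennreal_mult'[symmetric] mult.assoc ennreal_leI)
      qed simp
    qed
  qed
  also have "\<dots> = ennreal (M * sqrt (2 * pi / s)) * (\<integral>\<^sup>+t. ennreal (normal_density (p / s) (1 / sqrt s) t) \<partial>lborel)"
    by (rule nn_integral_cmult) measurable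
  also have "(\<integral>\<^sup>+t. ennreal (normal_density (p / s) (1 / sqrt s) t) \<partial>lborel) = 1"
    using prob_space.emeasure_space_1[OF prob_space_normal_density[of "1 / sqrt s" "p / s"]] s
    by (simp add: emeasure_density)
  finally have "Beta (p + 1) (q + 1) \<le> M * sqrt (2 * pi / s)"
    using M s by (simp add: ennreal_le_iff)
  then show ?thesis by (simp add: M_def s_def mult.commute)
qed

text \<open>For x of the same order as y, where the exponential base must be exact.\<close>

lemma gamma_T_le_stirling:
  assumes x: "x \<ge> 0" and y: "y > 0"
  shows "gamma_T x y \<le> (x + 2 * y + 1) * sqrt (2 * pi / (x + 2 * y)) *
     (4 powr y * (y powr y * (x + y) powr (x + y) / (x + 2 * y) powr (x + 2 * y)))"
proof -
  have G: "Gamma (x + 2 * y + 2) = (x + 2 * y + 1) * Gamma (x + 2 * y + 1)"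
    using Gamma_real_plus1[of "x + 2 * y + 1"] x y by (simp add: add.assoc)
  have pos: "Gamma (x + 2 * y + 1) > 0" using x y by (intro Gamma_real_pos) auto
  have "gamma_T x y = (x + 2 * y + 1) * 4 powr y * Beta (y + 1) (x + y + 1)"
  proof -
    have "y + 1 + (x + y + 1) = x + 2 * y + 2" by simp
    then have B: "Beta (y + 1) (x + y + 1) = Gamma (y + 1) * Gamma (x + y + 1) / ((x + 2 * y + 1) * Gamma (x + 2 * y + 1))"
      unfolding Beta_def by (simp only: G)
    show ?thesis unfolding B gamma_T_def using x y by simp
  qed
  also have "\<dots> \<le> (x + 2 * y + 1) * 4 powr y * (sqrt (2 * pi / (y + (x + y))) * (y powr y * (x + y) powr (x + y) / (y + (x + y)) powr (y + (x + y))))"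
    using x y by (intro mult_left_mono Beta_le) auto
  also have "y + (x + y) = x + 2 * y" by simp
  finally show ?thesis by (simp add: mult_ac)
qed

text \<open>Bounds the variance of a section volume divided by its squared mean.
  \<open>cap_ratio\<close> is the contribution of a ball of fixed radius, the Gamma quotient that of
  the mixture over radii.\<close>

definition rel_var :: "nat \<Rightarrow> real \<Rightarrow> real" where
  "rel_var m r = cap_ratio m r * Gamma (2 * real m / r + 2) / (Gamma (real m / r + 1))\<^sup>2"

text \<open>Splits off the algebraic factors. The powers of 4 come from two uses of the duplication
  formula, at m / r + 1 (visible as 4^(m/r)) and at m / 2 + 1 (hidden in
  \<open>gamma_T\<close>).\<close>

lemma rel_var_le:
  assumes m: "m \<ge> 1" and r: "r \<ge> 8"
  shows "rel_var m r \<le> 6 * 4 powr (real m / r) * sqrt (real m / r + 2) / sqrt (real m * r) * gamma_T (r / 2) (real m / 2)"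
proof -
  define y where "y = real m / 2"
  define x where "x = r / 2"
  define p where "p = real m / r"
  have y: "y \<ge> 1 / 2" and x: "x \<ge> 4" and p: "p > 0" using m r by (auto simp: y_def x_def p_def)
  have pos: "Gamma (y + 1 / 2) > 0" "Gamma (y + 1) > 0" "Gamma (x - 1) > 0" "Gamma (x + 1 / 2) > 0" "Gamma (2 * y + 2) > 0"
    "Gamma (x + y + 1) > 0" "Gamma (x + 2 * y + 1) > 0" "Gamma (p + 1) > 0" "Gamma (p + 3 / 2) > 0" "Gamma (2 * p + 2) > 0"
    using y x p by (auto intro!: Gamma_real_pos)
  have kap: "kappa (real m - 1) / kappa (real m) \<le> sqrt (y + 1) / sqrt pi"
  proof -
    have "kappa (real m - 1) / kappa (real m) = Gamma (y + 1) / Gamma (y + 1 / 2) / sqrt pi"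
    proof -
      have e: "(real m - 1) / 2 = y - 1 / 2" "y - 1 / 2 + 1 = y + 1 / 2" by (simp_all add: y_def field_simps)
      show ?thesis unfolding kappa_def e y_def[symmetric] by (simp add: powr_diff powr_half_sqrt)
    qed
    also have "\<dots> \<le> sqrt (y + 1) / sqrt pi"
      using Gamma_add_le[of "y + 1 / 2" "1 / 2"] y pos
      by (intro divide_right_mono) (auto simp: powr_half_sqrt add.assoc divide_le_eq mult.commute)
    finally show ?thesis .
  qed
  \<comment> \<open>The hypothesis r >= 8 says exactly that x - 2 = r / 2 - 2 is at least r /
    4.\<close>
  have g1: "Gamma (x - 1) \<le> 8 / (r * sqrt r) * Gamma (x + 1 / 2)"
  proof -
    have "Gamma (x - 1) * (r / 4) powr (3 / 2) \<le> Gamma (x - 1) * (x - 2) powr (3 / 2)"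
      using pos r by (intro mult_left_mono powr_mono2) (auto simp: x_def)
    also have "\<dots> \<le> Gamma (x + 1 / 2)"
      using Gamma_add_ge[of "x - 1" "3 / 2"] x by (simp add: add.commute)
    also have "(r / 4) powr (3 / 2) = r * sqrt r / 8"
    proof -
      have "(r / 4) powr (3 / 2) = (r / 4) powr (1 + 1 / 2)" by simp
      also have "\<dots> = r / 4 * sqrt (r / 4)" using r by (subst powr_add) (simp add: powr_half_sqrt)
      finally show ?thesis by (simp add: real_sqrt_divide)
    qed
    finally show ?thesis using r by (simp add: field_simps)
  qed
  have d1: "sqrt pi * Gamma (2 * y + 2) = 2 * 4 powr y * (y + 1 / 2) * (Gamma (y + 1) * Gamma (y + 1 / 2))"
  proof -
    have L: "Gamma (y + 1) * Gamma (y + 3 / 2) = 2 powr (- 1 - 2 * y) * sqrt pi * Gamma (2 * y + 2)"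
      using Gamma_legendre_duplication_real[of "y + 1"] y by (simp add: algebra_simps)
    have S: "Gamma (y + 3 / 2) = (y + 1 / 2) * Gamma (y + 1 / 2)"
      using Gamma_real_plus1[of "y + 1 / 2"] y by (simp add: add.assoc)
    have one: "2 * 4 powr y * 2 powr (- 1 - 2 * y) = (1::real)"
    proof -
      have "(4::real) powr y = 2 powr (2 * y)" using powr_powr[of 2 2 y] by simp
      moreover have "(2::real) * 2 powr (2 * y) = 2 powr (1 + 2 * y)" by (simp add: powr_add)
      ultimately show ?thesis by (simp flip: powr_add)
    qed
    have "2 * 4 powr y * (y + 1 / 2) * (Gamma (y + 1) * Gamma (y + 1 / 2)) = 2 * 4 powr y * (Gamma (y + 1) * Gamma (y + 3 / 2))"
      unfolding S by (simp only: mult_ac)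
    also have "\<dots> = 2 * 4 powr y * 2 powr (- 1 - 2 * y) * (sqrt pi * Gamma (2 * y + 2))"
      unfolding L by (simp only: mult_ac)
    finally show ?thesis unfolding one by simp
  qed
  have d2: "Gamma (2 * p + 2) / (Gamma (p + 1))\<^sup>2 \<le> 2 * 4 powr p * sqrt (p + 2) / sqrt pi"
  proof -
    have L: "Gamma (p + 1) * Gamma (p + 3 / 2) = 2 powr (- 1 - 2 * p) * sqrt pi * Gamma (2 * p + 2)"
      using Gamma_legendre_duplication_real[of "p + 1"] p by (simp add: algebra_simps)
    have one: "2 * 4 powr p * 2 powr (- 1 - 2 * p) = (1::real)"
    proof -
      have "(4::real) powr p = 2 powr (2 * p)" using powr_powr[of 2 2 p] by simp
      moreover have "(2::real) * 2 powr (2 * p) = 2 powr (1 + 2 * p)" by (simp add: powr_add)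
      ultimately show ?thesis by (simp flip: powr_add)
    qed
    have "2 * 4 powr p * (Gamma (p + 1) * Gamma (p + 3 / 2)) = 2 * 4 powr p * 2 powr (- 1 - 2 * p) * (sqrt pi * Gamma (2 * p + 2))"
      unfolding L by (simp only: mult_ac)
    then have e: "sqrt pi * Gamma (2 * p + 2) = 2 * 4 powr p * (Gamma (p + 1) * Gamma (p + 3 / 2))"
      unfolding one by simp
    have "Gamma (p + 3 / 2) \<le> Gamma (p + 1) * (p + 3 / 2) powr (1 / 2)"
      using Gamma_add_le[of "p + 1" "1 / 2"] p by (simp add: add.assoc)
    also have "\<dots> \<le> Gamma (p + 1) * sqrt (p + 2)"
      using pos p by (intro mult_left_mono) (auto simp: powr_half_sqrt)
    finally have "2 * 4 powr p * (Gamma (p + 1) * Gamma (p + 3 / 2)) \<le> 2 * 4 powr p * (Gamma (p + 1) * (Gamma (p + 1) * sqrt (p + 2)))"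
      using pos by (intro mult_left_mono) auto
    then show ?thesis unfolding e[symmetric] using pos by (simp add: field_simps power2_eq_square)
  qed
  have beta: "Beta (r / 2 - 1) (real m + 2) / Beta ((r + 1) / 2) ((real m + 1) / 2) =
     (Gamma (x - 1) / Gamma (x + 1 / 2)) * (Gamma (2 * y + 2) / Gamma (y + 1 / 2)) * (Gamma (x + y + 1) / Gamma (x + 2 * y + 1))"
  proof -
    have a: "r / 2 - 1 = x - 1" "(r + 1) / 2 = x + 1 / 2" "real m + 2 = 2 * y + 2" "(real m + 1) / 2 = y + 1 / 2"
      by (simp_all add: x_def y_def field_simps)
    have b: "x - 1 + (2 * y + 2) = x + 2 * y + 1" "x + 1 / 2 + (y + 1 / 2) = x + y + 1" by simp_all
    show ?thesis unfolding a Beta_def b by simp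
  qed
  have e3: "Gamma (2 * y + 2) / Gamma (y + 1 / 2) = (real m + 1) * 4 powr y * Gamma (y + 1) / sqrt pi"
  proof -
    have "G / B = 2 * h * F * A / S" if "S * G = 2 * F * h * (A * B)" "B \<noteq> 0" "S \<noteq> 0" for A B F G S h :: real
      using that by (simp add: field_simps)
    from this[OF d1] pos have "Gamma (2 * y + 2) / Gamma (y + 1 / 2) = 2 * (y + 1 / 2) * 4 powr y * Gamma (y + 1) / sqrt pi"
      by (smt (verit) pi_gt_zero real_sqrt_gt_zero)
    moreover have "2 * (y + 1 / 2) = real m + 1" by (simp add: y_def)
    ultimately show ?thesis by metis
  qed
  have "cap_ratio m r = kappa (real m - 1) / kappa (real m) * (r / (real m + 1)\<^sup>2) *
     ((Gamma (x - 1) / Gamma (x + 1 / 2)) * (Gamma (2 * y + 2) / Gamma (y + 1 / 2)) * (Gamma (x + y + 1) / Gamma (x + 2 * y + 1)))"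
    unfolding cap_ratio_def beta[symmetric] by simp
  also have "\<dots> = kappa (real m - 1) / kappa (real m) * (r / (real m + 1) / sqrt pi) *
     (Gamma (x - 1) / Gamma (x + 1 / 2)) * gamma_T x y"
    unfolding e3 gamma_T_def using m by (simp add: power2_eq_square mult_ac)
  also have "\<dots> \<le> sqrt (y + 1) / sqrt pi * (r / (real m + 1) / sqrt pi) * (8 / (r * sqrt r)) * gamma_T x y"
    using kap g1 pos r x y gamma_T_pos[of x y]
    by (intro mult_mono mult_nonneg_nonneg) (auto simp: divide_le_eq intro!: less_imp_le divide_pos_pos kappa_pos)
  also have "\<dots> = 8 / pi * (sqrt (y + 1) / (real m + 1)) / sqrt r * gamma_T x y"
    using r by (simp add: field_simps)
  finally have c: "cap_ratio m r \<le> 8 / pi * (sqrt (y + 1) / (real m + 1)) / sqrt r * gamma_T x y" .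
  have sq: "sqrt (y + 1) / (real m + 1) \<le> 1 / sqrt (real m)"
  proof -
    have "sqrt (y + 1) * sqrt (real m) \<le> sqrt (real m + 1) * sqrt (real m + 1)"
      using m by (intro mult_mono) (auto simp: y_def)
    also have "\<dots> = real m + 1" by simp
    finally show ?thesis using m by (simp add: field_simps)
  qed
  have "rel_var m r = cap_ratio m r * (Gamma (2 * p + 2) / (Gamma (p + 1))\<^sup>2)"
    by (simp add: rel_var_def p_def)
  also have "\<dots> \<le> (8 / pi * (1 / sqrt (real m)) / sqrt r * gamma_T x y) * (2 * 4 powr p * sqrt (p + 2) / sqrt pi)"
  proof (intro mult_mono d2)
    have "8 / pi * (sqrt (y + 1) / (real m + 1)) / sqrt r * gamma_T x y \<le> 8 / pi * (1 / sqrt (real m)) / sqrt r * gamma_T x y"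
      using sq gamma_T_pos[of x y] x y r by (intro mult_right_mono divide_right_mono mult_left_mono) auto
    with c show "cap_ratio m r \<le> 8 / pi * (1 / sqrt (real m)) / sqrt r * gamma_T x y" by linarith
    show "0 \<le> 8 / pi * (1 / sqrt (real m)) / sqrt r * gamma_T x y"
      using gamma_T_pos[of x y] x y r by simp
  qed (use pos in auto)
  also have "\<dots> = (16 / (pi * sqrt pi)) * (4 powr p * sqrt (p + 2) / sqrt (real m * r) * gamma_T x y)"
    by (simp add: real_sqrt_mult field_simps)
  also have "\<dots> \<le> 6 * (4 powr p * sqrt (p + 2) / sqrt (real m * r) * gamma_T x y)"
  proof (rule mult_right_mono)
    have "3 * 1 \<le> pi * sqrt pi" using pi_gt3 by (intro mult_mono) auto
    then have "16 / (pi * sqrt pi) \<le> 16 / 3" by (intro divide_left_mono) auto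
    then show "16 / (pi * sqrt pi) \<le> 6" by linarith
  qed (use gamma_T_pos[of x y] x y p r in \<open>auto intro!: mult_nonneg_nonneg divide_nonneg_nonneg\<close>)
  finally show ?thesis by (simp add: x_def y_def p_def mult_ac)
qed

section \<open>Asymptotics of the relative variance and the mean\<close>

text \<open>Here r = o(n), so the base in \<open>gamma_T_le_power\<close> tends to 1/2. Settling for
  the base 2^(-3/4), with exponent r / 2, yields 2^(-3r/8). Compared with the target 2^(-r/4) this
  leaves 2^(-r/8) to absorb the polynomial factors and, for alpha > 1/2, also 4^(n/r).\<close>

lemma rel_var_rate_less_1:
  assumes b: "b > 0" and \<alpha>: "1 / 2 \<le> \<alpha>" "\<alpha> < 1"
  shows "\<forall>\<^sub>F n in sequentially. \<forall>m\<in>{n - 1, n}. rel_var m (b * real n powr \<alpha>) \<le> 6 * sqrt pi * rate_H C \<alpha> b n"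
proof -
  define \<delta> :: real where "\<delta> = 2 powr (- 3 / 4) - 1 / 2"
  have "2 powr (- 1) < (2 :: real) powr (- 3 / 4)" by (intro powr_less_mono) auto
  then have \<delta>: "\<delta> > 0" by (simp add: \<delta>_def powr_minus)
  have a0: "\<alpha> > 0" using \<alpha> by simp
  have "filterlim (\<lambda>n. b * real n powr \<alpha>) at_top sequentially"
    using b a0 by real_asymp
  then have ev1: "\<forall>\<^sub>F n in sequentially. 8 \<le> b * real n powr \<alpha>"
    by (simp add: filterlim_at_top)
  have "(\<lambda>n. (b * real n powr \<alpha> / 2 + 1) / (real n - 1)) \<longlonglongrightarrow> 0"
    using b a0 \<alpha>(2) by real_asymp
  then have ev2: "\<forall>\<^sub>F n in sequentially. (b * real n powr \<alpha> / 2 + 1) / (real n - 1) < \<delta>"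
    using \<delta> by (rule order_tendstoD)
  \<comment> \<open>At alpha = 1/2 the factor 4^(n/r) = 2^(2 sqrt n / b) has the same exponential
    order as the gain and is kept in the rate; for larger alpha it is absorbed.\<close>
  define Y where "Y n = (if \<alpha> = 1 / 2 then 1 else 4 powr (real n / (b * real n powr \<alpha>)))" for n
  have ev3: "\<forall>\<^sub>F n in sequentially. (real n + 2) * Y n * 2 powr (- (b * real n powr \<alpha>) / 8) \<le> 1"
  proof (cases "\<alpha> = 1 / 2")
    case True
    have "(\<lambda>n. (real n + 2) * 2 powr (- (b * real n powr (1 / 2)) / 8)) \<longlonglongrightarrow> 0"
      using b by real_asymp
    then have "\<forall>\<^sub>F n in sequentially. (real n + 2) * 2 powr (- (b * real n powr (1 / 2)) / 8) < 1"
      by (rule order_tendstoD) simp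
    then show ?thesis by eventually_elim (simp add: Y_def True)
  next
    case False
    then have a2: "\<alpha> > 1 / 2" using \<alpha> by simp
    have "(\<lambda>n. ln (real n + 2) / real n powr \<alpha>) \<longlonglongrightarrow> 0" using a0 by real_asymp
    moreover have "(\<lambda>n. real n powr (1 - 2 * \<alpha>) * (ln 4 / b)) \<longlonglongrightarrow> 0"
      using a2 b by real_asymp
    ultimately have "(\<lambda>n. ln (real n + 2) / real n powr \<alpha> + real n powr (1 - 2 * \<alpha>) * (ln 4 / b)) \<longlonglongrightarrow> 0 + 0"
      by (rule tendsto_add)
    then have "\<forall>\<^sub>F n in sequentially. ln (real n + 2) / real n powr \<alpha> + real n powr (1 - 2 * \<alpha>) * (ln 4 / b) < b * ln 2 / 8"
      using b by (intro order_tendstoD) auto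
    then show ?thesis using eventually_gt_at_top[of 0]
    proof eventually_elim
      case (elim n)
      define N where "N = real n powr \<alpha>"
      have N: "N > 0" using elim by (simp add: N_def)
      have e1: "real n powr (1 - 2 * \<alpha>) * N = real n / N"
      proof -
        have "real n powr (1 - 2 * \<alpha>) = real n / (N * N)"
          using elim by (simp add: N_def powr_diff flip: powr_add)
        then show ?thesis using N by simp
      qed
      have "(ln (real n + 2) / N + real n powr (1 - 2 * \<alpha>) * (ln 4 / b)) * N \<le> (b * ln 2 / 8) * N"
        using elim N unfolding N_def[symmetric] by (intro mult_right_mono) auto
      then have "ln (real n + 2) + (real n / N) * (ln 4 / b) \<le> b * N * ln 2 / 8"
      proof -
        assume a: "(ln (real n + 2) / N + real n powr (1 - 2 * \<alpha>) * (ln 4 / b)) * N \<le> (b * ln 2 / 8) * N"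
        have "ln (real n + 2) / N * N = ln (real n + 2)" using N by simp
        moreover have "real n powr (1 - 2 * \<alpha>) * (ln 4 / b) * N = (real n / N) * (ln 4 / b)"
          unfolding e1[symmetric] by (simp only: mult_ac)
        ultimately show ?thesis using a by (simp only: distrib_right) (simp add: mult_ac)
      qed
      then have "ln (real n + 2) + real n / (b * N) * ln 4 + (- (b * N) / 8) * ln 2 \<le> 0"
        by (simp add: mult_ac)
      then have "exp (ln (real n + 2) + real n / (b * N) * ln 4 + (- (b * N) / 8) * ln 2) \<le> 1" by simp
      also have "exp (ln (real n + 2) + real n / (b * N) * ln 4 + (- (b * N) / 8) * ln 2) =
         (real n + 2) * 4 powr (real n / (b * N)) * 2 powr (- (b * N) / 8)"
        unfolding exp_add by (simp add: powr_def)
      finally show ?case using False by (simp add: Y_def N_def)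
    qed
  qed
  show ?thesis using ev1 ev2 ev3 eventually_ge_at_top[of 2]
  proof eventually_elim
    case (elim n)
    define r where "r = b * real n powr \<alpha>"
    note elim = elim[folded r_def]
    have r: "r \<ge> 8" using elim by simp
    show ?case unfolding r_def[symmetric]
    proof
      fix m assume m: "m \<in> {n - 1, n}"
      then have m1: "m \<ge> 1" "real n - 1 \<le> real m" "real m \<le> real n" using elim by (auto simp: of_nat_diff)
      have mr: "real m / r \<le> real n / r" "real m / r \<le> real n"
      proof -
        show "real m / r \<le> real n / r" using m1 r by (intro divide_right_mono) auto
        have "real m / r \<le> real m / 1" using r by (intro divide_left_mono) auto
        then show "real m / r \<le> real n" using m1 by simp
      qed
      have frac: "(r / 2 + real m / 2 + 1) / (2 * (real m / 2)) \<le> 2 powr (- 3 / 4)"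
      proof -
        have "(r / 2 + real m / 2 + 1) / (2 * (real m / 2)) = 1 / 2 + (r / 2 + 1) / real m"
          using m1 by (simp add: field_simps)
        also have "(r / 2 + 1) / real m \<le> (r / 2 + 1) / (real n - 1)"
          using m1 r elim by (intro divide_left_mono) auto
        also have "1 / 2 + (r / 2 + 1) / (real n - 1) \<le> 1 / 2 + \<delta>" using elim by simp
        finally show ?thesis by (simp add: \<delta>_def)
      qed
      have T: "gamma_T (r / 2) (real m / 2) \<le> sqrt pi * sqrt (real n + 2) * 2 powr (- (3 * r) / 8)"
      proof -
        have "gamma_T (r / 2) (real m / 2) \<le> sqrt pi * sqrt (real m / 2 + 1) * ((r / 2 + real m / 2 + 1) / (2 * (real m / 2))) powr (r / 2)"
          using r m1 by (intro gamma_T_le_power) auto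
        also have "\<dots> \<le> sqrt pi * sqrt (real n + 2) * (2 powr (- 3 / 4)) powr (r / 2)"
          using frac r m1 by (intro mult_mono powr_mono2) auto
        also have "(2 powr (- 3 / 4)) powr (r / 2) = (2::real) powr (- (3 * r) / 8)"
          by (simp add: powr_powr)
        finally show ?thesis .
      qed
      have "rel_var m r \<le> 6 * 4 powr (real m / r) * sqrt (real m / r + 2) / sqrt (real m * r) * gamma_T (r / 2) (real m / 2)"
        using m1(1) r by (rule rel_var_le)
      also have "\<dots> \<le> 6 * 4 powr (real n / r) * sqrt (real n + 2) / 1 * (sqrt pi * sqrt (real n + 2) * 2 powr (- (3 * r) / 8))"
      proof (intro mult_mono frac_le T)
        show "1 \<le> sqrt (real m * r)" using m1 r mult_mono[of 1 "real m" 1 r] by simp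
      qed (use mr r m1 gamma_T_pos[of "r / 2" "real m / 2"] in \<open>auto intro!: mult_nonneg_nonneg\<close>)
      also have "\<dots> = 6 * sqrt pi * ((real n + 2) * 4 powr (real n / r) * 2 powr (- (3 * r) / 8))"
        by simp
      also have "(real n + 2) * 4 powr (real n / r) * 2 powr (- (3 * r) / 8) \<le> rate_H C \<alpha> b n"
      proof -
        have s: "(2::real) powr (- (3 * r) / 8) = 2 powr (- r / 8) * 2 powr (- r / 4)"
          by (simp flip: powr_add)
        show ?thesis
        proof (cases "\<alpha> = 1 / 2")
          case True
          have rs: "r = b * sqrt (real n)" using elim by (simp add: r_def True powr_half_sqrt)
          have q: "real n / r = sqrt (real n) / b"
            using elim b real_div_sqrt[of "real n"] by (simp add: rs field_simps)
          have four: "(4::real) powr (sqrt (real n) / b) = 2 powr (2 / b * sqrt (real n))"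
            using powr_powr[of 2 2 "sqrt (real n) / b"] by simp
          have "(real n + 2) * 4 powr (real n / r) * 2 powr (- (3 * r) / 8) =
             ((real n + 2) * 2 powr (- r / 8)) * (2 powr (2 / b * sqrt (real n)) * 2 powr (- r / 4))"
            unfolding s q four by (simp only: mult_ac)
          also have "\<dots> \<le> 1 * (2 powr (2 / b * sqrt (real n)) * 2 powr (- r / 4))"
            using elim by (intro mult_right_mono) (auto simp: Y_def True)
          also have "\<dots> = rate_H C \<alpha> b n"
            by (simp add: rate_H_def True powr_powr rs left_diff_distrib flip: powr_add)
          finally show ?thesis .
        next
          case False
          have "(real n + 2) * 4 powr (real n / r) * 2 powr (- (3 * r) / 8) =
             ((real n + 2) * Y n * 2 powr (- r / 8)) * 2 powr (- r / 4)"
            unfolding s using False by (simp add: Y_def r_def)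
          also have "\<dots> \<le> 1 * 2 powr (- r / 4)"
            using elim by (intro mult_right_mono) auto
          also have "\<dots> = rate_H C \<alpha> b n"
            using False \<alpha> by (simp add: rate_H_def powr_powr r_def)
          finally show ?thesis .
        qed
      qed
      finally show "rel_var m r \<le> 6 * sqrt pi * rate_H C \<alpha> b n" by simp
    qed
  qed
qed

text \<open>With x = b y all powers of y in \<open>gamma_T_le_stirling\<close> cancel, leaving the
  y-th power of the base in the rate. The remaining sqrt n, divided by the n from sqrt (m r), is its
  factor 1 / sqrt n.\<close>

lemma rel_var_rate_eq_1:
  assumes b: "b > 0"
  shows "\<exists>C1>0. \<forall>\<^sub>F n in sequentially. \<forall>m\<in>{n - 1, n}. rel_var m (b * real n powr 1) \<le> C1 * rate_H C 1 b n"
proof -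
  define K where "K = 4 * (b + 1) powr (b + 1) / (b + 2) powr (b + 2)"
  define A where "A = 6 * 4 powr (1 / b) * sqrt (1 / b + 2) / sqrt (b / 2)"
  define B where "B = (b + 2) * (2 * sqrt (2 * pi) * sqrt ((b + 2) / 2))"
  have A: "A > 0" and B: "B > 0" using b by (auto simp: A_def B_def intro!: mult_pos_pos divide_pos_pos add_pos_pos)
  have ev: "\<forall>\<^sub>F n in sequentially. 8 / b \<le> real n" by real_asymp
  have "\<forall>\<^sub>F n in sequentially. \<forall>m\<in>{n - 1, n}. rel_var m (b * real n powr 1) \<le> A * B * rate_H C 1 b n"
    using ev eventually_ge_at_top[of 2]
  proof eventually_elim
    case (elim n)
    define r where "r = b * real n"
    have r: "r \<ge> 8" using elim b by (simp add: r_def field_simps)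
    have n: "real n \<ge> 2" using elim by simp
    define y where "y = real n / 2"
    have y: "y \<ge> 1" using n by (simp add: y_def)
    have x: "r / 2 = b * y" by (simp add: r_def y_def)
    have "1 * 1 \<le> (b + 2) * y" using b y by (intro mult_mono) auto
    then have by2: "(b + 2) * y \<ge> 1" by (simp only: mult_1)
    have pow: "4 powr y * (y powr y * (b * y + y) powr (b * y + y) / (b * y + 2 * y) powr (b * y + 2 * y)) = K powr y"
    proof -
      have e: "b * y + y = (b + 1) * y" "b * y + 2 * y = (b + 2) * y" by (simp_all add: algebra_simps)
      have "y powr y * ((b + 1) * y) powr ((b + 1) * y) / ((b + 2) * y) powr ((b + 2) * y) =
        ((b + 1) powr (b + 1)) powr y / ((b + 2) powr (b + 2)) powr y * (y powr y * y powr ((b + 1) * y) / y powr ((b + 2) * y))"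
        using b y by (simp add: powr_mult powr_powr)
      also have "y powr y * y powr ((b + 1) * y) / y powr ((b + 2) * y) = 1"
        using y by (simp add: algebra_simps flip: powr_add)
      finally show ?thesis unfolding e using b y by (simp add: K_def powr_mult powr_divide)
    qed
    have T: "gamma_T (r / 2) y \<le> 2 * sqrt (2 * pi) * sqrt ((b + 2) / 2) * sqrt (real n) * K powr y"
    proof -
      let ?s = "(b + 2) * y"
      have "gamma_T (b * y) y \<le> (b * y + 2 * y + 1) * sqrt (2 * pi / (b * y + 2 * y)) *
         (4 powr y * (y powr y * (b * y + y) powr (b * y + y) / (b * y + 2 * y) powr (b * y + 2 * y)))"
        using b y by (intro gamma_T_le_stirling) auto
      also have "\<dots> = (?s + 1) * sqrt (2 * pi / ?s) * K powr y" unfolding pow by (simp add: algebra_simps)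
      also have "\<dots> \<le> (2 * ?s) * sqrt (2 * pi / ?s) * K powr y"
        using by2 by (intro mult_right_mono) (linarith, auto)
      also have "(2 * ?s) * sqrt (2 * pi / ?s) = 2 * sqrt (2 * pi) * sqrt ?s"
      proof -
        have "(2 * ?s) * sqrt (2 * pi / ?s) = 2 * sqrt (2 * pi) * (?s / sqrt ?s)" by (simp add: real_sqrt_divide)
        also have "?s / sqrt ?s = sqrt ?s" using by2 by (intro real_div_sqrt) linarith
        finally show ?thesis .
      qed
      also have "sqrt ?s = sqrt ((b + 2) / 2) * sqrt (real n)"
        by (simp add: y_def real_sqrt_mult real_sqrt_divide)
      finally show ?thesis by (simp add: x mult_ac)
    qed
    have Tm: "gamma_T (r / 2) (real m / 2) \<le> (b + 2) * gamma_T (r / 2) y" if m: "m \<in> {n - 1, n}" for m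
    proof (cases "m = n")
      case True
      have "1 * gamma_T (r / 2) y \<le> (b + 2) * gamma_T (r / 2) y"
        using b y r gamma_T_pos[of "r / 2" y] by (intro mult_right_mono) auto
      then show ?thesis using True by (simp add: y_def)
    next
      case False
      then have m2: "real m / 2 = y - 1 / 2" using m elim by (simp add: y_def of_nat_diff field_simps)
      have "gamma_T (r / 2) (real m / 2) \<le> (r / 2 + 2 * y) / (2 * y - 1) * gamma_T (r / 2) y"
        unfolding m2 using r y by (intro gamma_T_half_step) auto
      also have "\<dots> \<le> (b + 2) * gamma_T (r / 2) y"
      proof (rule mult_right_mono)
        have "b * y + 2 * y \<le> (b + 2) * (2 * y - 1)" using b y mult_left_mono[of 1 y "b + 2"] by (simp add: algebra_simps)
        then show "(r / 2 + 2 * y) / (2 * y - 1) \<le> b + 2" using y by (simp add: x divide_le_eq)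
      qed (use gamma_T_pos[of "r / 2" y] r y in auto)
      finally show ?thesis .
    qed
    show ?case
    proof
      fix m assume m: "m \<in> {n - 1, n}"
      then have m1: "m \<ge> 1" "real n / 2 \<le> real m" "real m \<le> real n" using elim by (auto simp: of_nat_diff)
      have mr: "real m / r \<le> 1 / b" using m1 b n by (simp add: r_def divide_simps)
      have sq: "real n * sqrt (b / 2) \<le> sqrt (real m * r)"
      proof -
        have "real n * sqrt (b / 2) = sqrt (real n / 2 * r)"
          using n by (simp add: r_def real_sqrt_mult real_sqrt_divide)
        also have "\<dots> \<le> sqrt (real m * r)" using m1 r by (intro real_sqrt_le_mono mult_right_mono) auto
        finally show ?thesis .
      qed
      have "rel_var m r \<le> 6 * 4 powr (real m / r) * sqrt (real m / r + 2) / sqrt (real m * r) * gamma_T (r / 2) (real m / 2)"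
        using m1(1) r by (rule rel_var_le)
      also have "\<dots> \<le> 6 * 4 powr (1 / b) * sqrt (1 / b + 2) / (real n * sqrt (b / 2)) *
          ((b + 2) * (2 * sqrt (2 * pi) * sqrt ((b + 2) / 2) * sqrt (real n) * K powr y))"
      proof (intro mult_mono frac_le sq)
        have "(b + 2) * gamma_T (r / 2) y \<le> (b + 2) * (2 * sqrt (2 * pi) * sqrt ((b + 2) / 2) * sqrt (real n) * K powr y)"
          using T b by (intro mult_left_mono) auto
        with Tm[OF m] show "gamma_T (r / 2) (real m / 2) \<le> (b + 2) * (2 * sqrt (2 * pi) * sqrt ((b + 2) / 2) * sqrt (real n) * K powr y)"
          by linarith
      qed (use mr r m1 n b gamma_T_pos[of "r / 2" "real m / 2"] in \<open>auto intro!: mult_nonneg_nonneg\<close>)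
      also have "\<dots> = A * B * (sqrt (real n) / real n * K powr y)"
        by (simp add: A_def B_def mult_ac)
      also have "sqrt (real n) / real n = 1 / sqrt (real n)"
        using n by (simp add: field_simps)
      also have "1 / sqrt (real n) * K powr y = rate_H C 1 b n"
        by (simp add: rate_H_def K_def y_def)
      finally show "rel_var m (b * real n powr 1) \<le> A * B * rate_H C 1 b n" using n by (simp add: r_def)
    qed
  qed
  then show ?thesis using A B by (intro exI[of _ "A * B"]) auto
qed

text \<open>The constant C stands inside the rate. Having the estimate for all large C permits
  choosing it equal to the outer constant afterwards.\<close>

lemma rel_var_rate_greater_1:
  assumes b: "b > 0" and \<alpha>: "\<alpha> > 1"
  shows "\<exists>C1>0. \<exists>C2>0. \<forall>C\<ge>C2. \<forall>\<^sub>F n in sequentially. \<forall>m\<in>{n - 1, n}. rel_var m (b * real n powr \<alpha>) \<le> C1 * rate_H C \<alpha> b n"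
proof -
  \<comment> \<open>Chosen so that 4 (n / 2 + 1) / (r / 2) <= 12 n / r = c n^(1 - alpha).\<close>
  define c where "c = 12 / b"
  have c: "c > 0" using b by (simp add: c_def)
  define A where "A = 6 * 4 powr (1 / b) * sqrt (1 / b + 2)"
  have A: "A > 0" using b by (auto simp: A_def intro!: mult_pos_pos add_pos_pos)
  have ev1: "\<forall>\<^sub>F n in sequentially. 8 \<le> b * real n powr \<alpha>"
    using filterlim_at_top[of "\<lambda>n. b * real n powr \<alpha>" sequentially] b \<alpha> by real_asymp
  have "(\<lambda>n. c * real n powr (1 - \<alpha>)) \<longlonglongrightarrow> 0" using \<alpha> by real_asymp
  then have ev2: "\<forall>\<^sub>F n in sequentially. c * real n powr (1 - \<alpha>) < 1" by (rule order_tendstoD) simp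
  have "(\<lambda>n. (real n powr (\<alpha> - 1) / c) powr (1 / 2) / 2 ^ n) \<longlonglongrightarrow> 0"
    using \<alpha> c by real_asymp
  then have ev3: "\<forall>\<^sub>F n in sequentially. (real n powr (\<alpha> - 1) / c) powr (1 / 2) / 2 ^ n < 1" by (rule order_tendstoD) simp
  have main: "\<forall>\<^sub>F n in sequentially. \<forall>m\<in>{n - 1, n}. rel_var m (b * real n powr \<alpha>) \<le> A * rate_H C \<alpha> b n" if C: "C \<ge> 4 * c" for C
    using ev1 ev2 ev3 eventually_ge_at_top[of 2]
  proof eventually_elim
    case (elim n)
    define r where "r = b * real n powr \<alpha>"
    have r: "r \<ge> 8" using elim by (simp add: r_def)
    have n: "real n \<ge> 2" using elim by simp
    define z where "z = c * real n powr (1 - \<alpha>)"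
    have z: "0 < z" "z < 1" using c n elim by (auto simp: z_def)
    have zr: "4 * (real n / 2 + 1) / (r / 2) \<le> z"
    proof -
      have "4 * (real n / 2 + 1) / (r / 2) \<le> 12 * real n / r" using n r by (simp add: divide_simps)
      also have "\<dots> = z" using n b by (simp add: z_def c_def r_def powr_diff)
      finally show ?thesis .
    qed
    show ?case unfolding r_def[symmetric]
    proof
      fix m assume m: "m \<in> {n - 1, n}"
      then have m1: "m \<ge> 1" "real n - 1 \<le> real m" "real m \<le> real n" using elim by (auto simp: of_nat_diff)
      have mr: "real m / r \<le> 1 / b"
      proof -
        have "real n powr 1 \<le> real n powr \<alpha>" using n \<alpha> by (intro powr_mono) auto
        then have "real m \<le> real n powr \<alpha>" using m1 n by simp
        then show ?thesis using b n by (simp add: r_def divide_simps)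
      qed
      have T: "gamma_T (r / 2) (real m / 2) \<le> z powr ((real n - 1) / 2)"
      proof -
        have "gamma_T (r / 2) (real m / 2) \<le> (4 * (real m / 2 + 1) / (r / 2)) powr (real m / 2)"
          using r by (intro gamma_T_le_large) auto
        also have "\<dots> \<le> z powr (real m / 2)"
        proof (intro powr_mono2)
          have "4 * (real m / 2 + 1) / (r / 2) \<le> 4 * (real n / 2 + 1) / (r / 2)"
            using m1 r by (intro divide_right_mono) auto
          then show "4 * (real m / 2 + 1) / (r / 2) \<le> z" using zr by linarith
        qed (use r in auto)
        also have "\<dots> \<le> z powr ((real n - 1) / 2)"
          using z m1 by (intro powr_mono') auto
        finally show ?thesis .
      qed
      have "rel_var m r \<le> 6 * 4 powr (real m / r) * sqrt (real m / r + 2) / sqrt (real m * r) * gamma_T (r / 2) (real m / 2)"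
        using m1(1) r by (rule rel_var_le)
      also have "\<dots> \<le> 6 * 4 powr (1 / b) * sqrt (1 / b + 2) / 1 * z powr ((real n - 1) / 2)"
      proof (intro mult_mono frac_le T)
        show "1 \<le> sqrt (real m * r)" using m1 r mult_mono[of 1 "real m" 1 r] by simp
      qed (use mr r m1 b gamma_T_pos[of "r / 2" "real m / 2"] in \<open>auto intro!: mult_nonneg_nonneg\<close>)
      also have "\<dots> = A * z powr ((real n - 1) / 2)" by (simp add: A_def)
      also have "\<dots> \<le> A * rate_H C \<alpha> b n"
      proof (rule mult_left_mono)
        \<comment> \<open>Dimension n - 1 leaves a surplus factor z^(-1/2). It is a power of n,
          hence eventually below 2^n = 4^(n/2); this accounts for the 4 in C >= 4 c.\<close>
        have "z powr ((real n - 1) / 2) = z powr (real n / 2) * (1 / z) powr (1 / 2)"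
          using z by (simp add: diff_divide_distrib powr_diff powr_divide)
        also have "1 / z = real n powr (\<alpha> - 1) / c"
          using n c by (simp add: z_def powr_diff)
        also have "z powr (real n / 2) * (real n powr (\<alpha> - 1) / c) powr (1 / 2) \<le> z powr (real n / 2) * 2 ^ n"
          using elim by (intro mult_left_mono) (auto simp: divide_less_eq)
        also have "\<dots> = (4 * z) powr (real n / 2)"
        proof -
          have "(4::real) powr (real n / 2) = 2 ^ n"
            using powr_powr[of 2 2 "real n / 2"] by (simp add: powr_realpow)
          then show ?thesis using z by (simp add: powr_mult)
        qed
        also have "\<dots> \<le> (C * real n powr (1 - \<alpha>)) powr (real n / 2)"
        proof (intro powr_mono2)
          show "4 * z \<le> C * real n powr (1 - \<alpha>)"
            using C by (simp add: z_def mult.assoc[symmetric] mult_right_mono)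
        qed (use z in auto)
        also have "\<dots> = rate_H C \<alpha> b n" using \<alpha> by (simp add: rate_H_def)
        finally show "z powr ((real n - 1) / 2) \<le> rate_H C \<alpha> b n" .
      qed (use A in simp)
      finally show "rel_var m r \<le> A * rate_H C \<alpha> b n" .
    qed
  qed
  show ?thesis using A c main by (intro exI[of _ A] exI[of _ "4 * c"] conjI) auto
qed

lemma rate_H_nonneg: "C \<ge> 0 \<Longrightarrow> rate_H C \<alpha> b n \<ge> 0"
  by (simp add: rate_H_def)

text \<open>One C serves both outside and inside the rate. The number 128 is 2 * 8^2: two volumes
  are each tested at relative deviation epsilon / 8.\<close>

lemma rel_var_rate:
  assumes params: "(b > 0 \<and> \<alpha> > 1 / 2) \<or> (b > sqrt 8 \<and> \<alpha> = 1 / 2)"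
  shows "\<exists>C>0. \<forall>\<^sub>F n in sequentially. \<forall>m\<in>{n - 1, n}. 128 * rel_var m (b * real n powr \<alpha>) \<le> C * rate_H C \<alpha> b n"
proof -
  have b: "b > 0" using params by (auto intro: less_trans[of 0 "sqrt 8"])
  have \<alpha>: "\<alpha> \<ge> 1 / 2" using params by auto
  have "\<exists>C1>0. \<exists>C2>0. \<forall>C\<ge>C2. \<forall>\<^sub>F n in sequentially. \<forall>m\<in>{n - 1, n}. rel_var m (b * real n powr \<alpha>) \<le> C1 * rate_H C \<alpha> b n"
  proof -
    consider "\<alpha> < 1" | "\<alpha> = 1" | "\<alpha> > 1" by linarith
    then show ?thesis
    proof cases
      case 1
      then show ?thesis using rel_var_rate_less_1[OF b \<alpha>]
        by (intro exI[of _ "6 * sqrt pi"] exI[of _ 1] conjI) auto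
    next
      case 2
      obtain C1 where "C1 > 0" "\<forall>\<^sub>F n in sequentially. \<forall>m\<in>{n - 1, n}. rel_var m (b * real n powr 1) \<le> C1 * rate_H 0 1 b n"
        using rel_var_rate_eq_1[OF b] by blast
      moreover have e: "rate_H C 1 b = rate_H 0 1 b" for C by (simp add: rate_H_def fun_eq_iff)
      ultimately have "\<forall>\<^sub>F n in sequentially. \<forall>m\<in>{n - 1, n}. rel_var m (b * real n powr 1) \<le> C1 * rate_H C 1 b n" for C
        unfolding e[of C] by blast
      then show ?thesis unfolding 2 using \<open>C1 > 0\<close> by (intro exI[of _ C1] exI[of _ 1] conjI allI impI) auto
    next
      case 3
      then show ?thesis using rel_var_rate_greater_1[OF b] by blast
    qed
  qed
  then obtain C1 C2 where C: "C1 > 0" "C2 > 0" "\<And>C. C \<ge> C2 \<Longrightarrow> \<forall>\<^sub>F n in sequentially. \<forall>m\<in>{n - 1, n}. rel_var m (b * real n powr \<alpha>) \<le> C1 * rate_H C \<alpha> b n"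
    by blast
  define C where "C = max (128 * C1) C2"
  have "C > 0" using C by (simp add: C_def)
  have "C \<ge> C2" by (simp add: C_def)
  from C(3)[OF this] have "\<forall>\<^sub>F n in sequentially. \<forall>m\<in>{n - 1, n}. 128 * rel_var m (b * real n powr \<alpha>) \<le> C * rate_H C \<alpha> b n"
  proof eventually_elim
    case (elim n)
    have "(128 * C1) * rate_H C \<alpha> b n \<le> C * rate_H C \<alpha> b n"
      using \<open>C > 0\<close> by (intro mult_right_mono rate_H_nonneg) (auto simp: C_def)
    then show ?case using elim by (auto simp: mult.assoc)
  qed
  then show ?thesis using \<open>C > 0\<close> by blast
qed

lemma rate_H_tendsto_0:
  assumes params: "(b > 0 \<and> \<alpha> > 1 / 2) \<or> (b > sqrt 8 \<and> \<alpha> = 1 / 2)" and C: "C > 0"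
  shows "(\<lambda>n. rate_H C \<alpha> b n) \<longlonglongrightarrow> 0"
proof -
  have b: "b > 0" using params by (auto intro: less_trans[of 0 "sqrt 8"])
  have \<alpha>: "\<alpha> \<ge> 1 / 2" using params by auto
  consider "\<alpha> = 1 / 2" | "1 / 2 < \<alpha>" "\<alpha> < 1" | "\<alpha> = 1" | "\<alpha> > 1" using \<alpha> by linarith
  then show ?thesis
  proof cases
    case 1
    then have "b > sqrt 8" using params by simp
    \<comment> \<open>The place where b > sqrt 8 is used: it is equivalent to 2 / b < b / 4.\<close>
    then have "(sqrt 8)\<^sup>2 < b\<^sup>2" by (intro power_strict_mono) auto
    then have q: "b / 4 - 2 / b > 0" using b by (simp add: power2_eq_square field_simps)
    define q where "q = b / 4 - 2 / b"
    have "(\<lambda>n. 2 powr (- (q * sqrt (real n)))) \<longlonglongrightarrow> 0" using q[folded q_def] by real_asymp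
    moreover have "rate_H C \<alpha> b n = 2 powr (- (q * sqrt (real n)))" for n
      using 1 by (simp add: rate_H_def powr_powr q_def algebra_simps)
    ultimately show ?thesis by simp
  next
    case 2
    have a: "\<alpha> > 0" using 2 by simp
    have "(\<lambda>n. 2 powr (- (b / 4 * real n powr \<alpha>))) \<longlonglongrightarrow> 0" using b a by real_asymp
    moreover have "rate_H C \<alpha> b n = 2 powr (- (b / 4 * real n powr \<alpha>))" for n
      using 2 by (simp add: rate_H_def powr_powr)
    ultimately show ?thesis by simp
  next
    case 3
    \<comment> \<open>The logarithm of (t + 1)^(t + 1) / (t + 2)^(t + 2). It decreases from the
      value - ln 4 at 0, so the base in the rate is at most 1 and the factor 1 / sqrt n forces the
      limit.\<close>
    define f where "f t = (t + 1) * ln (t + 1) - (t + 2) * ln (t + 2)" for t :: real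
    have "f b \<le> f 0"
    proof (rule DERIV_nonpos_imp_nonincreasing[where f = f])
      fix t :: real assume t: "0 \<le> t" "t \<le> b"
      show "\<exists>y. (f has_real_derivative y) (at t) \<and> y \<le> 0"
      proof (intro exI conjI)
      have "(f has_real_derivative (1 * ln (t + 1) + (t + 1) * (1 / (t + 1)) - (1 * ln (t + 2) + (t + 2) * (1 / (t + 2))))) (at t)"
        unfolding f_def using t by (auto intro!: derivative_eq_intros)
      then show "(f has_real_derivative (ln (t + 1) - ln (t + 2))) (at t)" using t by simp
      show "ln (t + 1) - ln (t + 2) \<le> 0" using t by simp
      qed
    qed (use b in simp)
    then have "exp (f b) \<le> exp (- 2 * ln 2)" by (simp add: f_def)
    also have "exp (- 2 * ln 2) = (1 / 4 :: real)"
      using powr_def[of 2 "- 2 :: real"] by (simp add: powr_minus)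
    also have "exp (f b) = (b + 1) powr (b + 1) / (b + 2) powr (b + 2)"
      using b by (simp add: f_def powr_def exp_diff)
    finally have K: "4 * (b + 1) powr (b + 1) / (b + 2) powr (b + 2) \<le> 1" by (simp add: mult.commute)
    have up: "rate_H C \<alpha> b n \<le> 1 / sqrt (real n)" for n
    proof -
      have "(4 * (b + 1) powr (b + 1) / (b + 2) powr (b + 2)) powr (real n / 2) \<le> 1 powr (real n / 2)"
        using K b by (intro powr_mono2) auto
      then have "1 / sqrt (real n) * (4 * (b + 1) powr (b + 1) / (b + 2) powr (b + 2)) powr (real n / 2) \<le> 1 / sqrt (real n) * 1"
        by (intro mult_left_mono) auto
      then show ?thesis using 3 by (simp add: rate_H_def)
    qed
    have lim: "(\<lambda>n. 1 / sqrt (real n)) \<longlonglongrightarrow> 0" by real_asymp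
    have lo: "0 \<le> rate_H C \<alpha> b n" for n using C by (intro rate_H_nonneg) simp
    show ?thesis
      by (rule tendsto_sandwich[OF _ _ tendsto_const lim]) (intro always_eventually allI lo up)+
  next
    case 4
    have "(\<lambda>n. C * real n powr (1 - \<alpha>)) \<longlonglongrightarrow> 0" using 4 by real_asymp
    then have "\<forall>\<^sub>F n in sequentially. C * real n powr (1 - \<alpha>) < 1 / 2" by (rule order_tendstoD) simp
    then have up: "\<forall>\<^sub>F n in sequentially. rate_H C \<alpha> b n \<le> (1 / 2) powr (real n / 2)"
    proof eventually_elim
      case (elim n)
      then show ?case using 4 C by (auto simp: rate_H_def intro!: powr_mono2)
    qed
    have lim: "(\<lambda>n. (1 / 2) powr (real n / 2)) \<longlonglongrightarrow> (0::real)" by real_asymp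
    have lo: "0 \<le> rate_H C \<alpha> b n" for n using C by (intro rate_H_nonneg) simp
    show ?thesis
      by (rule tendsto_sandwich[OF _ up tendsto_const lim]) (intro always_eventually allI lo)
  qed
qed

section \<open>The quotient of the mean volumes\<close>

lemma fact_le: "n \<ge> 1 \<Longrightarrow> ln (fact n) \<le> (real n + 1) * ln (real n) + 1 - real n"
proof (induction n rule: dec_induct)
  case (step n)
  have n: "real n \<ge> 1" using step by simp
  have "ln (real n / (real n + 1)) \<le> real n / (real n + 1) - 1" using n by (intro ln_le_minus_one) auto
  then have "(real n + 1) * (ln (real n) - ln (real n + 1)) \<le> (real n + 1) * (real n / (real n + 1) - 1)"
    using n by (intro mult_left_mono) (auto simp: ln_div)
  also have "\<dots> = - 1" using n by (simp add: field_simps)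
  finally have 1: "(real n + 1) * ln (real n) + 1 \<le> (real n + 1) * ln (real n + 1)" by (simp add: algebra_simps)
  have "ln (fact (Suc n)) = ln (real n + 1) + ln (fact n)"
    using n by (simp add: ln_mult add.commute)
  then show ?case using 1 step.IH by (simp add: algebra_simps)
qed simp

text \<open>The mean section volume divided by the mean cell volume to the power (n - 1) / n; the
  powers of \<open>k\<close> in the two means cancel.\<close>

definition mean_ratio :: "nat \<Rightarrow> real \<Rightarrow> real" where
  "mean_ratio n r = kappa (real n - 1) * Gamma ((real n - 1) / r + 1) /
     (kappa (real n) * Gamma (real n / r + 1)) powr ((real n - 1) / real n)"

text \<open>A crude constant is good enough, as its logarithm will be divided by n.\<close>

lemma Gamma_ge_half:
  fixes p :: real
  assumes "p \<ge> 0"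
  shows "Gamma (p + 1) \<ge> 1 / 2"
proof (cases "p \<ge> 1")
  case True
  then show ?thesis using Gamma_add_ge[of 2 "p - 1"] Gamma_numeral[of "num.Bit0 num.One", where 'a=real] by (simp add: fact_numeral add.commute)
next
  case False
  have g: "Gamma (p + 1) > 0" using assms by (intro Gamma_real_pos) auto
  have "Gamma (2::real) = 1" using Gamma_fact[of 1, where 'a=real] by simp
  then have "1 \<le> Gamma (p + 1) * 2 powr (1 - p)"
    using Gamma_add_le[of "p + 1" "1 - p"] assms False by simp
  also have "\<dots> \<le> Gamma (p + 1) * 2 powr 1"
    using g assms by (intro mult_left_mono powr_mono) auto
  finally show ?thesis by simp
qed

text \<open>Log-convexity bounds the quotient of the two values of \<open>kappa\<close>. The n-th
  root of \<open>kappa n\<close> is bounded by duplication together with n! <= e n (n / e)^n, whose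
  surplus factors disappear in the root. Passing from n / r to (n - 1) / r in Gamma costs ln (n + 1)
  / r in the exponent.\<close>

lemma mean_ratio_ge:
  assumes n: "n \<ge> 2" and r: "r \<ge> 1"
  shows "mean_ratio n r \<ge> exp (ln ((real n - 1) / 2) / 2 -
     (ln (real n / 2 + 1) / 2 - real n * ln 2 + ln pi / 2 + ((real n + 1) * ln (real n) + 1 - real n)) / (2 * real n)
     - ln (real n + 1) / r - ln 2 / real n)"
proof -
  define y where "y = real n / 2"
  define N where "N = real n"
  have N: "N \<ge> 2" using n by (simp add: N_def)
  have y: "y \<ge> 1" using n by (simp add: y_def)
  define g where "g p = ln (Gamma (p + 1))" for p :: real
  have pos: "Gamma (y + 1) > 0" "Gamma (y + 1 / 2) > 0" "Gamma (N / r + 1) > 0" "Gamma ((N - 1) / r + 1) > 0" "kappa N > 0" "kappa (N - 1) > 0"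
    using y N r by (auto intro!: Gamma_real_pos kappa_pos add_nonneg_pos divide_nonneg_pos)
  have kap: "ln (kappa (N - 1)) - ln (kappa N) \<ge> ln ((N - 1) / 2) / 2 - ln pi / 2"
  proof -
    have "kappa (N - 1) / kappa N = Gamma (y + 1) / Gamma (y + 1 / 2) / sqrt pi"
    proof -
      have e: "(N - 1) / 2 = y - 1 / 2" "N / 2 = y" "y - 1 / 2 + 1 = y + 1 / 2" by (simp_all add: y_def N_def field_simps)
      show ?thesis unfolding kappa_def e by (simp add: powr_diff powr_half_sqrt)
    qed
    moreover have "Gamma (y + 1 / 2) * ((N - 1) / 2) powr (1 / 2) \<le> Gamma (y + 1)"
    proof -
      have e: "y + 1 / 2 - 1 = (N - 1) / 2" by (simp add: y_def N_def field_simps)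
      show ?thesis using Gamma_add_ge[of "y + 1 / 2" "1 / 2"] y unfolding e by (simp add: add.assoc)
    qed
    ultimately have "((N - 1) / 2) powr (1 / 2) / pi powr (1 / 2) \<le> kappa (N - 1) / kappa N"
      using pos by (simp add: powr_half_sqrt divide_right_mono le_divide_eq mult.commute)
    then have "ln (((N - 1) / 2) powr (1 / 2) / pi powr (1 / 2)) \<le> ln (kappa (N - 1) / kappa N)"
      using N pos by (subst ln_le_cancel_iff) auto
    then show ?thesis using N pos by (simp add: ln_div ln_powr)
  qed
  have gam: "ln (Gamma (y + 1)) \<le> (ln (y + 1) / 2 - N * ln 2 + ln pi / 2 + ((N + 1) * ln N + 1 - N)) / 2"
  proof -
    have dup: "Gamma (y + 1 / 2) * Gamma (y + 1) = 2 powr (- N) * sqrt pi * fact n"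
    proof -
      have "2 * (y + 1 / 2) = 1 + real n" by (simp add: y_def)
      then have "Gamma (2 * (y + 1 / 2)) = fact n" using Gamma_fact[of n, where 'a=real] by (simp add: add.commute)
      moreover have "1 - 2 * (y + 1 / 2) = - N" by (simp add: y_def N_def)
      ultimately show ?thesis
        using Gamma_legendre_duplication_real[of "y + 1 / 2"] y by (simp add: add.assoc)
    qed
    have "Gamma (y + 1) \<le> Gamma (y + 1 / 2) * (y + 1) powr (1 / 2)"
      using Gamma_add_le[of "y + 1 / 2" "1 / 2"] y by (simp add: add.assoc)
    then have "Gamma (y + 1) * Gamma (y + 1) \<le> Gamma (y + 1 / 2) * (y + 1) powr (1 / 2) * Gamma (y + 1)"
      using pos by (intro mult_right_mono) auto
    also have "\<dots> = (y + 1) powr (1 / 2) * (2 powr (- N) * pi powr (1 / 2) * fact n)"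
      unfolding powr_half_sqrt[OF pi_ge_zero] dup[symmetric] by (simp only: mult_ac)
    finally have "ln (Gamma (y + 1) * Gamma (y + 1)) \<le> ln ((y + 1) powr (1 / 2) * (2 powr (- N) * pi powr (1 / 2) * fact n))"
      using pos y by (subst ln_le_cancel_iff) auto
    also have "\<dots> = ln (y + 1) / 2 - N * ln 2 + ln pi / 2 + ln (fact n)"
      using y by (simp add: ln_mult_pos ln_powr)
    also have "\<dots> \<le> ln (y + 1) / 2 - N * ln 2 + ln pi / 2 + ((N + 1) * ln N + 1 - N)"
      using fact_le[of n] n by (simp add: N_def)
    finally show ?thesis using pos by (simp add: ln_mult_pos)
  qed
  have lnk: "ln (kappa N) / N = ln pi / 2 - ln (Gamma (y + 1)) / N"
  proof -
    have "ln (kappa N) = N / 2 * ln pi - ln (Gamma (y + 1))"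
    proof -
      have "kappa N = pi powr (N / 2) / Gamma (y + 1)" by (simp add: kappa_def y_def N_def)
      then have "ln (kappa N) = ln (pi powr (N / 2)) - ln (Gamma (y + 1))"
        using pos(1) by (metis ln_divide_pos pi_gt_zero powr_gt_zero less_irrefl)
      then show ?thesis by (simp add: ln_powr)
    qed
    then show ?thesis using N by (simp add: field_simps)
  qed
  have g1: "g (N / r) \<le> g ((N - 1) / r) + ln (N + 1) / r"
  proof -
    have "Gamma (N / r + 1) \<le> Gamma ((N - 1) / r + 1) * (N / r + 1) powr (1 / r)"
    proof -
      have e: "(N - 1) / r + 1 + 1 / r = N / r + 1" using r by (simp add: field_simps)
      show ?thesis using Gamma_add_le[of "(N - 1) / r + 1" "1 / r"] N r unfolding e by (simp add: add_nonneg_pos)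
    qed
    also have "\<dots> \<le> Gamma ((N - 1) / r + 1) * (N + 1) powr (1 / r)"
      using pos N r by (intro mult_left_mono powr_mono2) (auto simp: divide_le_eq mult_le_cancel_left1)
    finally have "g (N / r) \<le> ln (Gamma ((N - 1) / r + 1) * (N + 1) powr (1 / r))"
      unfolding g_def using pos N by (subst ln_le_cancel_iff) auto
    then show ?thesis using pos N by (simp add: g_def ln_mult_pos ln_powr)
  qed
  have g2: "g (N / r) \<ge> - ln 2"
  proof -
    have "ln (1 / 2) \<le> g (N / r)"
      unfolding g_def using Gamma_ge_half[of "N / r"] N r pos by (subst ln_le_cancel_iff) auto
    then show ?thesis by (simp add: ln_div)
  qed
  have "ln (mean_ratio n r) = ln (kappa (N - 1)) + g ((N - 1) / r) - (N - 1) / N * (ln (kappa N) + g (N / r))"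
    unfolding mean_ratio_def N_def[symmetric] g_def using pos by (simp add: ln_div ln_mult_pos ln_powr)
  also have "(N - 1) / N * (ln (kappa N) + g (N / r)) = ln (kappa N) + g (N / r) - ln (kappa N) / N - g (N / r) / N"
    using N by (simp add: field_simps)
  finally have "ln (mean_ratio n r) = (ln (kappa (N - 1)) - ln (kappa N)) + ln (kappa N) / N + (g ((N - 1) / r) - g (N / r)) + g (N / r) / N"
    by simp
  also have "\<dots> \<ge> (ln ((N - 1) / 2) / 2 - ln pi / 2) + (ln pi / 2 - (ln (y + 1) / 2 - N * ln 2 + ln pi / 2 + ((N + 1) * ln N + 1 - N)) / 2 / N)
      + (- (ln (N + 1) / r)) + (- ln 2) / N"
  proof (intro add_mono)
    show "ln pi / 2 - (ln (y + 1) / 2 - N * ln 2 + ln pi / 2 + ((N + 1) * ln N + 1 - N)) / 2 / N \<le> ln (kappa N) / N"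
      unfolding lnk using gam N by (intro diff_left_mono divide_right_mono) auto
    show "- (ln (N + 1) / r) \<le> g ((N - 1) / r) - g (N / r)" using g1 by simp
    show "- ln 2 / N \<le> g (N / r) / N" using g2 N by (intro divide_right_mono) auto
  qed (rule kap)
  finally have "ln (mean_ratio n r) \<ge> ln ((N - 1) / 2) / 2 - (ln (y + 1) / 2 - N * ln 2 + ln pi / 2 + ((N + 1) * ln N + 1 - N)) / (2 * N) - ln (N + 1) / r - ln 2 / N"
    by simp
  then have "exp (ln ((N - 1) / 2) / 2 - (ln (y + 1) / 2 - N * ln 2 + ln pi / 2 + ((N + 1) * ln N + 1 - N)) / (2 * N) - ln (N + 1) / r - ln 2 / N) \<le> exp (ln (mean_ratio n r))"
    by simp
  also have "exp (ln (mean_ratio n r)) = mean_ratio n r"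
    unfolding mean_ratio_def N_def[symmetric] using pos by (intro exp_ln divide_pos_pos mult_pos_pos) auto
  finally show ?thesis by (simp add: N_def y_def)
qed

lemma mean_ratio_eventually:
  assumes b: "b > 0" and \<alpha>: "\<alpha> > 0" and \<delta>: "\<delta> > 0"
  shows "\<forall>\<^sub>F n in sequentially. mean_ratio n (b * real n powr \<alpha>) > sqrt (exp 1) - \<delta>"
proof -
  let ?E = "\<lambda>n. ln ((real n - 1) / 2) / 2 -
     (ln (real n / 2 + 1) / 2 - real n * ln 2 + ln pi / 2 + ((real n + 1) * ln (real n) + 1 - real n)) / (2 * real n)"
  \<comment> \<open>The leading terms are ln (n / 2) / 2 and (ln n - ln 2 - 1) / 2. Their difference
    1/2 is the exponent that yields sqrt e.\<close>
  have "?E \<longlonglongrightarrow> ln (1 / 2) / 2 - (- ln 2 - 1) / 2" by real_asymp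
  also have "ln (1 / 2) / 2 - (- ln 2 - 1) / 2 = (1 / 2 :: real)" by (simp add: ln_div field_simps)
  finally have "?E \<longlonglongrightarrow> 1 / 2" .
  moreover have "(\<lambda>n. ln (real n + 1) / (b * real n powr \<alpha>)) \<longlonglongrightarrow> 0" using b \<alpha> by real_asymp
  moreover have "(\<lambda>n. ln 2 / real n) \<longlonglongrightarrow> 0" by real_asymp
  ultimately have "(\<lambda>n. exp (?E n - ln (real n + 1) / (b * real n powr \<alpha>) - ln 2 / real n)) \<longlonglongrightarrow> exp (1 / 2 - 0 - 0)"
    by (intro tendsto_intros)
  moreover have "exp (1 / 2 - 0 - 0) = sqrt (exp (1::real))"
    by (simp add: powr_half_sqrt[symmetric] powr_def)
  ultimately have "\<forall>\<^sub>F n in sequentially. exp (?E n - ln (real n + 1) / (b * real n powr \<alpha>) - ln 2 / real n) > sqrt (exp 1) - \<delta>"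
    using \<delta> by (intro order_tendstoD(1)) auto
  moreover have "filterlim (\<lambda>n. b * real n powr \<alpha>) at_top sequentially" using b \<alpha> by real_asymp
  then have "\<forall>\<^sub>F n in sequentially. 1 \<le> b * real n powr \<alpha>" by (simp add: filterlim_at_top)
  ultimately show ?thesis using eventually_ge_at_top[of 2]
  proof eventually_elim
    case (elim n)
    then show ?case using mean_ratio_ge[of n "b * real n powr \<alpha>"] by linarith
  qed
qed

section \<open>Moments of the volume of a section of the zero cell\<close>

lemma nn_integral_pair_square:
  assumes "sigma_finite_measure V" and [measurable]: "f \<in> borel_measurable V"
  shows "(\<integral>\<^sup>+z. f (fst z) * f (snd z) \<partial>(V \<Otimes>\<^sub>M V)) = (\<integral>\<^sup>+x. f x \<partial>V)\<^sup>2"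
proof -
  interpret V: sigma_finite_measure V by fact
  have "(\<integral>\<^sup>+z. f (fst z) * f (snd z) \<partial>(V \<Otimes>\<^sub>M V)) = (\<integral>\<^sup>+x. \<integral>\<^sup>+y. f x * f y \<partial>V \<partial>V)"
    by (subst V.nn_integral_fst[symmetric]) auto
  also have "\<dots> = (\<integral>\<^sup>+x. f x \<partial>V)\<^sup>2"
    by (simp add: nn_integral_cmult nn_integral_multc power2_eq_square)
  finally show ?thesis .
qed

text \<open>A moment of the Weibull law with tail exp (- k R^r), obtained from the Gamma integral by
  t = k R^r.\<close>

lemma nn_integral_weibull_moment:
  fixes k r q :: real
  assumes k: "k > 0" and r: "r > 0" and q: "q \<ge> 0"
  shows "(\<integral>\<^sup>+R. ennreal (k * r * R powr (r - 1) * exp (- k * R powr r) * R powr q) * indicator {0<..} R \<partial>lborel)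
    = ennreal (k powr (- q / r) * Gamma (q / r + 1))"
proof -
  define p where "p = q / r + 1"
  have p: "p > 0" "p - 1 = q / r" using q r by (auto simp: p_def add_nonneg_pos)
  let ?g = "\<lambda>R. k * R powr r" and ?g' = "\<lambda>R. k * (r * R powr (r - 1))" and ?f = "\<lambda>t. t powr (p - 1) / exp t"
  have image: "?g ` {0<..} = {0<..}"
  proof (intro equalityI subsetI)
    fix t :: real assume t: "t \<in> {0<..}"
    then have "t = ?g ((t / k) powr (1 / r))" using k r by (simp add: powr_powr)
    then show "t \<in> ?g ` {0<..}" using t k by (intro image_eqI[of _ _ "(t / k) powr (1 / r)"]) auto
  qed (use k in auto)
  have inj: "inj_on ?g {0<..}"
  proof (rule inj_onI)
    fix x y :: real assume "x \<in> {0<..}" "y \<in> {0<..}" "?g x = ?g y"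
    then show "x = y" using k r by (auto dest: arg_cong[where f="\<lambda>t. t powr (1 / r)"] simp: powr_powr)
  qed
  have deriv: "(?g has_field_derivative ?g' x) (at x within {0<..})" if "x \<in> {0<..}" for x
    using that k r by (auto intro!: derivative_eq_intros DERIV_subset[OF has_real_derivative_powr])
  have G: "(?f has_integral Gamma p) {0..}" using p(1) by (rule Gamma_integral_real)
  have G': "(?f has_integral Gamma p) {0<..}"
    by (rule has_integral_spike_set_eq[THEN iffD1, OF _ _ G]) (auto intro!: negligible_subset[OF negligible_sing[of 0]])
  have "?f absolutely_integrable_on ?g ` {0<..} \<and> integral (?g ` {0<..}) ?f = Gamma p"
    unfolding image using G'
    by (auto intro!: nonnegative_absolutely_integrable_1 simp: has_integral_iff)
  then have A: "(\<lambda>x. \<bar>?g' x\<bar> * ?f (?g x)) absolutely_integrable_on {0<..} \<and> integral {0<..} (\<lambda>x. \<bar>?g' x\<bar> * ?f (?g x)) = Gamma p"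
    by (subst has_absolute_integral_change_of_variables_1'[OF _ deriv inj]) auto
  then have "((\<lambda>x. \<bar>?g' x\<bar> * ?f (?g x)) has_integral Gamma p) {0<..}"
    by (auto simp: has_integral_iff dest: set_lebesgue_integral_eq_integral(1))
  from nn_integral_has_integral_lebesgue[OF _ this]
  have I: "(\<integral>\<^sup>+x. ennreal (indicator {0<..} x * (\<bar>?g' x\<bar> * ?f (?g x))) \<partial>lborel) = ennreal (Gamma p)"
    using k r by auto
  have "(\<integral>\<^sup>+R. ennreal (k * r * R powr (r - 1) * exp (- k * R powr r) * R powr q) * indicator {0<..} R \<partial>lborel)
    = (\<integral>\<^sup>+x. ennreal (k powr (- q / r)) * ennreal (indicator {0<..} x * (\<bar>?g' x\<bar> * ?f (?g x))) \<partial>lborel)"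
  proof (rule nn_integral_cong)
    fix x :: real
    have "k * r * x powr (r - 1) * exp (- k * x powr r) * x powr q = k powr (- q / r) * (\<bar>?g' x\<bar> * ?f (?g x))" if "x > 0"
    proof -
      have "k powr (- q / r) * (k * x powr r) powr (q / r) = x powr q"
        using k r that by (simp add: powr_mult powr_powr mult.assoc[symmetric] flip: powr_add)
      then have "?f (?g x) * k powr (- q / r) = exp (- k * x powr r) * x powr q"
        by (simp add: p exp_minus field_simps)
      moreover have "k powr (- q / r) * (\<bar>?g' x\<bar> * ?f (?g x)) = \<bar>?g' x\<bar> * (?f (?g x) * k powr (- q / r))"
        by (simp only: mult_ac)
      moreover have "\<bar>?g' x\<bar> = k * r * x powr (r - 1)" using k r by (simp add: abs_mult)
      ultimately show ?thesis by (simp only: mult.assoc)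
    qed
    then show "ennreal (k * r * x powr (r - 1) * exp (- k * x powr r) * x powr q) * indicator {0<..} x =
      ennreal (k powr (- q / r)) * ennreal (indicator {0<..} x * (\<bar>?g' x\<bar> * ?f (?g x)))"
      by (cases "x > 0") (simp_all add: ennreal_mult'[symmetric])
  qed
  also have "\<dots> = ennreal (k powr (- q / r)) * ennreal (Gamma p)"
    unfolding I[symmetric] by (rule nn_integral_cmult) measurable
  finally show ?thesis unfolding p_def by (simp add: ennreal_mult'[symmetric])
qed

text \<open>The tail of the same Weibull law. Read backwards, it replaces the weight exp (- k M^r)
  by an average of indicators M <= R.\<close>

lemma weibull_layer_cake:
  fixes k r M :: real
  assumes k: "k > 0" and r: "r > 0" and M: "M > 0"
  shows "(\<integral>\<^sup>+R. ennreal (k * r * R powr (r - 1) * exp (- k * R powr r)) * indicator {M..} R \<partial>lborel)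
     = ennreal (exp (- k * M powr r))"
proof -
  let ?F = "\<lambda>R. - exp (- k * R powr r)"
  have "(\<integral>\<^sup>+R. ennreal (k * r * R powr (r - 1) * exp (- k * R powr r)) * indicator {M..} R \<partial>lborel) = ennreal (0 - ?F M)"
  proof (rule nn_integral_FTC_atLeast)
    fix x assume x: "M \<le> x"
    then show "DERIV ?F x :> k * r * x powr (r - 1) * exp (- k * x powr r)"
      using M r by (auto intro!: derivative_eq_intros simp: mult_ac)
    show "0 \<le> k * r * x powr (r - 1) * exp (- k * x powr r)" using k r by simp
  next
    have "filterlim (\<lambda>R::real. exp (r * ln R)) at_top at_top"
      using r by (intro filterlim_compose[OF exp_at_top] filterlim_tendsto_pos_mult_at_top[OF tendsto_const] ln_at_top)
    moreover have "\<forall>\<^sub>F R in at_top. exp (r * ln R) = R powr r"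
      using eventually_gt_at_top[of "0::real"] by eventually_elim (simp add: powr_def)
    ultimately have "filterlim (\<lambda>R. R powr r) at_top at_top"
      by (rule filterlim_cong[OF refl refl, THEN iffD1, rotated])
    then have "filterlim (\<lambda>R. k * R powr r) at_top at_top"
      using k by (intro filterlim_tendsto_pos_mult_at_top[OF tendsto_const])
    then have "((\<lambda>R. exp (- (k * R powr r))) \<longlongrightarrow> 0) at_top"
      by (intro filterlim_compose[OF exp_at_bot]) (simp add: filterlim_uminus_at_bot)
    then show "(?F \<longlongrightarrow> 0) at_top" using tendsto_minus by fastforce
  qed measurable
  then show ?thesis by simp
qed

lemma emeasure_ball_n:
  assumes "m \<ge> 1" "R > 0"
  shows "emeasure (volM m) {c \<in> Rn m. norm_n m c \<le> R} = ennreal (kappa (real m) * R ^ m)"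
proof -
  have "{c \<in> Rn m. norm_n m c \<le> R} = {f. sqrt (\<Sum>i\<in>{..<m}. (f i)\<^sup>2) \<le> R} \<inter> space (Pi\<^sub>M {..<m} (\<lambda>_. lborel))"
    by (auto simp: L2_set_def space_PiM Rn_def)
  then show ?thesis
    using emeasure_cball_aux[of "{..<m}" R] assms by (simp add: volM_def kappa_eq_unit_ball_vol)
qed

text \<open>Removes the origin, since \<open>weibull_layer_cake\<close> is stated for M > 0.\<close>

lemma AE_norm_n_pos:
  assumes "m \<ge> 1"
  shows "AE c in volM m. norm_n m c > 0"
proof (rule AE_I)
  have "{c \<in> space (volM m). \<not> norm_n m c > 0} \<subseteq> Pi\<^sub>E {..<m} (\<lambda>_. {0})"
  proof
    fix c assume c: "c \<in> {c \<in> space (volM m). \<not> norm_n m c > 0}"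
    then have "norm_n m c = 0" using L2_set_nonneg[of c "{..<m}"] by auto
    then have "\<forall>i\<in>{..<m}. c i = 0" by (simp add: L2_set_eq_0_iff)
    then show "c \<in> Pi\<^sub>E {..<m} (\<lambda>_. {0})" using c by (intro PiE_I) (auto simp: Rn_iff)
  qed
  then show "{c \<in> space (volM m). \<not> norm_n m c > 0} \<subseteq> Pi\<^sub>E {..<m} (\<lambda>_. {0})" .
  show "Pi\<^sub>E {..<m} (\<lambda>_. {0}) \<in> sets (volM m)" unfolding volM_def by (intro sets_PiM_I_finite) auto
  show "emeasure (volM m) (Pi\<^sub>E {..<m} (\<lambda>_. {0})) = 0"
    unfolding volM_def using assms by (subst lb.emeasure_PiM) auto
qed

section \<open>Finiteness of the sphere measure and joint measurability of the cell\<close>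

context hyperplane_process begin

lemma cube_subset: "cube_n n q d \<subseteq> Rn n"
  by (auto simp: cube_n_def)

text \<open>Whatever its normal, a hyperplane with t in [0, 1] hits the cube [-1, 1]^n. The
  intensity of the hitting set of this cube is therefore at least c0 / r times the measure of the
  sphere, and it is finite because the process is locally finite.\<close>

lemma finite_measure_sphereM: "finite_measure (sphereM n)"
proof
  let ?K = "cube_n n (zero_n n) 1"
  let ?hit = "hitting n ?K"
  have K: "?K \<subseteq> Rn n" "compact ?K" by (auto simp: cube_n_def compact_cube[unfolded cube_n_def])
  have coord: "\<bar>u i\<bar> \<le> 1" if "u \<in> sphere_n n" "i < n" for u i
    using that member_le_L2_set[of "{..<n}" i "\<lambda>i. \<bar>u i\<bar>"] by (simp add: sphere_n_def L2_set_def)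
  have hit: "hyperplane n u t \<in> ?hit" if u: "u \<in> sphere_n n" and t: "t \<in> {0..1}" for u t
  proof -
    have "scale_n n t u \<in> ?K"
      using t coord[OF u] by (auto simp: cube_n_def scale_n_def zero_n_def abs_mult mult_le_one Rn_iff)
    moreover have "scale_n n t u \<in> hyperplane n u t"
      using u by (simp add: hyperplane_def sphere_n_def flip: norm_n_power2)
    ultimately show ?thesis using u by (auto simp: hitting_iff hyperplane_in)
  qed
  have "ennreal c0 * (ennreal (1 / r) * emeasure (sphereM n) (space (sphereM n))) =
     ennreal c0 * (\<integral>\<^sup>+u. ennreal (1 / r) \<partial>sphereM n)" by (simp add: mult.commute)
  also have "\<dots> \<le> emeasure \<Theta> ?hit"
    unfolding emeasure_Theta[OF hitting_in_sets[OF K]]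
  proof (intro mult_left_mono nn_integral_mono)
    fix u assume "u \<in> space (sphereM n)"
    then have u: "u \<in> sphere_n n" by simp
    have "ennreal (1 / r) = (\<integral>\<^sup>+t. ennreal (t powr (r - 1)) * indicator {0..1} t \<partial>lborel)"
      using nn_integral_powr_from_0[OF r, of 1] by simp
    also have "\<dots> \<le> (\<integral>\<^sup>+t. indicator ?hit (hyperplane n u t) * ennreal (\<bar>t\<bar> powr (r - 1)) \<partial>lborel)"
      using hit[OF u] by (intro nn_integral_mono) (auto simp: indicator_def)
    finally show "ennreal (1 / r) \<le> (\<integral>\<^sup>+t. indicator ?hit (hyperplane n u t) * ennreal (\<bar>t\<bar> powr (r - 1)) \<partial>lborel)" .
  qed simp
  also have "\<dots> < \<infinity>" by (rule emeasure_hitting_finite[OF K])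
  finally show "emeasure (sphereM n) (space (sphereM n)) \<noteq> \<infinity>"
    using c0_pos r by (auto simp: ennreal_mult_eq_top_iff less_top[symmetric])
qed

definition baseM :: "((nat \<Rightarrow> real) \<times> real) measure" where
  "baseM = sphereM n \<Otimes>\<^sub>M lborel"

text \<open>Separation as a function on pairs (u, t), so that intersections of separating sets
  become products of integrands.\<close>

definition sepi :: "(nat \<Rightarrow> real) \<Rightarrow> (nat \<Rightarrow> real) \<times> real \<Rightarrow> ennreal" where
  "sepi x p = indicator {p. separates n x (fst p) (snd p)} p"

lemma sigma_finite_baseM: "sigma_finite_measure baseM"
  unfolding baseM_def using finite_measure_sphereM
  by (intro sigma_finite_pair_measure) (auto simp: finite_measure.axioms lborel.sigma_finite_measure_axioms)

lemma measurable_sepi [measurable (raw)]: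
  assumes [measurable]: "f \<in> N \<rightarrow>\<^sub>M volM n" "g \<in> N \<rightarrow>\<^sub>M baseM"
  shows "(\<lambda>x. sepi (f x) (g x)) \<in> borel_measurable N"
proof -
  have g1: "(\<lambda>x. fst (g x)) \<in> N \<rightarrow>\<^sub>M volM n"
    by (rule measurable_compose[OF assms(2)[unfolded baseM_def] measurable_compose[OF measurable_fst measurable_sphereM_volM]])
  have [measurable]: "(\<lambda>x. inner_n n (f x) (fst (g x))) \<in> borel_measurable N"
    using assms(1) g1 by (rule measurable_inner_n)
  have [measurable]: "(\<lambda>x. snd (g x)) \<in> borel_measurable N"
    using measurable_compose[OF assms(2)[unfolded baseM_def] measurable_snd] by simp
  have "(\<lambda>x. if 0 < snd (g x) \<and> snd (g x) < inner_n n (f x) (fst (g x)) \<or> snd (g x) < 0 \<and> inner_n n (f x) (fst (g x)) < snd (g x)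
     then 1 else 0 :: ennreal) \<in> borel_measurable N" by measurable
  then show ?thesis by (simp add: sepi_def separates_def indicator_def of_bool_def)
qed

lemma measurable_snd_baseM [measurable]: "snd \<in> baseM \<rightarrow>\<^sub>M borel"
  unfolding baseM_def by measurable

lemma emeasure_sepset_Int:
  assumes x: "x \<in> Rn n" and y: "y \<in> Rn n"
  shows "emeasure \<Theta> (sepset n x \<inter> sepset n y) =
    ennreal c0 * (\<integral>\<^sup>+p. ennreal (\<bar>snd p\<bar> powr (r - 1)) * (sepi x p * sepi y p) \<partial>baseM)"
proof -
  have [measurable]: "(\<lambda>_. x) \<in> baseM \<rightarrow>\<^sub>M volM n" "(\<lambda>_. y) \<in> baseM \<rightarrow>\<^sub>M volM n" using x y by auto
  have "(\<integral>\<^sup>+p. ennreal (\<bar>snd p\<bar> powr (r - 1)) * (sepi x p * sepi y p) \<partial>baseM) =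
    (\<integral>\<^sup>+u. \<integral>\<^sup>+t. ennreal (\<bar>snd (u, t)\<bar> powr (r - 1)) * (sepi x (u, t) * sepi y (u, t)) \<partial>lborel \<partial>sphereM n)"
    unfolding baseM_def
    by (rule lborel.nn_integral_fst[symmetric]) (unfold baseM_def[symmetric], measurable)
  also have "\<dots> = (\<integral>\<^sup>+u. \<integral>\<^sup>+t. indicator (sepset n x \<inter> sepset n y) (hyperplane n u t) * ennreal (\<bar>t\<bar> powr (r - 1)) \<partial>lborel \<partial>sphereM n)"
    using sepset_iff x y by (intro nn_integral_cong) (auto simp: sepi_def indicator_def)
  finally show ?thesis unfolding emeasure_Theta[OF sepset_Int_sets[OF x y]] by simp
qed

text \<open>A countable description of the complement of the cell. If a hyperplane separates x
  strictly, it also separates a whole small cube around some q in T near x and misses that cube.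
  Conversely, a hyperplane that separates q and misses the cube leaves the entire cube, hence x, on
  the side of q.\<close>

lemma Z_complement_cover:
  assumes \<omega>: "\<omega> \<in> space P" and x: "x \<in> Rn n"
    and T: "\<And>W. open W \<Longrightarrow> W \<inter> Rn n \<noteq> {} \<Longrightarrow> W \<inter> T \<noteq> {}" "T \<subseteq> Rn n"
  shows "x \<notin> Z \<omega> \<longleftrightarrow> (\<exists>q\<in>T. \<exists>l::nat. x \<in> cube_n n q (1 / Suc l) \<and>
            num_points (X \<omega>) (sepset n q - hitting n (cube_n n q (1 / Suc l))) \<noteq> 0)"
proof
  assume "x \<notin> Z \<omega>"
  then obtain H where H: "H \<in> X \<omega>" "H \<in> sepset n x"
    using Z_iff[OF \<omega> x] by (auto simp: num_points_eq_0_iff)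
  then obtain u t where u: "u \<in> sphere_n n" and Hu: "H = hyperplane n u t"
    by (auto simp: sepset_def hyperplanes_def)
  have sep: "separates n x u t" using H(2) sepset_iff[OF u x] Hu by simp
  define \<eta> where "\<eta> = \<bar>inner_n n x u - t\<bar>"
  have \<eta>: "\<eta> > 0" using sep by (auto simp: \<eta>_def separates_def)
  have coord: "\<bar>u i\<bar> \<le> 1" if "i < n" for i
    using that u member_le_L2_set[of "{..<n}" i "\<lambda>i. \<bar>u i\<bar>"] by (simp add: sphere_n_def L2_set_def)
  have near: "\<bar>inner_n n y u - inner_n n x u\<bar> \<le> real n * d" if "\<And>i. i < n \<Longrightarrow> \<bar>y i - x i\<bar> \<le> d" for y d
  proof -
    have "inner_n n y u - inner_n n x u = (\<Sum>i<n. (y i - x i) * u i)"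
      by (simp add: inner_n_def sum_subtractf algebra_simps)
    also have "\<bar>\<dots>\<bar> \<le> (\<Sum>i<n. \<bar>(y i - x i) * u i\<bar>)" by (rule sum_abs)
    also have "\<dots> \<le> (\<Sum>i<n. d * 1)"
      unfolding abs_mult using that coord
      by (intro sum_mono mult_mono) (auto intro: order_trans[OF abs_ge_zero])
    finally show ?thesis by simp
  qed
  \<comment> \<open>The coordinates of u are at most 1 in absolute value, so a shift by d in every
    coordinate changes the inner product by at most n d. Two shifts by 1 / Suc l, from x to q and
    from q to y, stay below eta.\<close>
  obtain l :: nat where l: "1 / Suc l < \<eta> / (2 * n)"
    using reals_Archimedean[of "\<eta> / (2 * n)"] \<eta> n by (auto simp: inverse_eq_divide)
  have small: "real n * (2 / Suc l) < \<eta>" using l n by (simp add: field_simps)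
  let ?W = "\<Inter>i<n. {y. \<bar>y i - x i\<bar> < 1 / Suc l}"
  have "open ?W" by (intro open_INT ballI open_Collect_less continuous_intros) auto
  moreover have "x \<in> ?W \<inter> Rn n" using x by simp
  ultimately obtain q where q: "q \<in> T" "q \<in> ?W" using T(1)[of ?W] by blast
  have qR: "q \<in> Rn n" using q(1) T(2) by blast
  have xq: "x \<in> cube_n n q (1 / Suc l)" using q(2) x by (auto simp: cube_n_def abs_minus_commute less_imp_le)
  have same: "separates n y u t" if y: "y \<in> cube_n n q (1 / Suc l)" for y
  proof -
    have "\<bar>y i - x i\<bar> \<le> 2 / Suc l" if "i < n" for i
    proof -
      have "\<bar>y i - q i\<bar> \<le> 1 / Suc l" "\<bar>q i - x i\<bar> < 1 / Suc l"
        using that q(2) y by (auto simp: cube_n_def)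
      then have "\<bar>y i - x i\<bar> \<le> 1 / Suc l + 1 / Suc l" by linarith
      then show ?thesis by simp
    qed
    from near[OF this] small have "\<bar>inner_n n y u - inner_n n x u\<bar> < \<eta>" by linarith
    then show ?thesis using sep unfolding \<eta>_def separates_def by linarith
  qed
  have qq: "q \<in> cube_n n q (1 / Suc l)" using qR by (simp add: cube_n_def)
  have "H \<in> sepset n q" using same[OF qq] sepset_iff[OF u qR] Hu by simp
  moreover have "H \<notin> hitting n (cube_n n q (1 / Suc l))"
    using same by (force simp: hitting_iff Hu hyperplane_def separates_def)
  ultimately show "\<exists>q\<in>T. \<exists>l::nat. x \<in> cube_n n q (1 / Suc l) \<and>
            num_points (X \<omega>) (sepset n q - hitting n (cube_n n q (1 / Suc l))) \<noteq> 0"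
    using q(1) xq H(1) unfolding num_points_eq_0_iff by blast
next
  assume "\<exists>q\<in>T. \<exists>l::nat. x \<in> cube_n n q (1 / Suc l) \<and>
            num_points (X \<omega>) (sepset n q - hitting n (cube_n n q (1 / Suc l))) \<noteq> 0"
  then obtain q l H where q: "q \<in> T" "x \<in> cube_n n q (1 / Suc l)" and H: "H \<in> X \<omega>" "H \<in> sepset n q"
    "H \<notin> hitting n (cube_n n q (1 / Suc l))" unfolding num_points_eq_0_iff by blast
  have qR: "q \<in> Rn n" using q(1) T(2) by blast
  obtain u t where u: "u \<in> sphere_n n" and Hu: "H = hyperplane n u t"
    using H(2) by (auto simp: sepset_def hyperplanes_def)
  have sep: "separates n q u t" using H(2) sepset_iff[OF u qR] Hu by simp
  have "separates n x u t"
  proof (rule ccontr)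
    assume nsep: "\<not> separates n x u t"
    let ?a = "inner_n n x u" and ?b = "inner_n n q u"
    \<comment> \<open>The parameter at which the segment from x to q would cross the hyperplane; the
      crossing point lies in the cube, which the hyperplane misses.\<close>
    define s where "s = (t - ?a) / (?b - ?a)"
    have s: "0 \<le> s" "s \<le> 1" "?a + s * (?b - ?a) = t"
      using sep nsep by (auto simp: s_def separates_def divide_simps)
    define y where "y = (\<lambda>i\<in>{..<n}. x i + s * (q i - x i))"
    have "inner_n n y u = (\<Sum>i<n. (x i + s * (q i - x i)) * u i)"
      unfolding inner_n_def by (intro sum.cong) (auto simp: y_def)
    also have "\<dots> = ?a + s * (?b - ?a)"
      by (simp add: inner_n_def algebra_simps sum.distrib sum_subtractf sum_distrib_left)
    finally have "inner_n n y u = t" using s by simp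
    moreover have "y \<in> cube_n n q (1 / Suc l)"
    proof -
      have "\<bar>y i - q i\<bar> \<le> 1 / Suc l" if "i < n" for i
      proof -
        have "y i - q i = (1 - s) * (x i - q i)" using that by (simp add: y_def algebra_simps)
        then have "\<bar>y i - q i\<bar> = (1 - s) * \<bar>x i - q i\<bar>" using s by (simp add: abs_mult)
        also have "\<dots> \<le> 1 * \<bar>x i - q i\<bar>" using s by (intro mult_right_mono) auto
        also have "\<dots> \<le> 1 / Suc l" using q(2) that by (simp add: cube_n_def)
        finally show ?thesis .
      qed
      then show ?thesis by (simp add: cube_n_def Rn_iff y_def)
    qed
    ultimately have "y \<in> H" "y \<in> cube_n n q (1 / Suc l)"
      by (auto simp: Hu hyperplane_def cube_n_def)
    then have "H \<in> hitting n (cube_n n q (1 / Suc l))"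
      using hyperplane_in[OF u] by (auto simp: hitting_iff Hu)
    then show False using H(3) by simp
  qed
  then have "H \<in> sepset n x" using sepset_iff[OF u x] Hu by simp
  then show "x \<notin> Z \<omega>" using H(1) Z_iff[OF \<omega> x] by (auto simp: num_points_eq_0_iff)
qed

text \<open>By \<open>Z_complement_cover\<close> the complement is a countable union of rectangles.
  Joint measurability is what exchanging expectation and volume relies on.\<close>

lemma measurable_Z: "{z \<in> space (P \<Otimes>\<^sub>M volM n). snd z \<in> Z (fst z)} \<in> sets (P \<Otimes>\<^sub>M volM n)"
proof -
  obtain T where T: "countable T" "T \<subseteq> Rn n" "\<And>W. open W \<Longrightarrow> W \<inter> Rn n \<noteq> {} \<Longrightarrow> W \<inter> T \<noteq> {}"
    using countable_dense_subset by blast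
  let ?A = "\<lambda>q l. sepset n q - hitting n (cube_n n q (1 / Suc l))"
  have cube_sets: "cube_n n q d \<in> sets (volM n)" for q d
  proof -
    have "{y \<in> space (volM n). \<bar>y i - q i\<bar> \<le> d} \<in> sets (volM n)" if "i < n" for i
      using measurable_volM_component[OF measurable_ident_sets[OF refl] that]
      by (intro borel_measurable_le borel_measurable_abs borel_measurable_diff borel_measurable_const)
    then have "{y \<in> space (volM n). \<forall>i\<in>{..<n}. \<bar>y i - q i\<bar> \<le> d} \<in> sets (volM n)"
      by (intro sets.sets_Collect_finite_All finite_lessThan) (simp only: lessThan_iff)
    moreover have "cube_n n q d = {y \<in> space (volM n). \<forall>i\<in>{..<n}. \<bar>y i - q i\<bar> \<le> d}"
      unfolding cube_n_def space_volM by blast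
    ultimately show ?thesis by (simp only:)
  qed
  have A: "?A q l \<in> hyperplane_sets n" if "q \<in> T" for q l
  proof -
    have "q \<in> Rn n" using that T(2) by blast
    then show ?thesis
      using sets.Diff[of "sepset n q" "hyperplaneM n"] sepset_sets hitting_in_sets[OF cube_subset compact_cube]
      by simp
  qed
  have "{z \<in> space (P \<Otimes>\<^sub>M volM n). snd z \<in> Z (fst z)} = space (P \<Otimes>\<^sub>M volM n) -
     (\<Union>q\<in>T. \<Union>l. {\<omega> \<in> space P. num_points (X \<omega>) (?A q l) \<noteq> 0} \<times> cube_n n q (1 / Suc l))"
  proof (intro set_eqI)
    fix z
    show "z \<in> {z \<in> space (P \<Otimes>\<^sub>M volM n). snd z \<in> Z (fst z)} \<longleftrightarrow> z \<in> space (P \<Otimes>\<^sub>M volM n) -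
     (\<Union>q\<in>T. \<Union>l. {\<omega> \<in> space P. num_points (X \<omega>) (?A q l) \<noteq> 0} \<times> cube_n n q (1 / Suc l))"
    proof (cases "z \<in> space (P \<Otimes>\<^sub>M volM n)")
      case True
      then have z: "fst z \<in> space P" "snd z \<in> Rn n" by (auto simp: space_pair_measure)
      have "z \<in> (\<Union>q\<in>T. \<Union>l. {\<omega> \<in> space P. num_points (X \<omega>) (?A q l) \<noteq> 0} \<times> cube_n n q (1 / Suc l)) \<longleftrightarrow>
         (\<exists>q\<in>T. \<exists>l::nat. snd z \<in> cube_n n q (1 / Suc l) \<and> num_points (X (fst z)) (?A q l) \<noteq> 0)"
        using z(1) by (simp only: UN_iff mem_Times_iff mem_Collect_eq) blast
      then show ?thesis
        using True Z_complement_cover[OF z T(3) T(2)] by blast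
    qed blast
  qed
  also have "\<dots> \<in> sets (P \<Otimes>\<^sub>M volM n)"
  proof (intro sets.Diff sets.top sets.countable_UN'' T(1) sets.countable_UN' pair_measureI cube_sets)
    fix q l assume "q \<in> T"
    note [measurable] = num_points_measurable[OF A[OF this, of l]]
    show "{\<omega> \<in> space P. num_points (X \<omega>) (?A q l) \<noteq> 0} \<in> sets P" by measurable
  qed auto
  finally show ?thesis .
qed

end

text \<open>Interpreted twice: with m = n - 1 and an orthonormal basis of the given hyperplane, and
  with m = n and the standard basis, which makes the volume of the cell itself a section
  volume.\<close>

locale hyperplane_section = hyperplane_process n r \<gamma> P X
  for n :: nat and r \<gamma> :: real and P :: "'w measure" and X :: "'w \<Rightarrow> (nat \<Rightarrow> real) set set" +
  fixes m :: nat and v :: "nat \<Rightarrow> nat \<Rightarrow> real"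
  assumes m: "2 \<le> m" and r2: "2 < r"
    and v_Rn: "\<And>j. j < m \<Longrightarrow> v j \<in> Rn n"
    and orthonormal: "\<And>i j. i < m \<Longrightarrow> j < m \<Longrightarrow> inner_n n (v i) (v j) = (if i = j then 1 else 0)"
begin

abbreviation L :: "(nat \<Rightarrow> real) \<Rightarrow> nat \<Rightarrow> real" where
  "L \<equiv> lincomb_n n m v"

abbreviation V :: "(nat \<Rightarrow> real) measure" where
  "V \<equiv> volM m"

text \<open>Coordinates of the orthogonal projection of u onto the section space. Within these
  coordinates a hyperplane with normal u has this vector as normal, which in general is no longer a
  unit vector.\<close>

definition proj :: "(nat \<Rightarrow> real) \<Rightarrow> nat \<Rightarrow> real" where
  "proj u = (\<lambda>j\<in>{..<m}. inner_n n (v j) u)"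

lemma inner_L: "inner_n n (L c) u = inner_n m c (proj u)"
proof -
  have "inner_n n (L c) u = (\<Sum>i<n. \<Sum>j<m. c j * (v j i * u i))"
    unfolding inner_n_def by (intro sum.cong) (auto simp: lincomb_n_def sum_distrib_right mult.assoc)
  also have "\<dots> = (\<Sum>j<m. \<Sum>i<n. c j * (v j i * u i))" by (rule sum.swap)
  also have "\<dots> = inner_n m c (proj u)"
    unfolding inner_n_def[of m] by (intro sum.cong) (auto simp: proj_def inner_n_def sum_distrib_left)
  finally show ?thesis .
qed

lemma norm_L: "norm_n n (L c) = norm_n m c"
proof -
  have "proj (L c) j = c j" if "j < m" for j
  proof -
    have "inner_n n (v j) (L c) = inner_n m c (proj (v j))" by (simp add: inner_n_commute[of n "v j"] inner_L)
    also have "\<dots> = (\<Sum>l<m. if l = j then c l else 0)"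
      unfolding inner_n_def[of m] using that by (intro sum.cong) (auto simp: proj_def orthonormal)
    finally show ?thesis using that by (simp add: proj_def)
  qed
  then have "inner_n m c (proj (L c)) = inner_n m c c" by (simp add: inner_n_def)
  then show ?thesis by (simp add: norm_n_sqrt inner_L)
qed

lemma measurable_L [measurable]: "L \<in> V \<rightarrow>\<^sub>M volM n"
proof -
  have "(\<lambda>c. \<Sum>j<m. c j * v j i) \<in> borel_measurable V" for i
    by (intro borel_measurable_sum borel_measurable_times[OF measurable_volM_component[OF measurable_ident_sets[OF refl]] borel_measurable_const]) auto
  then show ?thesis unfolding lincomb_n_def volM_def[of n] by (intro measurable_restrict) simp
qed

interpretation V: sigma_finite_measure V by (rule sigma_finite_volM)
interpretation VV: pair_sigma_finite V V ..
interpretation PV: pair_sigma_finite P V ..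
interpretation PVV: pair_sigma_finite P "V \<Otimes>\<^sub>M V" ..
interpretation B: sigma_finite_measure baseM by (rule sigma_finite_baseM)
interpretation VB: pair_sigma_finite V baseM ..
interpretation VVB: pair_sigma_finite "V \<Otimes>\<^sub>M V" baseM ..
interpretation VVl: pair_sigma_finite "V \<Otimes>\<^sub>M V" "lborel :: real measure" ..
interpretation Vl: pair_sigma_finite V "lborel :: real measure" ..

definition section_vol :: "'w \<Rightarrow> ennreal" where
  "section_vol \<omega> = emeasure V {c \<in> Rn m. L c \<in> Z \<omega>}"

definition inZ :: "'w \<Rightarrow> (nat \<Rightarrow> real) \<Rightarrow> ennreal" where
  "inZ \<omega> c = indicator {c. L c \<in> Z \<omega>} c"

lemma measurable_inZ: "(\<lambda>z. inZ (fst z) (snd z)) \<in> borel_measurable (P \<Otimes>\<^sub>M V)"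
proof -
  have mm: "(\<lambda>z. (fst z, L (snd z))) \<in> P \<Otimes>\<^sub>M V \<rightarrow>\<^sub>M P \<Otimes>\<^sub>M volM n" by measurable
  have "(\<lambda>z. indicator {z \<in> space (P \<Otimes>\<^sub>M volM n). snd z \<in> Z (fst z)} (fst z, L (snd z)) :: ennreal) \<in> borel_measurable (P \<Otimes>\<^sub>M V)"
    using measurable_Z by (intro measurable_compose[OF mm] borel_measurable_indicator)
  then show ?thesis
    by (rule measurable_cong[THEN iffD1, rotated]) (auto simp: inZ_def indicator_def space_pair_measure)
qed

lemma measurable_inZ' [measurable (raw)]:
  assumes "f \<in> N \<rightarrow>\<^sub>M P" "g \<in> N \<rightarrow>\<^sub>M V"
  shows "(\<lambda>x. inZ (f x) (g x)) \<in> borel_measurable N"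
  using measurable_compose[OF measurable_Pair[OF assms] measurable_inZ] by simp

lemma section_set_measurable:
  assumes \<omega>: "\<omega> \<in> space P"
  shows "{c \<in> Rn m. L c \<in> Z \<omega>} \<in> sets V"
proof -
  have "(\<lambda>c. inZ \<omega> c) \<in> borel_measurable V" using \<omega> by (intro measurable_inZ') auto
  then have "(\<lambda>c. inZ \<omega> c) -` {1} \<inter> space V \<in> sets V" by (rule measurable_sets) simp
  also have "(\<lambda>c. inZ \<omega> c) -` {1} \<inter> space V = {c \<in> Rn m. L c \<in> Z \<omega>}"
    by (auto simp: inZ_def indicator_def split: if_splits)
  finally show ?thesis .
qed

lemma section_vol_integral:
  assumes \<omega>: "\<omega> \<in> space P"
  shows "section_vol \<omega> = (\<integral>\<^sup>+c. inZ \<omega> c \<partial>V)"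
proof -
  have "section_vol \<omega> = (\<integral>\<^sup>+c. indicator {c \<in> Rn m. L c \<in> Z \<omega>} c \<partial>V)"
    using section_set_measurable[OF \<omega>] by (simp add: section_vol_def)
  also have "\<dots> = (\<integral>\<^sup>+c. inZ \<omega> c \<partial>V)"
    by (intro nn_integral_cong) (auto simp: inZ_def indicator_def)
  finally show ?thesis .
qed

lemma measurable_section_vol [measurable]: "section_vol \<in> borel_measurable P"
proof -
  have "(\<lambda>\<omega>. \<integral>\<^sup>+c. inZ \<omega> c \<partial>V) \<in> borel_measurable P"
    by measurable
  then show ?thesis by (rule measurable_cong[THEN iffD1, rotated]) (simp add: section_vol_integral)
qed

definition mean :: real where
  "mean = kappa (real m) * k powr (- real m / r) * Gamma (real m / r + 1)"

abbreviation relvar :: real where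
  "relvar \<equiv> rel_var m r"

lemma mean_pos: "0 < mean"
  using k_pos r m by (auto simp: mean_def intro!: mult_pos_pos kappa_pos Gamma_real_pos add_nonneg_pos)

abbreviation dens :: "real \<Rightarrow> ennreal" where
  "dens R \<equiv> ennreal (k * r * R powr (r - 1) * exp (- k * R powr r))"

lemma AE_pair_norm_pos: "AE z in V \<Otimes>\<^sub>M V. 0 < norm_n m (fst z)"
proof -
  have "AE z in V \<Otimes>\<^sub>M V. (\<lambda>z. 0 < norm_n m (fst z)) z"
    by (rule VV.AE_pair_measure) (use AE_norm_n_pos[of m] m in auto)
  then show ?thesis .
qed

lemma nn_integral_dens_moment:
  assumes "q \<ge> 0" "a \<ge> 0"
  shows "(\<integral>\<^sup>+R. dens R * ennreal (a * R powr q) * indicator {0<..} R \<partial>lborel)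
    = ennreal (a * (k powr (- q / r) * Gamma (q / r + 1)))"
proof -
  have "(\<integral>\<^sup>+R. dens R * ennreal (a * R powr q) * indicator {0<..} R \<partial>lborel) =
    (\<integral>\<^sup>+R. ennreal a * (ennreal (k * r * R powr (r - 1) * exp (- k * R powr r) * R powr q) * indicator {0<..} R) \<partial>lborel)"
    using k_pos r assms by (intro nn_integral_cong) (simp add: ennreal_mult' ennreal_mult'' mult_ac)
  also have "\<dots> = ennreal a * ennreal (k powr (- q / r) * Gamma (q / r + 1))"
    unfolding nn_integral_weibull_moment[OF k_pos r assms(1), symmetric] by (rule nn_integral_cmult) measurable
  finally show ?thesis using assms by (simp add: ennreal_mult')
qed

lemma nn_integral_exp_norm:
  "(\<integral>\<^sup>+c. ennreal (exp (- k * norm_n m c powr r)) \<partial>V) = ennreal mean"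
proof -
  have "(\<integral>\<^sup>+c. ennreal (exp (- k * norm_n m c powr r)) \<partial>V) =
    (\<integral>\<^sup>+c. \<integral>\<^sup>+R. dens R * (if norm_n m c \<le> R \<and> 0 < R then 1 else 0) \<partial>lborel \<partial>V)"
  proof (rule nn_integral_cong_AE)
    show "AE c in V. ennreal (exp (- k * norm_n m c powr r)) = (\<integral>\<^sup>+R. dens R * (if norm_n m c \<le> R \<and> 0 < R then 1 else 0) \<partial>lborel)"
      using AE_norm_n_pos[OF order_trans[OF one_le_numeral m]]
    proof eventually_elim
      case (elim c)
      then show ?case unfolding weibull_layer_cake[OF k_pos r elim, symmetric]
        by (intro nn_integral_cong) (auto simp: indicator_def)
    qed
  qed
  also have "\<dots> = (\<integral>\<^sup>+R. \<integral>\<^sup>+c. dens R * (if norm_n m c \<le> R \<and> 0 < R then 1 else 0) \<partial>V \<partial>lborel)"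
    by (rule Vl.Fubini'[symmetric]) measurable
  also have "\<dots> = (\<integral>\<^sup>+R. dens R * ennreal (kappa (real m) * R powr real m) * indicator {0<..} R \<partial>lborel)"
  proof (rule nn_integral_cong)
    fix R :: real
    show "(\<integral>\<^sup>+c. dens R * (if norm_n m c \<le> R \<and> 0 < R then 1 else 0) \<partial>V) = dens R * ennreal (kappa (real m) * R powr real m) * indicator {0<..} R"
    proof (cases "R > 0")
      case True
      have [measurable]: "{c \<in> Rn m. norm_n m c \<le> R} \<in> sets V"
      proof -
        have "{c \<in> space V. norm_n m c \<le> R} \<in> sets V" by measurable
        then show ?thesis by simp
      qed
      have "(\<integral>\<^sup>+c. dens R * (if norm_n m c \<le> R \<and> 0 < R then 1 else 0) \<partial>V) = (\<integral>\<^sup>+c. dens R * indicator {c \<in> Rn m. norm_n m c \<le> R} c \<partial>V)"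
        using True by (intro nn_integral_cong) (auto simp: indicator_def)
      also have "\<dots> = dens R * emeasure V {c \<in> Rn m. norm_n m c \<le> R}"
        by (subst nn_integral_cmult) auto
      finally show ?thesis using True m by (simp add: emeasure_ball_n powr_realpow)
    qed auto
  qed
  also have "\<dots> = ennreal mean"
    using m by (subst nn_integral_dens_moment) (auto simp: mean_def mult_ac kappa_pos less_imp_le)
  finally show ?thesis .
qed

lemma nn_integral_section_vol: "(\<integral>\<^sup>+\<omega>. section_vol \<omega> \<partial>P) = ennreal mean"
proof -
  have "(\<integral>\<^sup>+\<omega>. section_vol \<omega> \<partial>P) = (\<integral>\<^sup>+\<omega>. \<integral>\<^sup>+c. inZ \<omega> c \<partial>V \<partial>P)"
    by (intro nn_integral_cong) (simp add: section_vol_integral)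
  also have "\<dots> = (\<integral>\<^sup>+c. \<integral>\<^sup>+\<omega>. inZ \<omega> c \<partial>P \<partial>V)"
    by (rule PV.Fubini'[symmetric]) measurable
  also have "\<dots> = (\<integral>\<^sup>+c. ennreal (exp (- k * norm_n m c powr r)) \<partial>V)"
  proof (rule nn_integral_cong)
    fix c assume c: "c \<in> space V"
    have "(\<lambda>\<omega>. inZ \<omega> c) \<in> borel_measurable P" using c by (intro measurable_inZ') auto
    then have "(\<lambda>\<omega>. inZ \<omega> c) -` {1} \<inter> space P \<in> sets P" by (rule measurable_sets) simp
    also have "(\<lambda>\<omega>. inZ \<omega> c) -` {1} \<inter> space P = {\<omega> \<in> space P. L c \<in> Z \<omega>}"
      by (auto simp: inZ_def indicator_def split: if_splits)
    finally have "(\<integral>\<^sup>+\<omega>. indicator {\<omega> \<in> space P. L c \<in> Z \<omega>} \<omega> \<partial>P) = emeasure P {\<omega> \<in> space P. L c \<in> Z \<omega>}" by simp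
    also have "\<dots> = ennreal (exp (- k * norm_n m c powr r))"
      by (simp add: emeasure_eq_measure prob_in_Z norm_L)
    also have "(\<integral>\<^sup>+\<omega>. indicator {\<omega> \<in> space P. L c \<in> Z \<omega>} \<omega> \<partial>P) = (\<integral>\<^sup>+\<omega>. inZ \<omega> c \<partial>P)"
      by (intro nn_integral_cong) (auto simp: inZ_def indicator_def)
    finally show "(\<integral>\<^sup>+\<omega>. inZ \<omega> c \<partial>P) = ennreal (exp (- k * norm_n m c powr r))" .
  qed
  finally show ?thesis unfolding nn_integral_exp_norm .
qed

text \<open>The overlap again, as an integral over \<open>baseM\<close>: in this form it is
  measurable jointly in both points and open to Tonelli.\<close>

definition ovl :: "(nat \<Rightarrow> real) \<Rightarrow> (nat \<Rightarrow> real) \<Rightarrow> ennreal" where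
  "ovl c d = ennreal c0 * (\<integral>\<^sup>+p. ennreal (\<bar>snd p\<bar> powr (r - 1)) * (sepi (L c) p * sepi (L d) p) \<partial>baseM)"

lemma measurable_ovl: "(\<lambda>z. ovl (fst z) (snd z)) \<in> borel_measurable (V \<Otimes>\<^sub>M V)"
  unfolding ovl_def by measurable

lemma ovl_eq: "ovl c d = ennreal (overlap (L c) (L d))"
  by (simp add: ovl_def emeasure_sepset_Int emeasure_overlap[symmetric])

definition ballsep :: "real \<Rightarrow> (nat \<Rightarrow> real) \<Rightarrow> (nat \<Rightarrow> real) \<times> real \<Rightarrow> ennreal" where
  "ballsep R c p = (if norm_n m c \<le> R then 1 else 0) * sepi (L c) p"

lemma measurable_ballsep [measurable (raw)]:
  assumes [measurable]: "f \<in> N \<rightarrow>\<^sub>M V" "g \<in> N \<rightarrow>\<^sub>M baseM"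
  shows "(\<lambda>x. ballsep R (f x) (g x)) \<in> borel_measurable N"
  unfolding ballsep_def by measurable

lemma nn_integral_ballsep:
  assumes "p \<in> space baseM"
  shows "(\<integral>\<^sup>+c. ballsep R c p \<partial>V) = cap_vol m R (proj (fst p)) (snd p)"
proof -
  have proj: "proj (fst p) \<in> Rn m" by (simp add: proj_def Rn_iff)
  have "(\<integral>\<^sup>+c. ballsep R c p \<partial>V) = (\<integral>\<^sup>+c. indicator {c \<in> Rn m. norm_n m c \<le> R \<and> separates m c (proj (fst p)) (snd p)} c \<partial>V)"
    by (intro nn_integral_cong) (auto simp: ballsep_def sepi_def indicator_def separates_def inner_L)
  then show ?thesis unfolding cap_vol_def using cap_set_measurable[OF proj] by simp
qed

text \<open>For a fixed hyperplane both points range over the same cap, so the integral over pairs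
  is a squared cap volume. \<open>cap_vol_moments\<close> trades the square for the first power
  times a multiple of the ball volume, and the first power integrates back to the intensities k
  |c|^r <= k R^r over the ball.\<close>

lemma nn_integral_overlap_ball:
  assumes R: "R > 0"
  shows "(\<integral>\<^sup>+z. ovl (fst z) (snd z) * (if norm_n m (fst z) \<le> R \<and> norm_n m (snd z) \<le> R then 1 else 0) \<partial>(V \<Otimes>\<^sub>M V))
     \<le> ennreal ((kappa (real m))\<^sup>2 * cap_ratio m r * k * R powr (2 * real m + r))"
proof -
  let ?w = "\<lambda>p :: (nat \<Rightarrow> real) \<times> real. ennreal (\<bar>snd p\<bar> powr (r - 1))"
  let ?A = "\<lambda>p. cap_vol m R (proj (fst p)) (snd p)"
  have km: "kappa (real m) > 0" by (simp add: kappa_pos)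
  have cr: "cap_ratio m r > 0" using r2 m by (intro cap_ratio_pos) auto
  have mA [measurable]: "?A \<in> borel_measurable baseM"
  proof -
    have "(\<lambda>p. \<integral>\<^sup>+c. ballsep R c p \<partial>V) \<in> borel_measurable baseM" by measurable
    then show ?thesis by (rule measurable_cong[THEN iffD1, rotated]) (simp add: nn_integral_ballsep)
  qed
  have "(\<integral>\<^sup>+z. ovl (fst z) (snd z) * (if norm_n m (fst z) \<le> R \<and> norm_n m (snd z) \<le> R then 1 else 0) \<partial>(V \<Otimes>\<^sub>M V)) =
     (\<integral>\<^sup>+z. ennreal c0 * (\<integral>\<^sup>+p. ?w p * (ballsep R (fst z) p * ballsep R (snd z) p) \<partial>baseM) \<partial>(V \<Otimes>\<^sub>M V))"
    by (intro nn_integral_cong) (auto simp: ovl_def ballsep_def)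
  also have "\<dots> = ennreal c0 * (\<integral>\<^sup>+z. (\<integral>\<^sup>+p. ?w p * (ballsep R (fst z) p * ballsep R (snd z) p) \<partial>baseM) \<partial>(V \<Otimes>\<^sub>M V))"
    by (rule nn_integral_cmult) measurable
  also have "(\<integral>\<^sup>+z. (\<integral>\<^sup>+p. ?w p * (ballsep R (fst z) p * ballsep R (snd z) p) \<partial>baseM) \<partial>(V \<Otimes>\<^sub>M V)) =
     (\<integral>\<^sup>+p. (\<integral>\<^sup>+z. ?w p * (ballsep R (fst z) p * ballsep R (snd z) p) \<partial>(V \<Otimes>\<^sub>M V)) \<partial>baseM)"
    by (rule VVB.Fubini'[symmetric]) measurable
  also have "\<dots> = (\<integral>\<^sup>+p. ?w p * (?A p)\<^sup>2 \<partial>baseM)"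
  proof (rule nn_integral_cong)
    fix p assume p: "p \<in> space baseM"
    have [measurable]: "(\<lambda>c. ballsep R c p) \<in> borel_measurable V" using p by (intro measurable_ballsep) auto
    have "(\<integral>\<^sup>+z. ?w p * (ballsep R (fst z) p * ballsep R (snd z) p) \<partial>(V \<Otimes>\<^sub>M V)) = ?w p * (\<integral>\<^sup>+z. ballsep R (fst z) p * ballsep R (snd z) p \<partial>(V \<Otimes>\<^sub>M V))"
      by (rule nn_integral_cmult) measurable
    also have "(\<integral>\<^sup>+z. ballsep R (fst z) p * ballsep R (snd z) p \<partial>(V \<Otimes>\<^sub>M V)) = (\<integral>\<^sup>+c. ballsep R c p \<partial>V)\<^sup>2"
      by (rule nn_integral_pair_square[OF sigma_finite_volM]) measurable
    finally show "(\<integral>\<^sup>+z. ?w p * (ballsep R (fst z) p * ballsep R (snd z) p) \<partial>(V \<Otimes>\<^sub>M V)) = ?w p * (?A p)\<^sup>2"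
      by (simp add: nn_integral_ballsep[OF p])
  qed
  finally have eq1: "(\<integral>\<^sup>+z. ovl (fst z) (snd z) * (if norm_n m (fst z) \<le> R \<and> norm_n m (snd z) \<le> R then 1 else 0) \<partial>(V \<Otimes>\<^sub>M V)) =
      ennreal c0 * (\<integral>\<^sup>+p. ?w p * (?A p)\<^sup>2 \<partial>baseM)" .
  have "(\<integral>\<^sup>+p. ?w p * (?A p)\<^sup>2 \<partial>baseM) = (\<integral>\<^sup>+u. \<integral>\<^sup>+t. ?w (u, t) * (?A (u, t))\<^sup>2 \<partial>lborel \<partial>sphereM n)"
    unfolding baseM_def by (rule lborel.nn_integral_fst[symmetric]) (unfold baseM_def[symmetric], measurable)
  also have "\<dots> \<le> (\<integral>\<^sup>+u. ennreal (kappa (real m) * R ^ m * cap_ratio m r) * (\<integral>\<^sup>+t. ?w (u, t) * ?A (u, t) \<partial>lborel) \<partial>sphereM n)"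
    using cap_vol_moments[OF r2 m R] by (intro nn_integral_mono) (simp add: proj_def Rn_iff)
  also have "\<dots> = ennreal (kappa (real m) * R ^ m * cap_ratio m r) * (\<integral>\<^sup>+u. (\<integral>\<^sup>+t. ?w (u, t) * ?A (u, t) \<partial>lborel) \<partial>sphereM n)"
  proof (rule nn_integral_cmult)
    have "(\<lambda>p. ?w p * ?A p) \<in> borel_measurable (sphereM n \<Otimes>\<^sub>M lborel)" unfolding baseM_def[symmetric] by measurable
    then show "(\<lambda>u. \<integral>\<^sup>+t. ?w (u, t) * ?A (u, t) \<partial>lborel) \<in> borel_measurable (sphereM n)"
      by (rule lborel.borel_measurable_nn_integral_fst)
  qed
  finally have le2: "(\<integral>\<^sup>+p. ?w p * (?A p)\<^sup>2 \<partial>baseM) \<le> ennreal (kappa (real m) * R ^ m * cap_ratio m r) *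
      (\<integral>\<^sup>+u. (\<integral>\<^sup>+t. ?w (u, t) * ?A (u, t) \<partial>lborel) \<partial>sphereM n)" .
  have "(\<integral>\<^sup>+u. (\<integral>\<^sup>+t. ?w (u, t) * ?A (u, t) \<partial>lborel) \<partial>sphereM n) = (\<integral>\<^sup>+p. ?w p * ?A p \<partial>baseM)"
    unfolding baseM_def by (rule lborel.nn_integral_fst) (unfold baseM_def[symmetric], measurable)
  also have "\<dots> = (\<integral>\<^sup>+p. \<integral>\<^sup>+c. ?w p * ballsep R c p \<partial>V \<partial>baseM)"
  proof (rule nn_integral_cong)
    fix p assume p: "p \<in> space baseM"
    have [measurable]: "(\<lambda>c. ballsep R c p) \<in> borel_measurable V" using p by (intro measurable_ballsep) auto
    show "?w p * ?A p = (\<integral>\<^sup>+c. ?w p * ballsep R c p \<partial>V)"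
      unfolding nn_integral_ballsep[OF p, symmetric] by (rule nn_integral_cmult[symmetric]) measurable
  qed
  also have "\<dots> = (\<integral>\<^sup>+c. \<integral>\<^sup>+p. ?w p * ballsep R c p \<partial>baseM \<partial>V)"
    by (rule VB.Fubini') measurable
  finally have eq3: "(\<integral>\<^sup>+u. (\<integral>\<^sup>+t. ?w (u, t) * ?A (u, t) \<partial>lborel) \<partial>sphereM n) = (\<integral>\<^sup>+c. \<integral>\<^sup>+p. ?w p * ballsep R c p \<partial>baseM \<partial>V)" .
  have 1: "(\<integral>\<^sup>+z. ovl (fst z) (snd z) * (if norm_n m (fst z) \<le> R \<and> norm_n m (snd z) \<le> R then 1 else 0) \<partial>(V \<Otimes>\<^sub>M V))
    \<le> ennreal c0 * (ennreal (kappa (real m) * R ^ m * cap_ratio m r) * (\<integral>\<^sup>+c. \<integral>\<^sup>+p. ?w p * ballsep R c p \<partial>baseM \<partial>V))"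
    unfolding eq1 by (rule mult_left_mono[OF le2[unfolded eq3]]) simp
  have "ennreal c0 * (\<integral>\<^sup>+c. \<integral>\<^sup>+p. ?w p * ballsep R c p \<partial>baseM \<partial>V) = (\<integral>\<^sup>+c. ennreal c0 * (\<integral>\<^sup>+p. ?w p * ballsep R c p \<partial>baseM) \<partial>V)"
    by (rule nn_integral_cmult[symmetric]) measurable
  also have "\<dots> \<le> (\<integral>\<^sup>+c. ennreal (k * R powr r) * indicator {c \<in> Rn m. norm_n m c \<le> R} c \<partial>V)"
  proof (rule nn_integral_mono)
    fix c assume c: "c \<in> space V"
    show "ennreal c0 * (\<integral>\<^sup>+p. ?w p * ballsep R c p \<partial>baseM) \<le> ennreal (k * R powr r) * indicator {c \<in> Rn m. norm_n m c \<le> R} c"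
    proof (cases "norm_n m c \<le> R")
      case True
      have "ennreal c0 * (\<integral>\<^sup>+p. ?w p * ballsep R c p \<partial>baseM) = emeasure \<Theta> (sepset n (L c) \<inter> sepset n (L c))"
        unfolding emeasure_sepset_Int[OF lincomb_n_in_Rn lincomb_n_in_Rn] using True
        by (intro arg_cong[where f="\<lambda>z. ennreal c0 * z"] nn_integral_cong) (simp add: ballsep_def sepi_def indicator_def)
      also have "\<dots> = ennreal (k * norm_n m c powr r)" by (simp add: emeasure_sepset_eq norm_L)
      also have "\<dots> \<le> ennreal (k * R powr r)"
        using True r k_pos by (intro ennreal_leI mult_left_mono powr_mono2) (auto simp: L2_set_nonneg)
      finally show ?thesis using True c by simp
    qed (simp add: ballsep_def)
  qed
  also have "\<dots> = ennreal (k * R powr r) * emeasure V {c \<in> Rn m. norm_n m c \<le> R}"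
  proof -
    have "{c \<in> space V. norm_n m c \<le> R} \<in> sets V" by measurable
    then show ?thesis by (subst nn_integral_cmult) auto
  qed
  also have "\<dots> = ennreal (k * R powr r * (kappa (real m) * R ^ m))"
    using R m k_pos by (simp add: emeasure_ball_n ennreal_mult')
  finally have 2: "ennreal c0 * (\<integral>\<^sup>+c. \<integral>\<^sup>+p. ?w p * ballsep R c p \<partial>baseM \<partial>V) \<le> ennreal (k * R powr r * (kappa (real m) * R ^ m))" .
  have "ennreal c0 * (ennreal (kappa (real m) * R ^ m * cap_ratio m r) * (\<integral>\<^sup>+c. \<integral>\<^sup>+p. ?w p * ballsep R c p \<partial>baseM \<partial>V))
    = ennreal (kappa (real m) * R ^ m * cap_ratio m r) * (ennreal c0 * (\<integral>\<^sup>+c. \<integral>\<^sup>+p. ?w p * ballsep R c p \<partial>baseM \<partial>V))"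
    by (rule mult.left_commute)
  also have "\<dots> \<le> ennreal (kappa (real m) * R ^ m * cap_ratio m r) * ennreal (k * R powr r * (kappa (real m) * R ^ m))"
    using 2 by (rule mult_left_mono) simp
  also have "\<dots> = ennreal (kappa (real m) * R ^ m * cap_ratio m r * (k * R powr r * (kappa (real m) * R ^ m)))"
    using km cr R by (simp add: ennreal_mult')
  also have "kappa (real m) * R ^ m * cap_ratio m r * (k * R powr r * (kappa (real m) * R ^ m)) =
     (kappa (real m))\<^sup>2 * cap_ratio m r * k * R powr (2 * real m + r)"
  proof -
    have "R powr (2 * real m + r) = R ^ m * R ^ m * R powr r"
      unfolding powr_realpow[OF R, symmetric] mult_2 powr_add ..
    then show ?thesis by (simp add: power2_eq_square mult_ac)
  qed
  finally show ?thesis using 1 by (rule order_trans[rotated])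
qed

text \<open>The excess over independence is weighted by an average over R of the indicator that both
  points lie in the ball of radius R. Its inner integral is at most a multiple of R^(2 m + r), and
  the Weibull moment of that order produces Gamma (2 m / r + 2) together with the power of
  \<open>k\<close> that occurs in the squared mean.\<close>

lemma nn_integral_section_vol_square:
  "(\<integral>\<^sup>+\<omega>. (section_vol \<omega>)\<^sup>2 \<partial>P) \<le> ennreal (mean\<^sup>2 * (1 + relvar))"
proof -
  note [measurable] = measurable_ovl
  let ?e = "\<lambda>c. ennreal (exp (- k * norm_n m c powr r))"
  let ?M = "\<lambda>z. max (norm_n m (fst z)) (norm_n m (snd z))"
  let ?I = "\<lambda>z R. if norm_n m (fst z) \<le> R \<and> norm_n m (snd z) \<le> R then 1 else 0 :: ennreal"
  have km: "kappa (real m) > 0" by (simp add: kappa_pos)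
  have cr: "cap_ratio m r > 0" using r2 m by (intro cap_ratio_pos) auto
  have "(\<integral>\<^sup>+\<omega>. (section_vol \<omega>)\<^sup>2 \<partial>P) = (\<integral>\<^sup>+\<omega>. \<integral>\<^sup>+z. inZ \<omega> (fst z) * inZ \<omega> (snd z) \<partial>(V \<Otimes>\<^sub>M V) \<partial>P)"
  proof (rule nn_integral_cong)
    fix \<omega> assume \<omega>: "\<omega> \<in> space P"
    have "(\<lambda>c. inZ \<omega> c) \<in> borel_measurable V" using \<omega> by (intro measurable_inZ') auto
    then show "(section_vol \<omega>)\<^sup>2 = (\<integral>\<^sup>+z. inZ \<omega> (fst z) * inZ \<omega> (snd z) \<partial>(V \<Otimes>\<^sub>M V))"
      using nn_integral_pair_square[OF sigma_finite_volM, of "inZ \<omega>" m] by (simp add: section_vol_integral[OF \<omega>])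
  qed
  also have "\<dots> = (\<integral>\<^sup>+z. \<integral>\<^sup>+\<omega>. inZ \<omega> (fst z) * inZ \<omega> (snd z) \<partial>P \<partial>(V \<Otimes>\<^sub>M V))"
    by (rule PVV.Fubini'[symmetric]) measurable
  also have "\<dots> \<le> (\<integral>\<^sup>+z. ?e (fst z) * ?e (snd z) + ovl (fst z) (snd z) * ennreal (exp (- k * ?M z powr r)) \<partial>(V \<Otimes>\<^sub>M V))"
  proof (rule nn_integral_mono)
    fix z assume z: "z \<in> space (V \<Otimes>\<^sub>M V)"
    let ?c = "fst z" and ?d = "snd z"
    let ?S = "{\<omega> \<in> space P. L ?c \<in> Z \<omega> \<and> L ?d \<in> Z \<omega>}"
    have cd: "?c \<in> space V" "?d \<in> space V" using z by (auto simp: space_pair_measure)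
    have "(\<lambda>\<omega>. inZ \<omega> ?c * inZ \<omega> ?d) \<in> borel_measurable P"
      using cd by (intro borel_measurable_times_ennreal measurable_inZ') auto
    then have "(\<lambda>\<omega>. inZ \<omega> ?c * inZ \<omega> ?d) -` {1} \<inter> space P \<in> sets P" by (rule measurable_sets) simp
    also have "(\<lambda>\<omega>. inZ \<omega> ?c * inZ \<omega> ?d) -` {1} \<inter> space P = ?S"
      by (auto simp: inZ_def indicator_def of_bool_def split: if_splits)
    finally have "(\<integral>\<^sup>+\<omega>. indicator ?S \<omega> \<partial>P) = ennreal (measure P ?S)" by (simp add: emeasure_eq_measure)
    moreover have "(\<integral>\<^sup>+\<omega>. inZ \<omega> ?c * inZ \<omega> ?d \<partial>P) = (\<integral>\<^sup>+\<omega>. indicator ?S \<omega> \<partial>P)"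
      by (intro nn_integral_cong) (auto simp: inZ_def indicator_def)
    moreover have "ennreal (measure P ?S) \<le> ennreal (exp (- k * norm_n n (L ?c) powr r) * exp (- k * norm_n n (L ?d) powr r)
     + overlap (L ?c) (L ?d) * exp (- k * (max (norm_n n (L ?c)) (norm_n n (L ?d))) powr r))"
      by (intro ennreal_leI prob_both_in_Z) auto
    moreover have "0 \<le> overlap (L ?c) (L ?d)" by (simp add: overlap_def)
    ultimately show "(\<integral>\<^sup>+\<omega>. inZ \<omega> ?c * inZ \<omega> ?d \<partial>P) \<le> ?e ?c * ?e ?d + ovl ?c ?d * ennreal (exp (- k * ?M z powr r))"
      by (simp add: norm_L ovl_eq ennreal_mult)
  qed
  also have "\<dots> = (\<integral>\<^sup>+z. ?e (fst z) * ?e (snd z) \<partial>(V \<Otimes>\<^sub>M V)) + (\<integral>\<^sup>+z. ovl (fst z) (snd z) * ennreal (exp (- k * ?M z powr r)) \<partial>(V \<Otimes>\<^sub>M V))"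
    by (rule nn_integral_add) measurable
  finally have split: "(\<integral>\<^sup>+\<omega>. (section_vol \<omega>)\<^sup>2 \<partial>P) \<le> (\<integral>\<^sup>+z. ?e (fst z) * ?e (snd z) \<partial>(V \<Otimes>\<^sub>M V)) +
      (\<integral>\<^sup>+z. ovl (fst z) (snd z) * ennreal (exp (- k * ?M z powr r)) \<partial>(V \<Otimes>\<^sub>M V))" .
  have first: "(\<integral>\<^sup>+z. ?e (fst z) * ?e (snd z) \<partial>(V \<Otimes>\<^sub>M V)) = (ennreal mean)\<^sup>2"
    unfolding nn_integral_exp_norm[symmetric] by (rule nn_integral_pair_square[OF sigma_finite_volM]) measurable
  have "(\<integral>\<^sup>+z. ovl (fst z) (snd z) * ennreal (exp (- k * ?M z powr r)) \<partial>(V \<Otimes>\<^sub>M V)) =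
     (\<integral>\<^sup>+z. \<integral>\<^sup>+R. (dens R * indicator {0<..} R) * (ovl (fst z) (snd z) * ?I z R) \<partial>lborel \<partial>(V \<Otimes>\<^sub>M V))"
  proof (rule nn_integral_cong_AE)
    show "AE z in V \<Otimes>\<^sub>M V. ovl (fst z) (snd z) * ennreal (exp (- k * ?M z powr r)) =
        (\<integral>\<^sup>+R. (dens R * indicator {0<..} R) * (ovl (fst z) (snd z) * ?I z R) \<partial>lborel)"
      using AE_pair_norm_pos
    proof eventually_elim
      case (elim z)
      then have M: "?M z > 0" by simp
      have "ovl (fst z) (snd z) * ennreal (exp (- k * ?M z powr r)) = (\<integral>\<^sup>+R. ovl (fst z) (snd z) * (dens R * indicator {?M z..} R) \<partial>lborel)"
        unfolding weibull_layer_cake[OF k_pos r M, symmetric] by (rule nn_integral_cmult[symmetric]) measurable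
      also have "\<dots> = (\<integral>\<^sup>+R. (dens R * indicator {0<..} R) * (ovl (fst z) (snd z) * ?I z R) \<partial>lborel)"
        using M by (intro nn_integral_cong) (auto simp: indicator_def mult_ac)
      finally show ?case .
    qed
  qed
  also have "\<dots> = (\<integral>\<^sup>+R. \<integral>\<^sup>+z. (dens R * indicator {0<..} R) * (ovl (fst z) (snd z) * ?I z R) \<partial>(V \<Otimes>\<^sub>M V) \<partial>lborel)"
    by (rule VVl.Fubini'[symmetric]) measurable
  also have "\<dots> \<le> (\<integral>\<^sup>+R. dens R * ennreal (((kappa (real m))\<^sup>2 * cap_ratio m r * k) * R powr (2 * real m + r)) * indicator {0<..} R \<partial>lborel)"
  proof (rule nn_integral_mono)
    fix R :: real
    show "(\<integral>\<^sup>+z. (dens R * indicator {0<..} R) * (ovl (fst z) (snd z) * ?I z R) \<partial>(V \<Otimes>\<^sub>M V)) \<le>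
      dens R * ennreal (((kappa (real m))\<^sup>2 * cap_ratio m r * k) * R powr (2 * real m + r)) * indicator {0<..} R"
    proof (cases "R > 0")
      case True
      have "(\<integral>\<^sup>+z. (dens R * indicator {0<..} R) * (ovl (fst z) (snd z) * ?I z R) \<partial>(V \<Otimes>\<^sub>M V)) =
        (dens R * indicator {0<..} R) * (\<integral>\<^sup>+z. ovl (fst z) (snd z) * ?I z R \<partial>(V \<Otimes>\<^sub>M V))"
        by (rule nn_integral_cmult) measurable
      also have "\<dots> \<le> (dens R * indicator {0<..} R) * ennreal (((kappa (real m))\<^sup>2 * cap_ratio m r * k) * R powr (2 * real m + r))"
        using nn_integral_overlap_ball[OF True] by (rule mult_left_mono) simp
      finally show ?thesis using True by simp
    qed simp
  qed
  also have "\<dots> = ennreal (((kappa (real m))\<^sup>2 * cap_ratio m r * k) * (k powr (- (2 * real m + r) / r) * Gamma ((2 * real m + r) / r + 1)))"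
    using km cr k_pos r by (intro nn_integral_dens_moment) auto
  also have "((kappa (real m))\<^sup>2 * cap_ratio m r * k) * (k powr (- (2 * real m + r) / r) * Gamma ((2 * real m + r) / r + 1)) = mean\<^sup>2 * relvar"
  proof -
    have e: "- (2 * real m + r) / r = - real m / r + - real m / r + -1" "(2 * real m + r) / r + 1 = 2 * real m / r + 2"
      using r by (simp_all add: field_simps)
    have "k * k powr (- (2 * real m + r) / r) = (k powr (- real m / r))\<^sup>2"
      unfolding e(1) powr_add using k_pos by (simp add: powr_minus power2_eq_square)
    moreover have "Gamma (real m / r + 1) > 0" using r m by (intro Gamma_real_pos add_nonneg_pos) auto
    ultimately show ?thesis unfolding e(2) mean_def rel_var_def by (simp add: power_mult_distrib field_simps)
  qed
  finally have second: "(\<integral>\<^sup>+z. ovl (fst z) (snd z) * ennreal (exp (- k * ?M z powr r)) \<partial>(V \<Otimes>\<^sub>M V)) \<le> ennreal (mean\<^sup>2 * relvar)" .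
  have "(\<integral>\<^sup>+\<omega>. (section_vol \<omega>)\<^sup>2 \<partial>P) \<le> (ennreal mean)\<^sup>2 + ennreal (mean\<^sup>2 * relvar)"
    using split unfolding first by (rule order_trans) (rule add_left_mono[OF second])
  also have "\<dots> = ennreal (mean\<^sup>2 * (1 + relvar))"
  proof -
    have "relvar \<ge> 0" unfolding rel_var_def using cr r m
      by (intro divide_nonneg_nonneg mult_nonneg_nonneg) (auto intro!: less_imp_le Gamma_real_pos add_nonneg_pos)
    then show ?thesis using mean_pos by (simp add: ennreal_power distrib_left flip: ennreal_plus)
  qed
  finally show ?thesis .
qed

end

section \<open>Concentration of the normalized section volume\<close>

lemma lincomb_n_eq_iff:
  "lincomb_n n m v c = lincomb_n n k w d \<longleftrightarrow> (\<forall>i<n. (\<Sum>j<m. c j * v j i) = (\<Sum>j<k. d j * w j i))"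
  by (auto simp: lincomb_n_def fun_eq_iff restrict_def)

lemma inner_lincomb_n_orthonormal:
  assumes "\<And>i j. i < m \<Longrightarrow> j < m \<Longrightarrow> inner_n n (w i) (w j) = (if i = j then 1 else 0)" "l < m"
  shows "inner_n n (lincomb_n n m w c) (w l) = c l"
proof -
  have "inner_n n (lincomb_n n m w c) (w l) = (\<Sum>i<n. \<Sum>j<m. c j * (w j i * w l i))"
    unfolding inner_n_def by (intro sum.cong) (auto simp: lincomb_n_def sum_distrib_right mult.assoc)
  also have "\<dots> = (\<Sum>j<m. \<Sum>i<n. c j * (w j i * w l i))" by (rule sum.swap)
  also have "\<dots> = (\<Sum>j<m. c j * inner_n n (w j) (w l))"
    by (simp add: inner_n_def sum_distrib_left)
  also have "\<dots> = (\<Sum>j<m. if j = l then c j else 0)"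
    using assms by (intro sum.cong) auto
  finally show ?thesis using assms(2) by simp
qed

text \<open>Gram-Schmidt by induction on the dimension. \<open>subspace_vol\<close> picks its basis
  by \<open>SOME\<close>, and existence is what gives this choice the orthonormality used
  later.\<close>

lemma orthonormal_basis_exists:
  "is_basis n m v L \<Longrightarrow> \<exists>w. is_orthonormal_basis n m w L"
proof (induction m arbitrary: L)
  case 0
  then show ?case by (auto simp: is_orthonormal_basis_def)
next
  case (Suc m)
  have v: "\<And>j. j < Suc m \<Longrightarrow> v j \<in> Rn n"
    and indep: "\<And>c. lincomb_n n (Suc m) v c = zero_n n \<Longrightarrow> \<forall>j<Suc m. c j = 0"
    and L: "L = range (lincomb_n n (Suc m) v)"
    using Suc.prems by (auto simp: is_basis_def)
  have "is_basis n m v (range (lincomb_n n m v))"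
    unfolding is_basis_def
  proof (intro conjI allI impI)
    fix c j assume c: "lincomb_n n m v c = zero_n n" and j: "j < m"
    have "lincomb_n n (Suc m) v (c(m := 0)) = lincomb_n n m v c"
      by (simp add: lincomb_n_eq_iff)
    from indep[OF this[unfolded c]] show "c j = 0" using j by (metis fun_upd_other less_SucI nat_neq_iff)
  qed (use v in auto)
  from Suc.IH[OF this] obtain w where w: "is_orthonormal_basis n m w (range (lincomb_n n m v))" by blast
  have wR: "\<And>j. j < m \<Longrightarrow> w j \<in> Rn n" and wL: "range (lincomb_n n m v) = range (lincomb_n n m w)"
    and wo: "\<And>i j. i < m \<Longrightarrow> j < m \<Longrightarrow> inner_n n (w i) (w j) = (if i = j then 1 else 0)"
    using w by (auto simp: is_orthonormal_basis_def is_basis_def)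
  have vw: "\<exists>d. \<forall>i<n. (\<Sum>j<m. c j * v j i) = (\<Sum>j<m. d j * w j i)" for c
  proof -
    have "lincomb_n n m v c \<in> range (lincomb_n n m w)" using wL by blast
    then obtain d where "lincomb_n n m v c = lincomb_n n m w d" by blast
    then show ?thesis unfolding lincomb_n_eq_iff by blast
  qed
  have wv: "\<exists>d. \<forall>i<n. (\<Sum>j<m. c j * w j i) = (\<Sum>j<m. d j * v j i)" for c
  proof -
    have "lincomb_n n m w c \<in> range (lincomb_n n m v)" using wL by blast
    then obtain d where "lincomb_n n m w c = lincomb_n n m v d" by blast
    then show ?thesis unfolding lincomb_n_eq_iff by blast
  qed
  define a where "a j = inner_n n (v m) (w j)" for j
  define u where "u = (\<lambda>i\<in>{..<n}. v m i - (\<Sum>j<m. a j * w j i))"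
  have uR: "u \<in> Rn n" by (simp add: u_def Rn_iff)
  have u_i: "u i = v m i - (\<Sum>j<m. a j * w j i)" if "i < n" for i using that by (simp add: u_def)
  have u_orth: "inner_n n u (w l) = 0" if "l < m" for l
  proof -
    have "inner_n n u (w l) = inner_n n (v m) (w l) - inner_n n (lincomb_n n m w a) (w l)"
      unfolding inner_n_def sum_subtractf[symmetric]
      by (intro sum.cong) (auto simp: u_def lincomb_n_def left_diff_distrib)
    then show ?thesis using inner_lincomb_n_orthonormal[OF wo that] by (simp add: a_def)
  qed
  define \<rho> where "\<rho> = norm_n n u"
  have \<rho>: "\<rho> > 0"
  proof (rule ccontr)
    assume "\<not> \<rho> > 0"
    then have "\<rho> = 0" using L2_set_nonneg[of u "{..<n}"] by (simp add: \<rho>_def)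
    then have u0: "u i = 0" if "i < n" for i using that by (simp add: \<rho>_def L2_set_eq_0_iff)
    obtain d where d: "\<forall>i<n. (\<Sum>j<m. a j * w j i) = (\<Sum>j<m. d j * v j i)" using wv by blast
    \<comment> \<open>Without a residual, \<open>v m\<close> is a combination of the earlier
      vectors; moving it to the other side gives it the coefficient - 1, against
      independence.\<close>
    have "lincomb_n n (Suc m) v (d(m := - 1)) = zero_n n"
    proof
      fix i show "lincomb_n n (Suc m) v (d(m := - 1)) i = zero_n n i"
        using d u0[of i] u_i[of i] by (auto simp: lincomb_n_def zero_n_def)
    qed
    from indep[OF this] show False by (metis fun_upd_same lessI zero_neq_neg_one)
  qed
  define w' where "w' = w(m := scale_n n (1 / \<rho>) u)"
  have w'j: "w' j = w j" if "j < m" for j using that by (simp add: w'_def)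
  have w'm: "w' m i = u i / \<rho>" if "i < n" for i using that by (simp add: w'_def scale_n_def)
  have sum_w': "(\<Sum>j<Suc m. c j * w' j i) = (\<Sum>j<m. c j * w j i) + c m / \<rho> * u i" if "i < n" for c i
    using that by (simp add: w'm) (simp add: w'j)
  have uu: "inner_n n u u = \<rho>\<^sup>2" by (simp add: \<rho>_def norm_n_power2)
  have orth': "inner_n n (w' i) (w' j) = (if i = j then 1 else 0)" if "i < Suc m" "j < Suc m" for i j
  proof -
    consider "i < m" "j < m" | "i = m" "j = m" | "i = m" "j < m" | "i < m" "j = m" using \<open>i < Suc m\<close> \<open>j < Suc m\<close> by linarith
    then show ?thesis
    proof cases
      case 2
      then show ?thesis using \<rho> uu by (simp add: w'_def power2_eq_square)
    qed (auto simp: w'_def wo u_orth inner_n_commute[of n _ u])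
  qed
  have "is_basis n (Suc m) w' L"
    unfolding is_basis_def
  proof (intro conjI allI impI)
    fix j assume "j < Suc m" then show "w' j \<in> Rn n" using wR by (auto simp: w'_def less_Suc_eq)
  next
    fix c j assume c: "lincomb_n n (Suc m) w' c = zero_n n" and j: "j < Suc m"
    show "c j = 0" using inner_lincomb_n_orthonormal[OF orth' j, of c] c by simp
  next
    show "L = range (lincomb_n n (Suc m) w')"
      unfolding L
    proof (intro equalityI subsetI; clarify)
      fix c
      obtain d where d: "\<forall>i<n. (\<Sum>j<m. c j * v j i) = (\<Sum>j<m. d j * w j i)" using vw by blast
      define e where "e j = (if j < m then d j + c m * a j else c m * \<rho>)" for j
      have em: "e m / \<rho> = c m" using \<rho> by (simp add: e_def)
      have "lincomb_n n (Suc m) v c = lincomb_n n (Suc m) w' e"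
        unfolding lincomb_n_eq_iff
      proof (intro allI impI)
        fix i assume i: "i < n"
        have "(\<Sum>j<Suc m. c j * v j i) = (\<Sum>j<m. d j * w j i) + c m * v m i" using d i by simp
        also have "v m i = u i + (\<Sum>j<m. a j * w j i)" unfolding u_i[OF i] by linarith
        also have "(\<Sum>j<m. d j * w j i) + c m * (u i + (\<Sum>j<m. a j * w j i)) =
            (\<Sum>j<m. d j * w j i) + (\<Sum>j<m. c m * (a j * w j i)) + c m * u i"
          unfolding distrib_left sum_distrib_left by linarith
        also have "(\<Sum>j<m. d j * w j i) + (\<Sum>j<m. c m * (a j * w j i)) = (\<Sum>j<m. (d j + c m * a j) * w j i)"
          unfolding sum.distrib[symmetric] distrib_right mult.assoc ..
        also have "(\<Sum>j<m. (d j + c m * a j) * w j i) = (\<Sum>j<m. e j * w j i)"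
          by (intro sum.cong) (auto simp: e_def)
        also have "(\<Sum>j<m. e j * w j i) + c m * u i = (\<Sum>j<Suc m. e j * w' j i)"
          unfolding sum_w'[OF i] em ..
        finally show "(\<Sum>j<Suc m. c j * v j i) = (\<Sum>j<Suc m. e j * w' j i)" .
      qed
      then show "lincomb_n n (Suc m) v c \<in> range (lincomb_n n (Suc m) w')" by blast
    next
      fix c
      define t where "t = c m / \<rho>"
      obtain d where d: "\<forall>i<n. (\<Sum>j<m. (c j - t * a j) * w j i) = (\<Sum>j<m. d j * v j i)" using wv[of "\<lambda>j. c j - t * a j"] by (elim exE)
      have "lincomb_n n (Suc m) w' c = lincomb_n n (Suc m) v (d(m := t))"
        unfolding lincomb_n_eq_iff
      proof (intro allI impI)
        fix i assume i: "i < n"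
        have "(\<Sum>j<Suc m. c j * w' j i) = (\<Sum>j<m. c j * w j i) + t * (v m i - (\<Sum>j<m. a j * w j i))"
          unfolding sum_w'[OF i] t_def u_i[OF i] ..
        also have "\<dots> = (\<Sum>j<m. c j * w j i) - (\<Sum>j<m. t * (a j * w j i)) + t * v m i"
          unfolding right_diff_distrib sum_distrib_left by linarith
        also have "(\<Sum>j<m. c j * w j i) - (\<Sum>j<m. t * (a j * w j i)) = (\<Sum>j<m. (c j - t * a j) * w j i)"
          unfolding sum_subtractf[symmetric] left_diff_distrib mult.assoc ..
        also have "(\<Sum>j<m. (c j - t * a j) * w j i) = (\<Sum>j<m. d j * v j i)" using d i by blast
        also have "(\<Sum>j<m. d j * v j i) + t * v m i = (\<Sum>j<Suc m. (d(m := t)) j * v j i)" by simp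
        finally show "(\<Sum>j<Suc m. c j * w' j i) = (\<Sum>j<Suc m. (d(m := t)) j * v j i)" .
      qed
      then show "lincomb_n n (Suc m) w' c \<in> range (lincomb_n n (Suc m) v)" by blast
    qed
  qed
  then have "is_orthonormal_basis n (Suc m) w' L" using orth' by (simp add: is_orthonormal_basis_def)
  then show ?case by blast
qed

lemma gamma_hat_pos: "0 < r \<Longrightarrow> 1 \<le> n \<Longrightarrow> 0 < gamma_hat r n"
proof -
  assume "0 < r" "1 \<le> n"
  moreover from this have "0 < Gamma (real n / r + 1) * kappa (real n)"
    by (intro mult_pos_pos Gamma_real_pos kappa_pos add_nonneg_pos) auto
  ultimately show ?thesis
    unfolding gamma_hat_def by (intro mult_pos_pos divide_pos_pos omega_pos powr_gt_zero[THEN iffD2]) auto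
qed

context hyperplane_section begin

lemma AE_section_vol_finite: "AE \<omega> in P. ennreal (enn2real (section_vol \<omega>)) = section_vol \<omega>"
proof -
  have "AE \<omega> in P. section_vol \<omega> \<noteq> \<infinity>"
    by (rule nn_integral_noteq_infinite) (simp_all add: nn_integral_section_vol)
  then show ?thesis by eventually_elim (simp add: less_top)
qed

lemma section_vol_concentration:
  assumes \<delta>: "\<delta> > 0"
  shows "measure P {\<omega> \<in> space P. \<bar>enn2real (section_vol \<omega>) - mean\<bar> \<ge> \<delta> * mean} \<le> relvar / \<delta>\<^sup>2"
proof -
  let ?W = "\<lambda>\<omega>. enn2real (section_vol \<omega>)"
  have W [measurable]: "?W \<in> borel_measurable P" by measurable
  have "(\<integral>\<^sup>+\<omega>. ennreal (?W \<omega>) \<partial>P) = ennreal mean"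
    unfolding nn_integral_section_vol[symmetric] by (intro nn_integral_cong_AE AE_section_vol_finite)
  then have mean: "expectation ?W = mean"
    using mean_pos by (intro integral_eq_nn_integral[THEN trans]) auto
  have sq: "(\<integral>\<^sup>+\<omega>. ennreal ((?W \<omega>)\<^sup>2) \<partial>P) \<le> ennreal (mean\<^sup>2 * (1 + relvar))"
  proof -
    have "(\<integral>\<^sup>+\<omega>. ennreal ((?W \<omega>)\<^sup>2) \<partial>P) = (\<integral>\<^sup>+\<omega>. (section_vol \<omega>)\<^sup>2 \<partial>P)"
    proof (rule nn_integral_cong_AE)
      show "AE \<omega> in P. ennreal ((?W \<omega>)\<^sup>2) = (section_vol \<omega>)\<^sup>2"
        using AE_section_vol_finite by eventually_elim (metis ennreal_power enn2real_nonneg)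
    qed
    then show ?thesis using nn_integral_section_vol_square by simp
  qed
  have relvar: "relvar \<ge> 0"
  proof -
    have "cap_ratio m r > 0" using r2 m by (intro cap_ratio_pos) auto
    then show ?thesis unfolding rel_var_def using r m
      by (intro divide_nonneg_nonneg mult_nonneg_nonneg) (auto intro!: less_imp_le Gamma_real_pos add_nonneg_pos)
  qed
  have int: "integrable P (\<lambda>\<omega>. (?W \<omega>)\<^sup>2)"
    by (rule integrableI_nonneg) (use sq in \<open>auto intro: le_less_trans\<close>)
  have "expectation (\<lambda>\<omega>. (?W \<omega>)\<^sup>2) \<le> mean\<^sup>2 * (1 + relvar)"
    using sq relvar by (simp add: integral_eq_nn_integral enn2real_leI)
  moreover have "integrable P ?W" by (rule square_integrable_imp_integrable[OF W int])
  ultimately have var: "variance ?W \<le> mean\<^sup>2 * relvar"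
    using variance_eq[OF _ int] by (simp add: mean algebra_simps)
  have "measure P {\<omega> \<in> space P. \<bar>?W \<omega> - mean\<bar> \<ge> \<delta> * mean} \<le> variance ?W / (\<delta> * mean)\<^sup>2"
    using Chebyshev_inequality[OF W int, of "\<delta> * mean"] \<delta> mean_pos by (simp add: mean)
  also have "\<dots> \<le> mean\<^sup>2 * relvar / (\<delta> * mean)\<^sup>2" using var by (intro divide_right_mono) auto
  also have "\<dots> = relvar / \<delta>\<^sup>2" using mean_pos by (simp add: power_mult_distrib)
  finally show ?thesis .
qed

text \<open>The case l = 0 occurs for cells whose \<open>vol\<close> is 0, since the normalising
  factor \<open>0 powr (- 1 / real n)\<close> is 0. The scaled section then lies in the origin, a
  null set.\<close>

lemma measure_scaled_section:
  assumes l: "l \<ge> 0" and \<omega>: "\<omega> \<in> space P"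
  shows "measure V {c \<in> Rn m. L c \<in> scale_n n l ` Z \<omega> \<inter> range L} = l ^ m * enn2real (section_vol \<omega>)"
proof (cases "l = 0")
  case True
  have "{c \<in> Rn m. L c \<in> scale_n n l ` Z \<omega> \<inter> range L} \<subseteq> {c \<in> space V. \<not> 0 < norm_n m c}"
  proof clarsimp
    fix c z assume "L c = scale_n n l z" "0 < norm_n m c"
    then have "norm_n m c = 0" using norm_L[of c] True by simp
    then show False using \<open>0 < norm_n m c\<close> by simp
  qed
  moreover have null: "{c \<in> space V. \<not> 0 < norm_n m c} \<in> sets V" by measurable
  ultimately have "emeasure V {c \<in> Rn m. L c \<in> scale_n n l ` Z \<omega> \<inter> range L} \<le> emeasure V {c \<in> space V. \<not> 0 < norm_n m c}"
    by (rule emeasure_mono)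
  also have "\<dots> = 0" using AE_norm_n_pos[of m] m AE_iff_measurable[OF null refl] by simp
  finally show ?thesis using True m by (simp add: measure_def)
next
  case False
  then have l: "l > 0" using l by simp
  let ?A = "{c \<in> Rn m. L c \<in> Z \<omega>}"
  have A: "?A \<in> sets V" by (rule section_set_measurable[OF \<omega>])
  have L_scale: "L (scale_n m a c) = scale_n n a (L c)" for a c
    by (auto simp: lincomb_n_def scale_n_def sum_distrib_left mult.assoc)
  have ZR: "Z \<omega> \<subseteq> Rn n" by (auto simp: Z_def zero_cell_def)
  have inv: "scale_n n a (scale_n n (1 / a) x) = x" if "a \<noteq> 0" "x \<in> Rn n" for a x
    using that by (intro Rn_eqI[of _ n] scale_n_in_Rn) (auto simp: scale_n_def)
  have "{c \<in> Rn m. L c \<in> scale_n n l ` Z \<omega> \<inter> range L} = scale_n m (1 / l) -` ?A \<inter> space V"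
  proof (intro set_eqI iffI)
    fix c assume "c \<in> {c \<in> Rn m. L c \<in> scale_n n l ` Z \<omega> \<inter> range L}"
    then obtain z where c: "c \<in> Rn m" and z: "z \<in> Z \<omega>" "L c = scale_n n l z" by auto
    have "L (scale_n m (1 / l) c) = scale_n n (1 / l) (scale_n n (1 / (1 / l)) z)" using z by (simp add: L_scale)
    also have "\<dots> = z" using l z ZR by (intro inv) auto
    finally show "c \<in> scale_n m (1 / l) -` ?A \<inter> space V" using z c by simp
  next
    fix c assume c: "c \<in> scale_n m (1 / l) -` ?A \<inter> space V"
    then have "L c = scale_n n l (L (scale_n m (1 / l) c))" using l inv[of l "L c"] by (simp add: L_scale)
    then show "c \<in> {c \<in> Rn m. L c \<in> scale_n n l ` Z \<omega> \<inter> range L}" using c by auto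
  qed
  moreover have meas: "scale_n m (1 / l) \<in> V \<rightarrow>\<^sub>M V"
    unfolding scale_n_def volM_def by measurable
  ultimately have "emeasure V {c \<in> Rn m. L c \<in> scale_n n l ` Z \<omega> \<inter> range L} = emeasure (distr V V (scale_n m (1 / l))) ?A"
    using A by (simp add: emeasure_distr)
  also have "\<dots> = ennreal (l ^ m) * section_vol \<omega>"
    using l A by (subst distr_scale_n) (auto simp: emeasure_density_const section_vol_def)
  finally show ?thesis using l by (simp add: measure_def enn2real_mult)
qed

end

section \<open>The cell as a section of itself, and the final probability estimate\<close>

definition std_basis :: "nat \<Rightarrow> nat \<Rightarrow> nat \<Rightarrow> real" where
  "std_basis n j = (\<lambda>i\<in>{..<n}. if i = j then 1 else 0)"

lemma std_basis_in_Rn: "std_basis n j \<in> Rn n"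
  by (simp add: std_basis_def Rn_iff)

lemma lincomb_std_basis: "c \<in> Rn n \<Longrightarrow> lincomb_n n n (std_basis n) c = c"
proof (rule Rn_eqI[of _ n])
  fix i assume i: "i < n"
  have "(\<Sum>j<n. c j * std_basis n j i) = (\<Sum>j<n. if j = i then c j else 0)"
    using i by (intro sum.cong) (auto simp: std_basis_def)
  then show "lincomb_n n n (std_basis n) c i = c i" using i by (simp add: lincomb_n_def)
qed auto

lemma inner_std_basis: "i < n \<Longrightarrow> j < n \<Longrightarrow> inner_n n (std_basis n i) (std_basis n j) = (if i = j then 1 else 0)"
proof -
  assume ij: "i < n" "j < n"
  have "inner_n n (std_basis n i) (std_basis n j) = (\<Sum>l<n. if l = i then if i = j then 1 else 0 else 0)"
    unfolding inner_n_def by (intro sum.cong) (auto simp: std_basis_def)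
  then show ?thesis using ij by simp
qed

text \<open>If W and U each stay within relative distance delta of their means, then W U^(- m / n)
  exceeds (1 - delta) (1 + delta)^(- m / n) times the quotient of the means, and the exponent may be
  enlarged to 1. Failure is thus covered by two Chebyshev events.\<close>

lemma (in hyperplane_process) section_prob_ge:
  assumes r2: "2 < r" and n3: "3 \<le> n" and Lg: "L \<in> grassmannian n (n - 1)" and \<delta>: "0 < \<delta>" "\<delta> < 1"
    and a: "a \<le> (1 - \<delta>) / (1 + \<delta>) * mean_ratio n r"
  shows "section_prob n P X L a \<ge> 1 - (rel_var (n - 1) r + rel_var n r) / \<delta>\<^sup>2"
proof -
  define m where "m = n - 1"
  have m: "real m = real n - 1" "2 \<le> m" using n3 by (auto simp: m_def of_nat_diff)
  define v where "v = (SOME v. is_orthonormal_basis n m v L)"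
  have "\<exists>v. is_orthonormal_basis n m v L"
    using Lg orthonormal_basis_exists unfolding grassmannian_def m_def by blast
  then have ob: "is_orthonormal_basis n m v L" unfolding v_def by (rule someI_ex)
  interpret S: hyperplane_section n r \<gamma> P X m v
    by standard (use ob r2 m in \<open>auto simp: is_orthonormal_basis_def is_basis_def\<close>)
  interpret T: hyperplane_section n r \<gamma> P X n "std_basis n"
    by standard (use r2 n in \<open>auto simp: inner_std_basis std_basis_in_Rn\<close>)
  have L: "L = range (lincomb_n n m v)" using ob by (simp add: is_orthonormal_basis_def is_basis_def)
  define W where "W \<omega> = enn2real (S.section_vol \<omega>)" for \<omega>
  define U where "U \<omega> = enn2real (T.section_vol \<omega>)" for \<omega>
  have U: "U \<omega> = vol n (Z \<omega>)" for \<omega>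
  proof -
    have "{c \<in> Rn n. lincomb_n n n (std_basis n) c \<in> Z \<omega>} = Z \<omega>"
      by (auto simp: lincomb_std_basis Z_def zero_cell_def)
    then show ?thesis by (simp add: U_def T.section_vol_def measure_def)
  qed
  have val: "subspace_vol n (n - 1) L (normalized n (zero_cell n (X \<omega>)) \<inter> L) = U \<omega> powr (- (real m / real n)) * W \<omega>"
    if \<omega>: "\<omega> \<in> space P" for \<omega>
  proof -
    let ?l = "U \<omega> powr (- 1 / real n)"
    have "subspace_vol n (n - 1) L (normalized n (zero_cell n (X \<omega>)) \<inter> L) =
        vol m {c \<in> Rn m. lincomb_n n m v c \<in> scale_n n ?l ` Z \<omega> \<inter> L}"
      by (simp only: subspace_vol_def Let_def m_def[symmetric] v_def[symmetric] normalized_def Z_def U)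
    also have "\<dots> = ?l ^ m * W \<omega>"
      unfolding W_def L by (rule S.measure_scaled_section[OF _ \<omega>]) simp
    also have "?l ^ m = U \<omega> powr (- (real m / real n))"
    proof (cases "U \<omega> = 0")
      case True
      then show ?thesis using m by simp
    next
      case False
      then have "U \<omega> > 0" by (simp add: U_def less_le)
      then show ?thesis by (simp add: powr_realpow[symmetric] powr_powr)
    qed
    finally show ?thesis .
  qed
  have WU [measurable]: "W \<in> borel_measurable P" "U \<in> borel_measurable P"
    unfolding W_def[abs_def] U_def[abs_def] by measurable
  let ?BW = "{\<omega> \<in> space P. \<bar>W \<omega> - S.mean\<bar> \<ge> \<delta> * S.mean}" and ?BU = "{\<omega> \<in> space P. \<bar>U \<omega> - T.mean\<bar> \<ge> \<delta> * T.mean}"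
  let ?E = "{\<omega> \<in> space P. subspace_vol n (n - 1) L (normalized n (zero_cell n (X \<omega>)) \<inter> L) > a}"
  have E: "?E = {\<omega> \<in> space P. U \<omega> powr (- (real m / real n)) * W \<omega> > a}" using val by auto
  have E_sets: "?E \<in> events" unfolding E by measurable
  have B_sets: "?BW \<in> events" "?BU \<in> events" by measurable
  have sub: "space P - ?E \<subseteq> ?BW \<union> ?BU"
  proof (rule ccontr)
    assume "\<not> ?thesis"
    then obtain \<omega> where \<omega>: "\<omega> \<in> space P" "\<omega> \<notin> ?E" "\<omega> \<notin> ?BW" "\<omega> \<notin> ?BU" by blast
    have mp: "S.mean > 0" "T.mean > 0" by (rule S.mean_pos, rule T.mean_pos)
    have "\<bar>W \<omega> - S.mean\<bar> < \<delta> * S.mean" "\<bar>U \<omega> - T.mean\<bar> < \<delta> * T.mean" using \<omega> by auto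
    then have W: "(1 - \<delta>) * S.mean < W \<omega>" and U1: "U \<omega> < (1 + \<delta>) * T.mean" and U2: "(1 - \<delta>) * T.mean < U \<omega>"
      by (auto simp: abs_less_iff algebra_simps)
    have "0 < (1 - \<delta>) * T.mean" using \<delta> mp by simp
    then have U0: "0 < U \<omega>" using U2 by linarith
    have W0: "0 < (1 - \<delta>) * S.mean" using \<delta> mp by simp
    let ?q = "real m / real n"
    have q: "0 \<le> ?q" "?q \<le> 1" using m n by auto
    have "((1 + \<delta>) * T.mean) powr (- ?q) * ((1 - \<delta>) * S.mean) < U \<omega> powr (- ?q) * W \<omega>"
    proof (rule mult_le_less_imp_less)
      show "((1 + \<delta>) * T.mean) powr (- ?q) \<le> U \<omega> powr (- ?q)"
        using U0 U1 q by (intro powr_mono2') auto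
    qed (use W W0 mp \<delta> in auto)
    moreover have "(1 - \<delta>) / (1 + \<delta>) * mean_ratio n r \<le> ((1 + \<delta>) * T.mean) powr (- ?q) * ((1 - \<delta>) * S.mean)"
    proof -
      have G: "kappa (real n) > 0" "Gamma (real n / r + 1) > 0" "kappa (real m) > 0" "Gamma (real m / r + 1) > 0"
        using r by (auto intro!: kappa_pos Gamma_real_pos add_nonneg_pos)
      have "T.mean powr ?q = (kappa (real n) * Gamma (real n / r + 1)) powr ?q * k powr (- real m / r)"
      proof -
        have "T.mean = (kappa (real n) * Gamma (real n / r + 1)) * k powr (- real n / r)" by (simp add: T.mean_def)
        then have "T.mean powr ?q = (kappa (real n) * Gamma (real n / r + 1)) powr ?q * (k powr (- real n / r)) powr ?q"
          using G by (simp add: powr_mult)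
        also have "(k powr (- real n / r)) powr ?q = k powr (- real m / r)"
          using n by (simp add: powr_powr)
        finally show ?thesis .
      qed
      then have ratio: "S.mean / T.mean powr ?q = mean_ratio n r"
        using k_pos by (simp add: S.mean_def mean_ratio_def m(1))
      have "(1 + \<delta>) powr ?q \<le> (1 + \<delta>) powr 1" using q \<delta> by (intro powr_mono) auto
      then have p1: "1 / (1 + \<delta>) \<le> 1 / (1 + \<delta>) powr ?q" using \<delta> by (intro divide_left_mono) auto
      have "(1 - \<delta>) / (1 + \<delta>) * mean_ratio n r = (1 - \<delta>) * (1 / (1 + \<delta>)) * (S.mean / T.mean powr ?q)"
        by (simp add: ratio)
      also have "\<dots> \<le> (1 - \<delta>) * (1 / (1 + \<delta>) powr ?q) * (S.mean / T.mean powr ?q)"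
        using p1 \<delta> mp by (intro mult_right_mono mult_left_mono) auto
      also have "\<dots> = ((1 + \<delta>) * T.mean) powr (- ?q) * ((1 - \<delta>) * S.mean)"
        unfolding powr_minus powr_mult by (simp add: divide_inverse)
      finally show ?thesis .
    qed
    ultimately have "a < U \<omega> powr (- ?q) * W \<omega>" using a by linarith
    then show False using \<omega> unfolding E by blast
  qed
  have "measure P (space P - ?E) \<le> measure P (?BW \<union> ?BU)"
    using sub B_sets by (intro finite_measure_mono) auto
  also have "\<dots> \<le> measure P ?BW + measure P ?BU"
    using B_sets by (intro measure_Un_le) auto
  also have "\<dots> \<le> rel_var m r / \<delta>\<^sup>2 + rel_var n r / \<delta>\<^sup>2"
    unfolding W_def U_def
    by (intro add_mono S.section_vol_concentration T.section_vol_concentration \<delta>)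
  finally have "measure P (space P - ?E) \<le> (rel_var m r + rel_var n r) / \<delta>\<^sup>2" by (simp add: add_divide_distrib)
  then show ?thesis using prob_compl[OF E_sets] by (simp add: section_prob_def m_def)
qed

theorem theorem3p17:
  fixes b \<alpha> :: real
    and P :: "nat \<Rightarrow> 'w measure"
    and X :: "nat \<Rightarrow> 'w \<Rightarrow> (nat \<Rightarrow> real) set set"
    and r :: "nat \<Rightarrow> real"
  assumes r: "\<And>n. r n = b * real n powr \<alpha>"
    and params: "(b > 0 \<and> \<alpha> > 1 / 2) \<or> (b > sqrt 8 \<and> \<alpha> = 1 / 2)"
    and X: "\<And>n. n \<ge> 2 \<Longrightarrow>
              poisson_hyperplane_process n (r n) (gamma_hat (r n) n) (P n) (X n)"
  shows "(\<exists>C>0. \<forall>\<epsilon>\<in>{0<..<sqrt (exp 1)}. \<exists>N::nat. \<forall>n\<ge>N. \<forall>L\<in>grassmannian n (n - 1).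
            section_prob n (P n) (X n) L (sqrt (exp 1) - \<epsilon>)
              \<ge> 1 - C * \<epsilon> powr (-2) * rate_H C \<alpha> b n) \<and>
         (\<forall>\<epsilon>\<in>{0<..<sqrt (exp 1)}. \<forall>L :: nat \<Rightarrow> (nat \<Rightarrow> real) set.
            (\<forall>n\<ge>2. L n \<in> grassmannian n (n - 1)) \<longrightarrow>
            (\<lambda>n. section_prob n (P n) (X n) (L n) (sqrt (exp 1) - \<epsilon>)) \<longlonglongrightarrow> 1)"
proof -
  have b: "b > 0" using params by (auto intro: less_trans[of 0 "sqrt 8"])
  have \<alpha>: "\<alpha> > 0" using params by auto
  obtain C where C: "C > 0" "\<forall>\<^sub>F n in sequentially. \<forall>m\<in>{n - 1, n}. 128 * rel_var m (b * real n powr \<alpha>) \<le> C * rate_H C \<alpha> b n"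
    using rel_var_rate[OF params] by blast
  have sqrt_e: "sqrt (exp 1) < 2"
  proof -
    have "sqrt (exp 1) < sqrt 4" using exp_le by (intro real_sqrt_less_mono) (auto intro: le_less_trans)
    then show ?thesis by simp
  qed
  have proc: "hyperplane_process n (r n) (gamma_hat (r n) n) (P n) (X n)" if "n \<ge> 2" for n
  proof
    show "0 < r n" using b that by (simp add: r)
    then show "0 < gamma_hat (r n) n" using that by (intro gamma_hat_pos) auto
  qed (use X that in auto)
  have main: "\<forall>\<^sub>F n in sequentially. \<forall>L\<in>grassmannian n (n - 1).
            section_prob n (P n) (X n) L (sqrt (exp 1) - \<epsilon>) \<ge> 1 - C * \<epsilon> powr (-2) * rate_H C \<alpha> b n"
    if \<epsilon>: "\<epsilon> \<in> {0<..<sqrt (exp 1)}" for \<epsilon>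
  proof -
    have "filterlim (\<lambda>n. b * real n powr \<alpha>) at_top sequentially" using b \<alpha> by real_asymp
    then have ev_r: "\<forall>\<^sub>F n in sequentially. 3 \<le> b * real n powr \<alpha>" by (simp add: filterlim_at_top)
    have ev_m: "\<forall>\<^sub>F n in sequentially. mean_ratio n (b * real n powr \<alpha>) > sqrt (exp 1) - \<epsilon> / 2"
      using mean_ratio_eventually[OF b \<alpha>, of "\<epsilon> / 2"] \<epsilon> by simp
    show ?thesis using C(2) ev_r ev_m eventually_ge_at_top[of 3]
    proof eventually_elim
      case (elim n)
      interpret hyperplane_process n "r n" "gamma_hat (r n) n" "P n" "X n"
        using elim by (intro proc) simp
      \<comment> \<open>The quotient of the means gives away epsilon / 2. Since (1 - delta) / (1 +
        delta) >= 1 - 2 delta, the deviations give away at most 2 delta sqrt e = epsilon sqrt e / 4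
        < epsilon / 2, because sqrt e < 2.\<close>
      define \<delta> where "\<delta> = \<epsilon> / 8"
      have \<delta>: "0 < \<delta>" "\<delta> < 1" using \<epsilon> sqrt_e by (auto simp: \<delta>_def)
      have small: "sqrt (exp 1) - \<epsilon> \<le> (1 - \<delta>) / (1 + \<delta>) * mean_ratio n (r n)"
      proof -
        have "\<epsilon> * sqrt (exp 1) \<le> \<epsilon> * 2" using sqrt_e \<epsilon> by (intro mult_left_mono) auto
        moreover have "0 \<le> \<epsilon> * \<epsilon>" by simp
        moreover have "(1 - 2 * \<delta>) * (sqrt (exp 1) - \<epsilon> / 2) = sqrt (exp 1) - \<epsilon> / 2 - \<epsilon> * sqrt (exp 1) / 4 + \<epsilon> * \<epsilon> / 8"
          by (simp add: \<delta>_def field_simps)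
        ultimately have "sqrt (exp 1) - \<epsilon> \<le> (1 - 2 * \<delta>) * (sqrt (exp 1) - \<epsilon> / 2)"
          by linarith
        also have "\<dots> \<le> (1 - \<delta>) / (1 + \<delta>) * (sqrt (exp 1) - \<epsilon> / 2)"
        proof (rule mult_right_mono)
          show "1 - 2 * \<delta> \<le> (1 - \<delta>) / (1 + \<delta>)" using \<delta> by (simp add: field_simps)
        qed (use \<epsilon> in auto)
        also have "\<dots> \<le> (1 - \<delta>) / (1 + \<delta>) * mean_ratio n (r n)"
          using elim \<delta> by (intro mult_left_mono) (auto simp: assms(1))
        finally show ?thesis .
      qed
      show ?case
      proof
        fix L assume L: "L \<in> grassmannian n (n - 1)"
        have "section_prob n (P n) (X n) L (sqrt (exp 1) - \<epsilon>) \<ge> 1 - (rel_var (n - 1) (r n) + rel_var n (r n)) / \<delta>\<^sup>2"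
          using elim L \<delta> small by (intro section_prob_ge) (auto simp: assms(1))
        moreover have "(rel_var (n - 1) (r n) + rel_var n (r n)) / \<delta>\<^sup>2 \<le> C * \<epsilon> powr (-2) * rate_H C \<alpha> b n"
        proof -
          \<comment> \<open>Two terms of at most C H / 128 each, divided by delta^2 = epsilon^2 /
            64, give C H / epsilon^2.\<close>
          have "128 * rel_var (n - 1) (r n) + 128 * rel_var n (r n) \<le> C * rate_H C \<alpha> b n + C * rate_H C \<alpha> b n"
            using elim by (intro add_mono) (auto simp: assms(1))
          then have "64 * (rel_var (n - 1) (r n) + rel_var n (r n)) \<le> C * rate_H C \<alpha> b n" by simp
          then have "64 * (rel_var (n - 1) (r n) + rel_var n (r n)) / \<epsilon>\<^sup>2 \<le> C * rate_H C \<alpha> b n / \<epsilon>\<^sup>2"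
            by (intro divide_right_mono) auto
          then show ?thesis using \<epsilon> by (simp add: \<delta>_def power_divide powr_minus field_simps)
        qed
        ultimately show "section_prob n (P n) (X n) L (sqrt (exp 1) - \<epsilon>) \<ge> 1 - C * \<epsilon> powr (-2) * rate_H C \<alpha> b n" by linarith
      qed
    qed
  qed
  show ?thesis
  proof (intro conjI ballI allI impI)
    show "\<exists>C>0. \<forall>\<epsilon>\<in>{0<..<sqrt (exp 1)}. \<exists>N::nat. \<forall>n\<ge>N. \<forall>L\<in>grassmannian n (n - 1).
            section_prob n (P n) (X n) L (sqrt (exp 1) - \<epsilon>) \<ge> 1 - C * \<epsilon> powr (-2) * rate_H C \<alpha> b n"
      using C(1) main unfolding eventually_sequentially by (intro exI[of _ C]) blast
  next
    fix \<epsilon> and L :: "nat \<Rightarrow> (nat \<Rightarrow> real) set"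
    assume \<epsilon>: "\<epsilon> \<in> {0<..<sqrt (exp 1)}" and L: "\<forall>n\<ge>2. L n \<in> grassmannian n (n - 1)"
    have "(\<lambda>n. 1 - C * \<epsilon> powr (-2) * rate_H C \<alpha> b n) \<longlonglongrightarrow> 1 - C * \<epsilon> powr (-2) * 0"
      by (intro tendsto_intros rate_H_tendsto_0[OF params C(1)])
    then have "(\<lambda>n. 1 - C * \<epsilon> powr (-2) * rate_H C \<alpha> b n) \<longlonglongrightarrow> 1" by simp
    moreover note tendsto_const[of "1::real" sequentially]
    moreover have "\<forall>\<^sub>F n in sequentially. 1 - C * \<epsilon> powr (-2) * rate_H C \<alpha> b n \<le> section_prob n (P n) (X n) (L n) (sqrt (exp 1) - \<epsilon>)"
      using main[OF \<epsilon>] eventually_ge_at_top[of 2] by eventually_elim (use L in blast)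
    moreover have "\<forall>\<^sub>F n in sequentially. section_prob n (P n) (X n) (L n) (sqrt (exp 1) - \<epsilon>) \<le> 1"
      using eventually_ge_at_top[of 2]
    proof eventually_elim
      case (elim n)
      interpret hyperplane_process n "r n" "gamma_hat (r n) n" "P n" "X n" using elim by (rule proc)
      show ?case unfolding section_prob_def by (rule prob_le_1)
    qed
    ultimately show "(\<lambda>n. section_prob n (P n) (X n) (L n) (sqrt (exp 1) - \<epsilon>)) \<longlonglongrightarrow> 1"
      by (rule tendsto_sandwich[rotated 2])
  qed
qed

end
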